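(* The $\mathbb{S}$-collection of neat PL pairs forms a unital suboperad of $(\mathsf{relscpx}_{\neq(-,\emptyset)},\{\circ_k^\ast\})$.
   Context: For $n\ge1$ let $[n]=\{1,\dots,n\}$. A simplicial complex on $[n]$ is a family of subsets of $[n]$ closed under taking subsets; ghost vertices (elements $i\in[n]$ with $\{i\}$ not a face) are allowed. A relative simplicial complex on $[n]$ is a pair $(K,L)$ of simplicial complexes on $[n]$ with $L\subseteq K$; $\mathsf{relscpx}_{\neq(-,\emptyset)}(n)$ is the set of those with $L$ not the empty family ($L=\{\emptyset\}$ is allowed), $n\ge1$, with $\mathbb{S}_n$ acting by relabelling. The join of $K_1$ on $[n_1]$ and $K_2$ on $[n_2]$ is $K_1\ast K_2=\{I_1\sqcup(I_2+n_1)\mid I_1\in K_1,I_2\in K_2\}$ on $[n_1+n_2]$, with $I+\ell=\{i+\ell\mid i\in I\}$. Let $\mathrm{pt}=\{\emptyset,\{1\}\}$ on $[1]$. For $K$ on $[n]$, $k\in[n]$ and a relative simplicial complex $(M,N)$ on $[m]$, $K\triangleleft_k^\ast(M,N)=\bigcup_{I\in K}P_1^I\ast\cdots\ast P_n^I$, where for $j\neq k$, $P_j^I=\mathrm{pt}$ if $j\in I$ and $P_j^I=\{\emptyset\}$ (on $[1]$) if $j\notin I$, while $P_k^I=M$ if $k\in I$ and $P_k^I=N$ if $k\notin I$. The operad structure on $\mathsf{relscpx}_{\neq(-,\emptyset)}$ is $(K,L)\circ_k^\ast(M,N)=(K\triangleleft_k^\ast(M,N),L\triangleleft_k^\ast(M,N))$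 with unit $(\mathrm{pt},\{\emptyset\})$. A PL sphere is a simplicial complex whose geometric realization is PL homeomorphic to a sphere and such that the link of every face is also a PL sphere ($\{\emptyset\}$ is the $(-1)$-sphere); a PL ball is a simplicial complex whose geometric realization is PL homeomorphic to a ball and such that the link of every face is a PL sphere or a PL ball. Both may have ghost vertices. The boundary $\partial B$ of a PL ball $B$ is the subcomplex triangulating its boundary sphere (and is $\{\emptyset\}$ for a $0$-ball). A neat PL pair is a relative simplicial complex $(B,\partial B)$ where $B$ is a PL ball with no interior vertices, i.e. every (non-ghost) vertex of $B$ is a vertex of $\partial B$; the unit $(\mathrm{pt},\{\emptyset\})$ on $[1]$ is by convention counted as a neat PL pair. *)

theory Defs
  imports "HOL-Analysis.Analysis" "HOL-Analysis.Finite_Function_Topology"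
    "HOL-Combinatorics.Permutations"
begin

section \<open>Operads in terms of partial compositions\<close>

text \<open>
  The carrier at arity \<open>n\<close> is \<open>P n\<close>, a permutation \<open>\<sigma>\<close> of \<open>{1..n}\<close> acts by \<open>act n \<sigma>\<close>, and
  \<open>pcomp n k m x y\<close> is \<open>x \<circ>\<^sub>k y\<close> for \<open>x \<in> P n\<close>, \<open>y \<in> P m\<close> and \<open>k \<in> {1..n}\<close>. The arities are explicit
  arguments because a family of sets that may have ghost vertices does not determine its
  ground set.

  In the inputs \<open>{1..n+m-1}\<close> of \<open>x \<circ>\<^sub>k y\<close>, input \<open>j \<noteq> k\<close> of \<open>x\<close> is at position
  \<open>outer_pos k m j\<close> and input \<open>b\<close> of \<open>y\<close> is at position \<open>b + k - 1\<close>. The permutation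
  \<open>block_perm n k m \<sigma> \<tau>\<close> of \<open>{1..n+m-1}\<close> is the one usually written \<open>\<sigma> \<circ>\<^sub>k \<tau>\<close>.
\<close>

definition outer_pos :: "nat \<Rightarrow> nat \<Rightarrow> nat \<Rightarrow> nat" where
  "outer_pos k m j = (if j < k then j else j + m - 1)"

definition block_perm ::
    "nat \<Rightarrow> nat \<Rightarrow> nat \<Rightarrow> (nat \<Rightarrow> nat) \<Rightarrow> (nat \<Rightarrow> nat) \<Rightarrow> nat \<Rightarrow> nat" where
  "block_perm n k m \<sigma> \<tau> p =
    (if p \<notin> {1..n + m - 1} then p
     else if p < k then outer_pos (\<sigma> k) m (\<sigma> p)
     else if p \<le> k + m - 1 then \<tau> (p - (k - 1)) + \<sigma> k - 1
     else outer_pos (\<sigma> k) m (\<sigma> (p - (m - 1))))"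

locale unital_operad =
  fixes P :: "nat \<Rightarrow> 'a set"
    and act :: "nat \<Rightarrow> (nat \<Rightarrow> nat) \<Rightarrow> 'a \<Rightarrow> 'a"
    and pcomp :: "nat \<Rightarrow> nat \<Rightarrow> nat \<Rightarrow> 'a \<Rightarrow> 'a \<Rightarrow> 'a"
    and unit :: 'a
  assumes act_closed: "\<lbrakk>\<sigma> permutes {1..n}; x \<in> P n\<rbrakk> \<Longrightarrow> act n \<sigma> x \<in> P n"
    and act_id: "x \<in> P n \<Longrightarrow> act n id x = x"
    and act_compose: "\<lbrakk>\<sigma> permutes {1..n}; \<tau> permutes {1..n}; x \<in> P n\<rbrakk>
          \<Longrightarrow> act n (\<sigma> \<circ> \<tau>) x = act n \<sigma> (act n \<tau> x)"
    and comp_closed: "\<lbrakk>x \<in> P n; y \<in> P m; k \<in> {1..n}\<rbrakk> \<Longrightarrow> pcomp n k m x y \<in> P (n + m - 1)"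
    and comp_sequential: "\<lbrakk>x \<in> P l; y \<in> P m; z \<in> P n; i \<in> {1..l}; j \<in> {1..m}\<rbrakk>
          \<Longrightarrow> pcomp (l + m - 1) (i + j - 1) n (pcomp l i m x y) z
            = pcomp l i (m + n - 1) x (pcomp m j n y z)"
    and comp_parallel: "\<lbrakk>x \<in> P l; y \<in> P m; z \<in> P n; i \<in> {1..l}; k \<in> {1..l}; i < k\<rbrakk>
          \<Longrightarrow> pcomp (l + m - 1) (k + m - 1) n (pcomp l i m x y) z
            = pcomp (l + n - 1) i m (pcomp l k n x z) y"
    and comp_equivariant: "\<lbrakk>x \<in> P n; y \<in> P m; k \<in> {1..n};
            \<sigma> permutes {1..n}; \<tau> permutes {1..m}\<rbrakk>
          \<Longrightarrow> pcomp n (\<sigma> k) m (act n \<sigma> x) (act m \<tau> y)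
            = act (n + m - 1) (block_perm n k m \<sigma> \<tau>) (pcomp n k m x y)"
    and unit_closed: "unit \<in> P 1"
    and unit_left: "x \<in> P n \<Longrightarrow> pcomp 1 1 n unit x = x"
    and unit_right: "\<lbrakk>x \<in> P n; k \<in> {1..n}\<rbrakk> \<Longrightarrow> pcomp n k 1 x unit = x"

locale unital_suboperad = unital_operad P act pcomp unit
  for P :: "nat \<Rightarrow> 'a set" and act pcomp unit +
  fixes Q :: "nat \<Rightarrow> 'a set"
  assumes sub_subset: "Q n \<subseteq> P n"
    and sub_act_closed: "\<lbrakk>\<sigma> permutes {1..n}; x \<in> Q n\<rbrakk> \<Longrightarrow> act n \<sigma> x \<in> Q n"
    and sub_comp_closed: "\<lbrakk>x \<in> Q n; y \<in> Q m; k \<in> {1..n}\<rbrakk> \<Longrightarrow> pcomp n k m x y \<in> Q (n + m - 1)"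
    and sub_unit_closed: "unit \<in> Q 1"


section \<open>Simplicial complexes and the operad of relative simplicial complexes\<close>

text \<open>The empty family is a simplicial complex, distinct from \<open>{{}}\<close>; ghost vertices are allowed.\<close>

definition scpx :: "nat \<Rightarrow> nat set set \<Rightarrow> bool" where
  "scpx n K \<longleftrightarrow> K \<subseteq> Pow {1..n} \<and> (\<forall>I\<in>K. \<forall>J. J \<subseteq> I \<longrightarrow> J \<in> K)"

definition link :: "nat set set \<Rightarrow> nat set \<Rightarrow> nat set set" where
  "link K I = {J. I \<inter> J = {} \<and> I \<union> J \<in> K}"

definition vertices :: "nat set set \<Rightarrow> nat set" where
  "vertices K = {i. {i} \<in> K}"

definition relscpx :: "nat \<Rightarrow> (nat set set \<times> nat set set) set" where
  "relscpx n = {(K, L). 1 \<le> n \<and> scpx n K \<and> scpx n L \<and> L \<subseteq> K \<and> L \<noteq> {}}"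

definition relabel ::
    "(nat \<Rightarrow> nat) \<Rightarrow> nat set set \<times> nat set set \<Rightarrow> nat set set \<times> nat set set" where
  "relabel \<sigma> = (\<lambda>(K, L). ((`) \<sigma> ` K, (`) \<sigma> ` L))"

definition pt :: "nat set set" where
  "pt = {{}, {1}}"

text \<open>\<open>join n\<^sub>1 K\<^sub>1 K\<^sub>2\<close> is the join of \<open>K\<^sub>1\<close> on \<open>{1..n\<^sub>1}\<close> with \<open>K\<^sub>2\<close>, whose vertices are shifted by \<open>n\<^sub>1\<close>.\<close>

definition join :: "nat \<Rightarrow> nat set set \<Rightarrow> nat set set \<Rightarrow> nat set set" where
  "join n\<^sub>1 K\<^sub>1 K\<^sub>2 = {I\<^sub>1 \<union> (\<lambda>i. i + n\<^sub>1) ` I\<^sub>2 | I\<^sub>1 I\<^sub>2. I\<^sub>1 \<in> K\<^sub>1 \<and> I\<^sub>2 \<in> K\<^sub>2}"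

text \<open>
  \<open>join_seq a F n\<close> is \<open>F 1 * \<dots> * F n\<close>, where \<open>F j\<close> is a complex on \<open>{1..a j}\<close>. The empty join
  \<open>{{}}\<close> on \<open>{1..0}\<close> is neutral for the join.
\<close>

fun join_seq :: "(nat \<Rightarrow> nat) \<Rightarrow> (nat \<Rightarrow> nat set set) \<Rightarrow> nat \<Rightarrow> nat set set" where
  "join_seq a F 0 = {{}}"
| "join_seq a F (Suc n) = join (\<Sum>j=1..n. a j) (join_seq a F n) (F (Suc n))"

text \<open>\<open>triangle_join n k m K (M, N)\<close> is the complex \<open>K \<triangleleft>\<^sub>k\<^sup>* (M, N)\<close> for \<open>K\<close> on \<open>{1..n}\<close> and \<open>(M, N)\<close> on \<open>{1..m}\<close>.\<close>

definition triangle_join ::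
    "nat \<Rightarrow> nat \<Rightarrow> nat \<Rightarrow> nat set set \<Rightarrow> nat set set \<times> nat set set \<Rightarrow> nat set set" where
  "triangle_join n k m K = (\<lambda>(M, N). \<Union>I\<in>K.
     join_seq (\<lambda>j. if j = k then m else 1)
       (\<lambda>j. if j = k then (if k \<in> I then M else N) else (if j \<in> I then pt else {{}})) n)"

definition rel_comp ::
    "nat \<Rightarrow> nat \<Rightarrow> nat \<Rightarrow> nat set set \<times> nat set set \<Rightarrow> nat set set \<times> nat set set
      \<Rightarrow> nat set set \<times> nat set set" where
  "rel_comp n k m = (\<lambda>(K, L) MN. (triangle_join n k m K MN, triangle_join n k m L MN))"

definition rel_unit :: "nat set set \<times> nat set set" where
  "rel_unit = (pt, {{}})"


section \<open>PL topology\<close>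

text \<open>
  The real vector space \<open>(nat, real) poly_mapping\<close> of finitely supported functions, with basis
  \<open>Poly_Mapping.single i 1\<close>, serves as ambient space for the complexes of all arities. All
  complexes below are finite, so their realizations lie in a finite-dimensional coordinate
  subspace.
\<close>

definition realization :: "nat set set \<Rightarrow> (nat, real) poly_mapping set" where
  "realization K = (\<Union>I\<in>K. convex hull ((\<lambda>i. Poly_Mapping.single i 1) ` I))"

text \<open>
  A map on a compact polyhedron \<open>S\<close> is PL if it is continuous and \<open>S\<close> is a finite union of convex
  polytopes on each of which the map is affine.
\<close>

definition pl_on ::
    "'a::real_normed_vector set \<Rightarrow> ('a \<Rightarrow> 'b::real_normed_vector) \<Rightarrow> bool" where
  "pl_on S f \<longleftrightarrow> continuous_on S f \<and>
     (\<exists>\<C>. finite \<C> \<and> \<Union>\<C> = S \<and>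
        (\<forall>C\<in>\<C>. polytope C \<and> (\<exists>h c. linear h \<and> (\<forall>x\<in>C. f x = h x + c))))"

definition pl_homeomorphism ::
    "'a::real_normed_vector set \<Rightarrow> 'b::real_normed_vector set \<Rightarrow> ('a \<Rightarrow> 'b) \<Rightarrow> ('b \<Rightarrow> 'a) \<Rightarrow> bool"
  where
  "pl_homeomorphism S T f g \<longleftrightarrow> homeomorphism S T f g \<and> pl_on S f \<and> pl_on T g"

definition pl_homeomorphic ::
    "'a::real_normed_vector set \<Rightarrow> 'b::real_normed_vector set \<Rightarrow> bool" where
  "pl_homeomorphic S T \<longleftrightarrow> (\<exists>f g. pl_homeomorphism S T f g)"

text \<open>
  The standard PL \<open>d\<close>-ball is the \<open>d\<close>-simplex and the standard PL \<open>(d-1)\<close>-sphere is its boundary;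
  for \<open>d = 0\<close> the latter is empty, the realization of \<open>{{}}\<close>.
\<close>

definition std_ball :: "nat \<Rightarrow> (nat, real) poly_mapping set" where
  "std_ball d = realization (Pow {1..d + 1})"

definition std_sphere :: "nat \<Rightarrow> (nat, real) poly_mapping set" where
  "std_sphere d = realization (Pow {1..d + 1} - {{1..d + 1}})"

text \<open>
  The link of the empty face is the complex itself, so the recursion is over nonempty faces, whose
  links have fewer faces. The condition \<open>{} \<in> K\<close> excludes the empty family, which has the same
  realization as the \<open>(-1)\<close>-sphere \<open>{{}}\<close>.
\<close>

inductive pl_sphere :: "nat \<Rightarrow> nat set set \<Rightarrow> bool" for n where
  "\<lbrakk>scpx n K; {} \<in> K; pl_homeomorphic (realization K) (std_sphere d);
    \<forall>I\<in>K. I \<noteq> {} \<longrightarrow> pl_sphere n (link K I)\<rbrakk> \<Longrightarrow> pl_sphere n K"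

inductive pl_ball :: "nat \<Rightarrow> nat set set \<Rightarrow> bool" for n where
  "\<lbrakk>scpx n K; pl_homeomorphic (realization K) (std_ball d);
    \<forall>I\<in>K. I \<noteq> {} \<longrightarrow> pl_sphere n (link K I) \<or> pl_ball n (link K I)\<rbrakk> \<Longrightarrow> pl_ball n K"

text \<open>
  \<open>L\<close> is the subcomplex of the PL ball \<open>B\<close> on \<open>{1..n}\<close> that triangulates the boundary sphere. For a
  \<open>0\<close>-ball that sphere is empty, and \<open>{} \<in> L\<close> forces \<open>L = {{}}\<close>.
\<close>

definition is_boundary :: "nat \<Rightarrow> nat set set \<Rightarrow> nat set set \<Rightarrow> bool" where
  "is_boundary n B L \<longleftrightarrow> scpx n L \<and> L \<subseteq> B \<and> {} \<in> L \<and>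
     (\<exists>d f g. pl_homeomorphism (realization B) (std_ball d) f g \<and>
        f ` realization L = std_sphere d)"

definition neat_pl_pairs :: "nat \<Rightarrow> (nat set set \<times> nat set set) set" where
  "neat_pl_pairs n =
     {(B, L) \<in> relscpx n. pl_ball n B \<and> is_boundary n B L \<and> vertices B \<subseteq> vertices L} \<union>
     (if n = 1 then {rel_unit} else {})"


section \<open>The relative simplicial complexes form an operad\<close>

text \<open>
  A subset \<open>J\<close> of \<open>{1..n+m-1}\<close> splits into \<open>outer_part n k m J\<close>, a subset of \<open>{1..n} - {k}\<close>, and
  \<open>inner_part k m J\<close>, a subset of \<open>{1..m}\<close>; \<open>triangle_join_iff\<close> describes the faces of
  \<open>K \<triangleleft>\<^sub>k\<^sup>* (M, N)\<close> in these terms.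
\<close>

lemma join_seq_iff:
  assumes "\<And>j. F j \<subseteq> Pow {1..a j}"
  shows "J \<in> join_seq a F n \<longleftrightarrow> J \<subseteq> {1..(\<Sum>j=1..n. a j)} \<and>
    (\<forall>j\<in>{1..n}. {i\<in>{1..a j}. i + (\<Sum>l\<in>{1..<j}. a l) \<in> J} \<in> F j)"
proof (induction n arbitrary: J)
  case 0 show ?case by auto
next
  case (Suc n)
  let ?s = "\<Sum>j=1..n. a j"
  have s: "(\<Sum>l\<in>{1..<Suc n}. a l) = ?s" by (simp add: atLeastLessThanSuc_atLeastAtMost)
  have sS: "(\<Sum>j=1..Suc n. a j) = ?s + a (Suc n)" by simp
  have le: "i + (\<Sum>l\<in>{1..<j}. a l) \<le> ?s" if "j \<in> {1..n}" "i \<le> a j" for i j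
  proof -
    have "i + (\<Sum>l\<in>{1..<j}. a l) \<le> (\<Sum>l\<in>{1..<Suc j}. a l)" using that by simp
    also have "\<dots> \<le> ?s" by (rule sum_mono2) (use that in auto)
    finally show ?thesis .
  qed
  have jm: "J \<in> join ?s (join_seq a F n) (F (Suc n)) \<longleftrightarrow>
     J \<subseteq> {1..?s + a (Suc n)} \<and> J \<inter> {1..?s} \<in> join_seq a F n \<and> {i\<in>{1..a (Suc n)}. i + ?s \<in> J} \<in> F (Suc n)"
    (is "?l = ?r")
  proof
    assume ?l
    then obtain I1 I2 where J: "J = I1 \<union> (\<lambda>i. i + ?s) ` I2" and I: "I1 \<in> join_seq a F n" "I2 \<in> F (Suc n)"
      by (auto simp: join_def)
    have I1: "I1 \<subseteq> {1..?s}" using I(1) Suc by blast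
    have I2: "I2 \<subseteq> {1..a (Suc n)}" using I(2) assms by blast
    have "J \<inter> {1..?s} = I1" "{i\<in>{1..a (Suc n)}. i + ?s \<in> J} = I2" "J \<subseteq> {1..?s + a (Suc n)}"
      using I1 I2 unfolding J by fastforce+
    then show ?r using I by simp
  next
    assume r: ?r
    have "J = (J \<inter> {1..?s}) \<union> (\<lambda>i. i + ?s) ` {i\<in>{1..a (Suc n)}. i + ?s \<in> J}"
    proof (intro equalityI subsetI)
      fix x assume x: "x \<in> J"
      show "x \<in> (J \<inter> {1..?s}) \<union> (\<lambda>i. i + ?s) ` {i\<in>{1..a (Suc n)}. i + ?s \<in> J}"
      proof (cases "x \<le> ?s")
        case True then show ?thesis using x r by auto
      next
        case False
        then have "x = (x - ?s) + ?s" "x - ?s \<in> {i\<in>{1..a (Suc n)}. i + ?s \<in> J}" using x r by auto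
        then show ?thesis by blast
      qed
    qed auto
    then show ?l using r unfolding join_def by blast
  qed
  have eq: "{i\<in>{1..a j}. i + (\<Sum>l\<in>{1..<j}. a l) \<in> J \<inter> {1..?s}} = {i\<in>{1..a j}. i + (\<Sum>l\<in>{1..<j}. a l) \<in> J}"
    if "j \<in> {1..n}" for j using le[OF that] by fastforce
  have ins: "{1..Suc n} = insert (Suc n) {1..n}" by auto
  have B: "(\<forall>j\<in>{1..n}. {i\<in>{1..a j}. i + (\<Sum>l\<in>{1..<j}. a l) \<in> J \<inter> {1..?s}} \<in> F j) \<longleftrightarrow>
     (\<forall>j\<in>{1..n}. {i\<in>{1..a j}. i + (\<Sum>l\<in>{1..<j}. a l) \<in> J} \<in> F j)"
    by (rule ball_cong[OF refl]) (simp only: eq)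
  show ?case
    unfolding join_seq.simps jm Suc.IH sS B
    unfolding ins ball_simps(7) s by blast
qed

lemma ball_split: "k \<in> A \<Longrightarrow> (\<forall>j\<in>A. Q j) \<longleftrightarrow> (\<forall>j\<in>A. j \<noteq> k \<longrightarrow> Q j) \<and> Q k" by metis

definition outer_part where "outer_part n k m J = {j\<in>{1..n}. j \<noteq> k \<and> outer_pos k m j \<in> J}"
definition inner_part where "inner_part k m J = {b\<in>{1..m}. b + k - 1 \<in> J}"

lemma mem_outer_part: "x \<in> outer_part n k m J \<longleftrightarrow> x \<in> {1..n} \<and> x \<noteq> k \<and> outer_pos k m x \<in> J" by (simp add: outer_part_def)
lemma mem_inner_part: "x \<in> inner_part k m J \<longleftrightarrow> x \<in> {1..m} \<and> x + k - 1 \<in> J" by (simp add: inner_part_def)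

lemma triangle_join_iff:
  assumes "scpx n K" "scpx m M" "scpx m N" "N \<subseteq> M" "k \<in> {1..n}" "1 \<le> m"
  shows "J \<in> triangle_join n k m K (M,N) \<longleftrightarrow> J \<subseteq> {1..n+m-1} \<and>
    ((insert k (outer_part n k m J) \<in> K \<and> inner_part k m J \<in> M) \<or> (outer_part n k m J \<in> K \<and> inner_part k m J \<in> N))"
proof -
  let ?a = "\<lambda>j. if j = k then m else (1::nat)"
  let ?F = "\<lambda>I j. if j = k then (if k \<in> I then M else N) else (if j \<in> I then pt else {{}})"
  have ss: "(\<Sum>l\<in>{1..<j}. ?a l) = (if j \<le> k then j - 1 else j + m - 2)" if "j \<in> {1..Suc n}" for j
  proof -
    have "(\<Sum>l\<in>{1..<j}. ?a l) = (\<Sum>l\<in>{1..<j}. 1 + (if l = k then m - 1 else 0))"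
      by (rule sum.cong) (use assms in auto)
    also have "\<dots> = (j - 1) + (if k \<in> {1..<j} then m - 1 else 0)"
      unfolding sum.distrib by simp
    finally show ?thesis using that assms by auto
  qed
  have tot: "(\<Sum>l=1..n. ?a l) = n + m - 1"
    using ss[of "Suc n"] assms by (simp add: atLeastLessThanSuc_atLeastAtMost)
  have F: "?F I j \<subseteq> Pow {1..?a j}" for I j
    using assms by (auto simp: scpx_def pt_def)
  have cond: "(\<forall>j\<in>{1..n}. {i\<in>{1..?a j}. i + (\<Sum>l\<in>{1..<j}. ?a l) \<in> J} \<in> ?F I j)
     \<longleftrightarrow> outer_part n k m J \<subseteq> I \<and> inner_part k m J \<in> (if k \<in> I then M else N)" for I
  proof -
    have k: "{i\<in>{1..?a k}. i + (\<Sum>l\<in>{1..<k}. ?a l) \<in> J} = inner_part k m J"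
      using ss[of k] assms by (auto simp: inner_part_def)
    have nk: "({i\<in>{1..?a j}. i + (\<Sum>l\<in>{1..<j}. ?a l) \<in> J} \<in> ?F I j) \<longleftrightarrow> (outer_pos k m j \<in> J \<longrightarrow> j \<in> I)"
      if j: "j \<in> {1..n}" "j \<noteq> k" for j
    proof -
      have "1 + (\<Sum>l\<in>{1..<j}. ?a l) = outer_pos k m j"
        using ss[of j] j assms by (auto simp: outer_pos_def)
      then have "{i\<in>{1..?a j}. i + (\<Sum>l\<in>{1..<j}. ?a l) \<in> J} = (if outer_pos k m j \<in> J then {1} else {})"
        using j by auto
      then show ?thesis using j by (auto simp: pt_def)
    qed
    have "(\<forall>j\<in>{1..n}. {i\<in>{1..?a j}. i + (\<Sum>l\<in>{1..<j}. ?a l) \<in> J} \<in> ?F I j) \<longleftrightarrow>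
      (\<forall>j\<in>{1..n}. j \<noteq> k \<longrightarrow> (outer_pos k m j \<in> J \<longrightarrow> j \<in> I)) \<and> inner_part k m J \<in> ?F I k"
      (is "(\<forall>j\<in>_. ?Q j) \<longleftrightarrow> _")
    proof -
      have "(\<forall>j\<in>{1..n}. ?Q j) \<longleftrightarrow> (\<forall>j\<in>{1..n}. j \<noteq> k \<longrightarrow> ?Q j) \<and> ?Q k"
        by (rule ball_split[OF assms(5)])
      also have "(\<forall>j\<in>{1..n}. j \<noteq> k \<longrightarrow> ?Q j) \<longleftrightarrow> (\<forall>j\<in>{1..n}. j \<noteq> k \<longrightarrow> (outer_pos k m j \<in> J \<longrightarrow> j \<in> I))"
        using nk by blast
      finally show ?thesis unfolding k .
    qed
    then show ?thesis by (auto simp: outer_part_def)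
  qed
  have "J \<in> triangle_join n k m K (M,N) \<longleftrightarrow> J \<subseteq> {1..n+m-1} \<and>
     (\<exists>I\<in>K. outer_part n k m J \<subseteq> I \<and> inner_part k m J \<in> (if k \<in> I then M else N))"
  proof -
    have "J \<in> triangle_join n k m K (M,N) \<longleftrightarrow> (\<exists>I\<in>K. J \<in> join_seq ?a (?F I) n)"
      unfolding triangle_join_def prod.case UN_iff ..
    also have "\<dots> \<longleftrightarrow> (\<exists>I\<in>K. J \<subseteq> {1..n+m-1} \<and> outer_part n k m J \<subseteq> I \<and> inner_part k m J \<in> (if k \<in> I then M else N))"
    proof (rule bex_cong[OF refl])
      fix I
      show "J \<in> join_seq ?a (?F I) n \<longleftrightarrow> J \<subseteq> {1..n+m-1} \<and> outer_part n k m J \<subseteq> I \<and> inner_part k m J \<in> (if k \<in> I then M else N)"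
        unfolding join_seq_iff[OF F] tot using cond[of I] by (rule conj_cong[OF refl])
    qed
    finally show ?thesis by blast
  qed
  also have "(\<exists>I\<in>K. outer_part n k m J \<subseteq> I \<and> inner_part k m J \<in> (if k \<in> I then M else N)) \<longleftrightarrow>
    ((insert k (outer_part n k m J) \<in> K \<and> inner_part k m J \<in> M) \<or> (outer_part n k m J \<in> K \<and> inner_part k m J \<in> N))" (is "?l = ?r")
  proof
    assume ?l
    then obtain I where I: "I \<in> K" "outer_part n k m J \<subseteq> I" "inner_part k m J \<in> (if k \<in> I then M else N)" by blast
    have d: "\<And>X. X \<subseteq> I \<Longrightarrow> X \<in> K" using I(1) assms(1) by (auto simp: scpx_def)
    show ?r using I d[of "outer_part n k m J"] d[of "insert k (outer_part n k m J)"] by (auto split: if_splits)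
  next
    have "k \<notin> outer_part n k m J" by (auto simp: outer_part_def)
    moreover assume ?r
    ultimately show ?l using assms(4)
      by (metis insertI1 subset_insertI order_refl)
  qed
  finally show ?thesis .
qed

lemma triangle_join_scpx:
  assumes "scpx n K" "scpx m M" "scpx m N" "N \<subseteq> M" "k \<in> {1..n}" "1 \<le> m"
  shows "scpx (n+m-1) (triangle_join n k m K (M,N))"
proof -
  have mono: "outer_part n k m J \<subseteq> outer_part n k m I" "inner_part k m J \<subseteq> inner_part k m I" if "J \<subseteq> I" for I J
    using that by (auto simp: outer_part_def inner_part_def)
  have d: "X \<in> C" if "Y \<in> C" "X \<subseteq> Y" "scpx q C" for X Y C q using that by (auto simp: scpx_def)
  show ?thesis unfolding scpx_def
  proof (intro conjI ballI allI impI)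
    show "triangle_join n k m K (M,N) \<subseteq> Pow {1..n+m-1}" using triangle_join_iff[OF assms] by auto
    fix I J assume "I \<in> triangle_join n k m K (M,N)" and JI: "J \<subseteq> I"
    then show "J \<in> triangle_join n k m K (M,N)" unfolding triangle_join_iff[OF assms]
      using mono[OF JI] d assms
      by (smt (verit, best) insert_mono subset_trans)
  qed
qed

lemma outer_part_seq: 
  assumes "i \<in> {1..l}" "j \<in> {1..m}" "1 \<le> n"
  shows "outer_part l i m (insert (i+j-1) (outer_part (l+m-1) (i+j-1) n J)) = outer_part l i (m+n-1) J"
    "outer_part l i m (outer_part (l+m-1) (i+j-1) n J) = outer_part l i (m+n-1) J"
    "inner_part i m (insert (i+j-1) (outer_part (l+m-1) (i+j-1) n J)) = insert j (outer_part m j n (inner_part i (m+n-1) J))"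
    "inner_part i m (outer_part (l+m-1) (i+j-1) n J) = outer_part m j n (inner_part i (m+n-1) J)"
    "inner_part (i+j-1) n J = inner_part j n (inner_part i (m+n-1) J)"
proof -
  have e: "outer_pos (i+j-1) n (outer_pos i m a) = outer_pos i (m+n-1) a" 
     "outer_pos i m a \<in> {1..l+m-1}" "outer_pos i m a \<noteq> i+j-1"
    if "a \<in> {1..l}" "a \<noteq> i" for a using that assms by (auto simp: outer_pos_def)
  have e2: "outer_pos (i+j-1) n (b+i-1) = outer_pos j n b + i - 1" 
     "b+i-1 \<in> {1..l+m-1}" "b+i-1 \<noteq> i+j-1" "outer_pos j n b \<in> {1..m+n-1}"
    if "b \<in> {1..m}" "b \<noteq> j" for b using that assms by (auto simp: outer_pos_def)
  show "outer_part l i m (insert (i+j-1) (outer_part (l+m-1) (i+j-1) n J)) = outer_part l i (m+n-1) J"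
    "outer_part l i m (outer_part (l+m-1) (i+j-1) n J) = outer_part l i (m+n-1) J"
    using e unfolding outer_part_def by auto
  show "inner_part i m (outer_part (l+m-1) (i+j-1) n J) = outer_part m j n (inner_part i (m+n-1) J)"
  proof (rule set_eqI)
    fix b
    have r: "b \<in> inner_part i m (outer_part (l+m-1) (i+j-1) n J) \<longleftrightarrow> b \<in> {1..m} \<and> b+i-1 \<in> {1..l+m-1} \<and> b+i-1 \<noteq> i+j-1 \<and> outer_pos (i+j-1) n (b+i-1) \<in> J"
      by (simp only: outer_part_def inner_part_def mem_Collect_eq)
    have r2: "b \<in> outer_part m j n (inner_part i (m+n-1) J) \<longleftrightarrow> b \<in> {1..m} \<and> b \<noteq> j \<and> outer_pos j n b \<in> {1..m+n-1} \<and> outer_pos j n b + i - 1 \<in> J"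
      by (simp only: outer_part_def inner_part_def mem_Collect_eq)
    have ji: "j + i - 1 = i + j - 1" by simp
    show "b \<in> inner_part i m (outer_part (l+m-1) (i+j-1) n J) \<longleftrightarrow> b \<in> outer_part m j n (inner_part i (m+n-1) J)"
      unfolding r r2 using e2[of b] ji by metis
  qed
  then have "inner_part i m (insert (i+j-1) (outer_part (l+m-1) (i+j-1) n J)) = inner_part i m {i+j-1} \<union> outer_part m j n (inner_part i (m+n-1) J)"
    unfolding inner_part_def by blast
  moreover have "inner_part i m {i+j-1} = {j}" using assms by (auto simp: inner_part_def)
  ultimately show "inner_part i m (insert (i+j-1) (outer_part (l+m-1) (i+j-1) n J)) = insert j (outer_part m j n (inner_part i (m+n-1) J))"
    by simp
  have "b + (i+j-1) - 1 = b + j - 1 + i - 1" "b+j-1 \<in> {1..m+n-1}" if "b \<in> {1..n}" for b using that assms by auto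
  then show "inner_part (i+j-1) n J = inner_part j n (inner_part i (m+n-1) J)"
    unfolding inner_part_def by auto
qed

lemma triangle_join_mono: "\<lbrakk>L \<subseteq> K\<rbrakk> \<Longrightarrow> triangle_join n k m L MN \<subseteq> triangle_join n k m K MN"
  by (auto simp: triangle_join_def)

lemma seq_reassoc: "(S \<and> (((a \<and> b) \<or> (c \<and> d)) \<and> e \<or> ((a \<and> f) \<or> (c \<and> g)) \<and> h)) =
  (S \<and> ((a \<and> ((b \<and> e) \<or> (f \<and> h))) \<or> (c \<and> ((d \<and> e) \<or> (g \<and> h)))))" by auto
lemma par_reassoc: "(S \<and> (((a \<and> m) \<or> (b \<and> m')) \<and> e \<or> ((c \<and> m) \<or> (d \<and> m')) \<and> h)) =
  (S \<and> (((a \<and> e) \<or> (c \<and> h)) \<and> m \<or> ((b \<and> e) \<or> (d \<and> h)) \<and> m'))" by auto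

lemma triangle_join_seq:
  assumes K: "scpx l K" and M: "scpx m M" "scpx m M'" "M' \<subseteq> M" and N: "scpx n N" "scpx n N'" "N' \<subseteq> N"
    and ij: "i \<in> {1..l}" "j \<in> {1..m}" and n: "1 \<le> n"
  shows "triangle_join (l+m-1) (i+j-1) n (triangle_join l i m K (M,M')) (N,N') =
    triangle_join l i (m+n-1) K (triangle_join m j n M (N,N'), triangle_join m j n M' (N,N'))"
proof -
  have m: "1 \<le> m" using ij by auto
  have s: "scpx (l+m-1) (triangle_join l i m K (M,M'))" by (rule triangle_join_scpx) (use assms m in auto)
  have t: "scpx (m+n-1) (triangle_join m j n M (N,N'))" "scpx (m+n-1) (triangle_join m j n M' (N,N'))"
    by (rule triangle_join_scpx; use assms in auto)+
  have p: "i+j-1 \<in> {1..l+m-1}" "1 \<le> m+n-1" using assms by auto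
  have sub: "insert (i+j-1) (outer_part (l+m-1) (i+j-1) n J) \<subseteq> {1..l+m-1}" "outer_part (l+m-1) (i+j-1) n J \<subseteq> {1..l+m-1}" 
     "inner_part i (m+n-1) J \<subseteq> {1..m+n-1}" for J using p by (auto simp: outer_part_def inner_part_def)
  have ar: "l+m-1+n-1 = l+(m+n-1)-1" using assms m by auto
  show ?thesis
    apply (rule set_eqI)
    apply (simp only: triangle_join_iff[OF s N p(1) n] triangle_join_iff[OF K t triangle_join_mono[OF M(3)] ij(1) p(2)])
    apply (simp only: triangle_join_iff[OF K M ij(1) m] triangle_join_iff[OF M(1) N ij(2) n] triangle_join_iff[OF M(2) N ij(2) n] sub simp_thms)
    apply (simp only: outer_part_seq[OF ij n] ar)
    apply (rule seq_reassoc)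
    done
qed

lemma outer_part_par: 
  assumes "i \<in> {1..l}" "k \<in> {1..l}" "i < k" "1 \<le> m" "1 \<le> n"
  shows 
    "outer_part l i m (insert (k+m-1) (outer_part (l+m-1) (k+m-1) n J)) = insert k (outer_part l i m (outer_part (l+m-1) (k+m-1) n J))"
    "outer_part l k n (insert i (outer_part (l+n-1) i m J)) = insert i (outer_part l k n (outer_part (l+n-1) i m J))"
    "insert i (outer_part l i m (outer_part (l+m-1) (k+m-1) n J)) = insert i (outer_part l k n (outer_part (l+n-1) i m J) - {i})"
    "k \<notin> outer_part l i m (outer_part (l+m-1) (k+m-1) n J)"
    "i \<notin> outer_part l i m (outer_part (l+m-1) (k+m-1) n J)"
    "outer_part l k n (outer_part (l+n-1) i m J) = outer_part l i m (outer_part (l+m-1) (k+m-1) n J)"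
    "inner_part i m (insert (k+m-1) (outer_part (l+m-1) (k+m-1) n J)) = inner_part i m J"
    "inner_part i m (outer_part (l+m-1) (k+m-1) n J) = inner_part i m J"
    "inner_part k n (insert i (outer_part (l+n-1) i m J)) = inner_part (k+m-1) n J"
    "inner_part k n (outer_part (l+n-1) i m J) = inner_part (k+m-1) n J"
proof -
  have a: "outer_pos (k+m-1) n (outer_pos i m a) = outer_pos i m (outer_pos k n a)" 
     "outer_pos i m a \<in> {1..l+m-1}" "outer_pos i m a \<noteq> k+m-1" "outer_pos k n a \<in> {1..l+n-1}" "outer_pos k n a \<noteq> i"
    if "a \<in> {1..l}" "a \<noteq> i" "a \<noteq> k" for a using that assms by (auto simp: outer_pos_def)
  have b: "outer_pos i m k = k+m-1" "outer_pos k n i = i" using assms by (auto simp: outer_pos_def)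
  have c: "outer_pos (k+m-1) n (b+i-1) = b+i-1" "b+i-1 \<in> {1..l+m-1}" "b+i-1 \<noteq> k+m-1" if "b \<in> {1..m}" for b
    using that assms by (auto simp: outer_pos_def)
  have d: "outer_pos i m (b+k-1) = b+(k+m-1)-1" "b+k-1 \<in> {1..l+n-1}" "b+k-1 \<noteq> i" if "b \<in> {1..n}" for b
    using that assms by (auto simp: outer_pos_def)
  have kk: "k+m-1 \<in> {1..l+m-1}" "i \<in> {1..l+n-1}" using assms by auto
  have e: "x \<in> outer_part l i m (outer_part (l+m-1) (k+m-1) n J) \<longleftrightarrow> x\<in>{1..l} \<and> x \<noteq> i \<and> x \<noteq> k \<and> outer_pos i m (outer_pos k n x) \<in> J" for x
    unfolding mem_outer_part using a[of x] b by metis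
  have f: "x \<in> outer_part l k n (outer_part (l+n-1) i m J) \<longleftrightarrow> x\<in>{1..l} \<and> x \<noteq> i \<and> x \<noteq> k \<and> outer_pos i m (outer_pos k n x) \<in> J" for x
    unfolding mem_outer_part using a[of x] b by metis
  show "outer_part l k n (outer_part (l+n-1) i m J) = outer_part l i m (outer_part (l+m-1) (k+m-1) n J)"
    "k \<notin> outer_part l i m (outer_part (l+m-1) (k+m-1) n J)"
    "i \<notin> outer_part l i m (outer_part (l+m-1) (k+m-1) n J)"
    unfolding set_eq_iff e f by auto
  show "insert i (outer_part l i m (outer_part (l+m-1) (k+m-1) n J)) = insert i (outer_part l k n (outer_part (l+n-1) i m J) - {i})"
    unfolding set_eq_iff insert_iff Diff_iff e f by auto
  have i1: "insert p X = X \<union> {p}" for p :: nat and X by auto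
  have u: "outer_part n' k' m' (X \<union> Y) = outer_part n' k' m' X \<union> outer_part n' k' m' Y" "inner_part k' m' (X \<union> Y) = inner_part k' m' X \<union> inner_part k' m' Y" 
    for n' k' m' X Y by (auto simp: outer_part_def inner_part_def)
  have s1: "outer_part l i m {k+m-1} = {k}" "outer_part l k n {i} = {i}"
    unfolding set_eq_iff mem_outer_part singleton_iff using a b assms(1-3) by (metis less_irrefl)+
  have s2: "inner_part i m {k+m-1} = {}" "inner_part k n {i} = {}" using c(3) d(3) by (auto simp: inner_part_def)
  show "outer_part l i m (insert (k+m-1) (outer_part (l+m-1) (k+m-1) n J)) = insert k (outer_part l i m (outer_part (l+m-1) (k+m-1) n J))"
    "outer_part l k n (insert i (outer_part (l+n-1) i m J)) = insert i (outer_part l k n (outer_part (l+n-1) i m J))"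
    by (subst insert_is_Un, subst u(1), simp only: s1, simp)+
  show B1: "inner_part i m (outer_part (l+m-1) (k+m-1) n J) = inner_part i m J" unfolding set_eq_iff mem_outer_part mem_inner_part using c by metis
  show B2: "inner_part k n (outer_part (l+n-1) i m J) = inner_part (k+m-1) n J" unfolding set_eq_iff mem_outer_part mem_inner_part using d by metis
  show "inner_part i m (insert (k+m-1) (outer_part (l+m-1) (k+m-1) n J)) = inner_part i m J"
    "inner_part k n (insert i (outer_part (l+n-1) i m J)) = inner_part (k+m-1) n J"
    by (subst insert_is_Un, subst u(2), simp only: s2 B1 B2, simp)+
qed

lemma triangle_join_par:
  assumes K: "scpx l K" and M: "scpx m M" "scpx m M'" "M' \<subseteq> M" and N: "scpx n N" "scpx n N'" "N' \<subseteq> N"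
    and ij: "i \<in> {1..l}" "k \<in> {1..l}" "i < k" and n: "1 \<le> m" "1 \<le> n"
  shows "triangle_join (l+m-1) (k+m-1) n (triangle_join l i m K (M,M')) (N,N') =
    triangle_join (l+n-1) i m (triangle_join l k n K (N,N')) (M,M')"
proof -
  have s: "scpx (l+m-1) (triangle_join l i m K (M,M'))" by (rule triangle_join_scpx) (use assms in auto)
  have t: "scpx (l+n-1) (triangle_join l k n K (N,N'))" by (rule triangle_join_scpx; use assms in auto)
  have p: "k+m-1 \<in> {1..l+m-1}" "i \<in> {1..l+n-1}" using assms by auto
  have sub: "insert (k+m-1) (outer_part (l+m-1) (k+m-1) n J) \<subseteq> {1..l+m-1}" "outer_part (l+m-1) (k+m-1) n J \<subseteq> {1..l+m-1}" 
     "insert i (outer_part (l+n-1) i m J) \<subseteq> {1..l+n-1}" "outer_part (l+n-1) i m J \<subseteq> {1..l+n-1}"  for J 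
    using p by (auto simp: outer_part_def)
  have ar: "l+n-1+m-1 = l+m-1+n-1" using assms by auto
  show ?thesis
    apply (rule set_eqI)
    apply (simp only: triangle_join_iff[OF s N p(1) n(2)] triangle_join_iff[OF t M p(2) n(1)])
    apply (simp only: triangle_join_iff[OF K M ij(1) n(1)] triangle_join_iff[OF K N ij(2) n(2)] sub simp_thms)
    apply (simp only: outer_part_par(1,2)[OF ij n] outer_part_par(6-)[OF ij n] ar)
    apply (subst insert_commute)
    apply (rule par_reassoc)
    done
qed

lemma mem_act: assumes "\<sigma> permutes {1..n}" shows "J \<in> (`) \<sigma> ` K \<longleftrightarrow> \<sigma> -` J \<in> K"
proof -
  have s: "\<sigma> ` (\<sigma> -` J) = J" using permutes_surj[OF assms] by (simp add: surj_image_vimage_eq)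
  have "\<sigma> -` (\<sigma> ` X) = X" for X using permutes_inj[OF assms] by (simp add: inj_vimage_image_eq)
  then show ?thesis using s by (metis image_iff)
qed

lemma act_scpx: assumes "\<sigma> permutes {1..n}" "scpx n K" shows "scpx n ((`) \<sigma> ` K)"
  unfolding scpx_def
proof (intro conjI ballI allI impI)
  show "(`) \<sigma> ` K \<subseteq> Pow {1..n}"
    using assms permutes_image[OF assms(1)] by (auto simp: scpx_def)
  fix I J assume "I \<in> (`) \<sigma> ` K" "J \<subseteq> I"
  then have "\<sigma> -` I \<in> K" "\<sigma> -` J \<subseteq> \<sigma> -` I" using mem_act[OF assms(1)] by auto
  then show "J \<in> (`) \<sigma> ` K" using mem_act[OF assms(1)] assms(2) by (simp add: scpx_def)
qed

lemma block_perm_outer: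
  assumes "\<sigma> permutes {1..n}" "k \<in> {1..n}" "1 \<le> m" "j \<in> {1..n}" "j \<noteq> k"
  shows "block_perm n k m \<sigma> \<tau> (outer_pos k m j) = outer_pos (\<sigma> k) m (\<sigma> j)"
  using assms by (auto simp: block_perm_def outer_pos_def)

lemma block_perm_inner:
  assumes "k \<in> {1..n}" "b \<in> {1..m}"
  shows "block_perm n k m \<sigma> \<tau> (b + k - 1) = \<tau> b + \<sigma> k - 1"
proof -
  have "b + k - 1 - (k - 1) = b" using assms by auto
  then show ?thesis using assms by (auto simp: block_perm_def)
qed

lemma pos_cases:
  assumes "p \<in> {1..n+m-1}" "k \<in> {1..n}" "1 \<le> m"
  obtains j where "j \<in> {1..n}" "j \<noteq> k" "p = outer_pos k m j" | b where "b \<in> {1..m}" "p = b + k - 1"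
proof -
  consider "p < k" | "k \<le> p" "p < k + m" | "k + m \<le> p" by linarith
  then show ?thesis
  proof cases
    case 1 then show ?thesis using that(1)[of p] assms by (auto simp: outer_pos_def)
  next
    case 2
    then have "p + 1 - k \<in> {1..m}" "p = p + 1 - k + k - 1" using assms by auto
    then show ?thesis by (rule that(2))
  next
    case 3
    then have "p + 1 - m \<in> {1..n}" "p + 1 - m \<noteq> k" "p = outer_pos k m (p + 1 - m)"
      using assms by (auto simp: outer_pos_def)
    then show ?thesis by (rule that(1))
  qed
qed

lemma block_perm_permutes:
  assumes s: "\<sigma> permutes {1..n}" and t: "\<tau> permutes {1..m}" and k: "k \<in> {1..n}" and m: "1 \<le> m"
  shows "block_perm n k m \<sigma> \<tau> permutes {1..n+m-1}"
proof -
  have sk: "\<sigma> k \<in> {1..n}" using k permutes_in_image[OF s] by simp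
  let ?b = "block_perm n k m \<sigma> \<tau>"
  have surj: "{1..n+m-1} \<subseteq> ?b ` {1..n+m-1}"
  proof
    fix p assume p: "p \<in> {1..n+m-1}"
    from pos_cases[OF p sk m] consider (2) j where "j \<in> {1..n}" "j \<noteq> \<sigma> k" "p = outer_pos (\<sigma> k) m j"
      | (3) b where "b \<in> {1..m}" "p = b + \<sigma> k - 1" by metis
    then show "p \<in> ?b ` {1..n+m-1}" 
    proof cases
      case (2 j)
      obtain i where i: "j = \<sigma> i" "i \<in> {1..n}" using s 2(1) by (metis permutes_image imageE)
      have "i \<noteq> k" using i 2 by auto
      moreover have "outer_pos k m i \<in> {1..n+m-1}" using i m \<open>i \<noteq> k\<close> k by (auto simp: outer_pos_def)
      ultimately show ?thesis using block_perm_outer[OF s k m i(2)] 2 i by (metis imageI)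
    next
      case (3 b)
      obtain i where i: "b = \<tau> i" "i \<in> {1..m}" using t 3(1) by (metis permutes_image imageE)
      moreover have "i + k - 1 \<in> {1..n+m-1}" using i m k by auto
      ultimately show ?thesis using block_perm_inner[OF k i(2)] 3 i by (metis imageI)
    qed
  qed
  have fin: "finite {1..n+m-1}" by simp
  have "card (?b ` {1..n+m-1}) \<le> card {1..n+m-1}" by (rule card_image_le) simp
  then have eq: "?b ` {1..n+m-1} = {1..n+m-1}" using surj fin by (metis card_seteq finite_imageI)
  then have "inj_on ?b {1..n+m-1}" by (metis fin eq_card_imp_inj_on)
  then have "bij_betw ?b {1..n+m-1} {1..n+m-1}" using eq by (simp add: bij_betw_def)
  then show ?thesis by (rule bij_imp_permutes) (auto simp: block_perm_def)
qed

lemma triangle_join_act: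
  assumes K: "scpx n K" and M: "scpx m M" "scpx m N" "N \<subseteq> M" and k: "k \<in> {1..n}" and m: "1 \<le> m"
    and s: "\<sigma> permutes {1..n}" and t: "\<tau> permutes {1..m}"
  shows "triangle_join n (\<sigma> k) m ((`) \<sigma> ` K) ((`) \<tau> ` M, (`) \<tau> ` N) =
    (`) (block_perm n k m \<sigma> \<tau>) ` triangle_join n k m K (M, N)"
proof (rule set_eqI)
  fix J
  let ?b = "block_perm n k m \<sigma> \<tau>"
  have b: "?b permutes {1..n+m-1}" by (rule block_perm_permutes[OF s t k m])
  have sk: "\<sigma> k \<in> {1..n}" using k permutes_in_image[OF s] by simp
  have si: "\<sigma> x \<in> {1..n} \<longleftrightarrow> x \<in> {1..n}" for x by (rule permutes_in_image[OF s])
  have ti: "\<tau> x \<in> {1..m} \<longleftrightarrow> x \<in> {1..m}" for x by (rule permutes_in_image[OF t])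
  have sinj: "\<sigma> x = \<sigma> y \<longleftrightarrow> x = y" for x y using permutes_inj[OF s] by (auto dest: injD)
  have MM: "(`) \<tau> ` N \<subseteq> (`) \<tau> ` M" using M by auto
  note 1 = triangle_join_iff[OF act_scpx[OF s K] act_scpx[OF t M(1)] act_scpx[OF t M(2)] MM sk m]
  have A: "\<sigma> -` outer_part n (\<sigma> k) m J = outer_part n k m (?b -` J)"
    unfolding set_eq_iff vimage_eq mem_outer_part si sinj using block_perm_outer[OF s k m] by metis
  have B: "\<tau> -` inner_part (\<sigma> k) m J = inner_part k m (?b -` J)"
    unfolding set_eq_iff vimage_eq mem_inner_part ti using block_perm_inner[OF k] by metis
  have ins: "\<sigma> -` insert (\<sigma> k) X = insert k (\<sigma> -` X)" for X using sinj by auto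
  have J: "?b -` J \<subseteq> {1..n+m-1} \<longleftrightarrow> J \<subseteq> {1..n+m-1}"
  proof -
    have 1: "?b -` {1..n+m-1} = {1..n+m-1}" unfolding set_eq_iff vimage_eq permutes_in_image[OF b] by simp
    have 2: "?b ` (?b -` J) = J" using permutes_surj[OF b] by (simp add: surj_image_vimage_eq)
    show ?thesis
    proof
      assume "?b -` J \<subseteq> {1..n+m-1}"
      then have "?b ` (?b -` J) \<subseteq> ?b ` {1..n+m-1}" by (rule image_mono)
      then show "J \<subseteq> {1..n+m-1}" unfolding 2 permutes_image[OF b] .
    next
      assume "J \<subseteq> {1..n+m-1}"
      then have "?b -` J \<subseteq> ?b -` {1..n+m-1}" by (rule vimage_mono)
      then show "?b -` J \<subseteq> {1..n+m-1}" unfolding 1 .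
    qed
  qed
  show "J \<in> triangle_join n (\<sigma> k) m ((`) \<sigma> ` K) ((`) \<tau> ` M, (`) \<tau> ` N) \<longleftrightarrow> J \<in> (`) ?b ` triangle_join n k m K (M, N)"
    unfolding 1 mem_act[OF b] mem_act[OF s] mem_act[OF t] ins A B triangle_join_iff[OF K M k m] J ..
qed

lemma scpx_empty: "scpx n K \<Longrightarrow> K \<noteq> {} \<Longrightarrow> {} \<in> K"
  by (auto simp: scpx_def)

lemma triangle_join_nonempty:
  assumes "scpx n K" "scpx m M" "scpx m N" "N \<subseteq> M" "k \<in> {1..n}" "1 \<le> m" "K \<noteq> {}" "N \<noteq> {}"
  shows "triangle_join n k m K (M,N) \<noteq> {}"
proof -
  have "{} \<in> K" "{} \<in> N" using assms scpx_empty by blast+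
  then have "{} \<in> triangle_join n k m K (M,N)" unfolding triangle_join_iff[OF assms(1-6)] by (simp add: outer_part_def inner_part_def)
  then show ?thesis by blast
qed

lemma triangle_join_unit_left: assumes "scpx n M" "scpx n N" "N \<subseteq> M" "1 \<le> n" 
  shows "triangle_join 1 1 n pt (M,N) = M" "triangle_join 1 1 n {{}} (M,N) = N"
proof -
  have s: "scpx 1 pt" "scpx 1 {{}}" by (auto simp: scpx_def pt_def)
  have a: "outer_part 1 1 n J = {}" for J by (auto simp: outer_part_def)
  have b: "J \<subseteq> {1..n} \<Longrightarrow> inner_part 1 n J = J" for J by (auto simp: inner_part_def)
  show "triangle_join 1 1 n pt (M,N) = M" "triangle_join 1 1 n {{}} (M,N) = N"
  proof -
    have o: "(1::nat) \<in> {1..1}" by simp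
    have r: "1 + n - 1 = n" by simp
    have sub: "J \<in> M \<Longrightarrow> J \<subseteq> {1..n}" for J using assms by (auto simp: scpx_def)
    have c: "{1} \<in> pt" "{} \<in> pt" "{1} \<notin> {{}}" "{} \<in> {{}}" by (simp_all add: pt_def)
    note t = triangle_join_iff[OF s(1) assms(1-3) o assms(4), unfolded a r] triangle_join_iff[OF s(2) assms(1-3) o assms(4), unfolded a r]
    show "triangle_join 1 1 n pt (M,N) = M" 
      unfolding set_eq_iff t using c sub b assms(3) by (metis subsetD)
    show "triangle_join 1 1 n {{}} (M,N) = N"
      unfolding set_eq_iff t using c sub b assms(3) by (metis subsetD)
  qed
qed

lemma triangle_join_unit_right: assumes "scpx n K" "k \<in> {1..n}"
  shows "triangle_join n k 1 K (pt,{{}}) = K"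
proof -
  have s: "scpx 1 pt" "scpx 1 {{}}" "{{}} \<subseteq> pt" by (auto simp: scpx_def pt_def)
  have o: "outer_pos k 1 j = j" for j by (simp add: outer_pos_def)
  have b: "inner_part k 1 J = (if k \<in> J then {1} else {})" for J using assms by (auto simp: inner_part_def)
  have a: "J \<subseteq> {1..n} \<Longrightarrow> outer_part n k 1 J = J - {k}" for J unfolding set_eq_iff mem_outer_part o by auto
  have d: "X \<in> K" if "Y \<in> K" "X \<subseteq> Y" for X Y using assms that by (auto simp: scpx_def)
  show ?thesis
  proof (rule set_eqI)
    fix J
    show "J \<in> triangle_join n k 1 K (pt,{{}}) \<longleftrightarrow> J \<in> K"
    proof (cases "J \<subseteq> {1..n}")
      case True
      then show ?thesis
        unfolding triangle_join_iff[OF assms(1) s assms(2) order_refl] a[OF True] b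
        using True by (cases "k \<in> J") (auto simp: pt_def insert_absorb intro: d[of "insert k J" J])
    next
      case False then show ?thesis using assms(1)
        unfolding triangle_join_iff[OF assms(1) s assms(2) order_refl] by (auto simp: scpx_def)
    qed
  qed
qed

lemma relscpxE:
  assumes "x \<in> relscpx n"
  obtains K L where "x = (K, L)" "1 \<le> n" "scpx n K" "scpx n L" "L \<subseteq> K" "L \<noteq> {}"
  using assms by (auto simp: relscpx_def)

lemma relscpxI: "\<lbrakk>1 \<le> n; scpx n K; scpx n L; L \<subseteq> K; L \<noteq> {}\<rbrakk> \<Longrightarrow> (K, L) \<in> relscpx n"
  by (auto simp: relscpx_def)

lemma unital_operad_relscpx: "unital_operad relscpx (\<lambda>n. relabel) rel_comp rel_unit"
proof
  show "relabel \<sigma> x \<in> relscpx n" if "\<sigma> permutes {1..n}" "x \<in> relscpx n" for \<sigma> n x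
    using that(2) by (rule relscpxE) (auto simp: relabel_def intro!: relscpxI act_scpx[OF that(1)])
  show "relabel id x = x" for x by (auto simp: relabel_def)
  show "relabel (\<sigma> \<circ> \<tau>) x = relabel \<sigma> (relabel \<tau> x)" for \<sigma> \<tau> x
    by (auto simp: relabel_def image_comp image_image split: prod.split)
  fix l m n :: nat and x y z :: "nat set set \<times> nat set set" and i k :: nat
  { assume x: "x \<in> relscpx n" and y: "y \<in> relscpx m" and k: "k \<in> {1..n}"
    obtain K L where K: "x = (K, L)" "1 \<le> n" "scpx n K" "scpx n L" "L \<subseteq> K" "L \<noteq> {}" using x by (rule relscpxE)
    obtain M N where M: "y = (M, N)" "1 \<le> m" "scpx m M" "scpx m N" "N \<subseteq> M" "N \<noteq> {}" using y by (rule relscpxE)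
    show "rel_comp n k m x y \<in> relscpx (n+m-1)" 
      unfolding K M rel_comp_def prod.case
    proof (rule relscpxI)
      show "1 \<le> n + m - 1" using K(2) M(2) by simp
    qed (rule triangle_join_scpx[OF K(3) M(3,4,5) k M(2)] triangle_join_scpx[OF K(4) M(3,4,5) k M(2)] triangle_join_mono[OF K(5)]
           triangle_join_nonempty[OF K(4) M(3,4,5) k M(2) K(6) M(6)])+
    fix \<sigma> \<tau> assume st: "\<sigma> permutes {1..n}" "\<tau> permutes {1..m}"
    show "rel_comp n (\<sigma> k) m (relabel \<sigma> x) (relabel \<tau> y) = relabel (block_perm n k m \<sigma> \<tau>) (rel_comp n k m x y)"
      unfolding K M rel_comp_def relabel_def prod.case
      by (simp only: triangle_join_act[OF K(3) M(3,4,5) k M(2) st] triangle_join_act[OF K(4) M(3,4,5) k M(2) st])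
  }
  { assume x: "x \<in> relscpx l" and y: "y \<in> relscpx m" and z: "z \<in> relscpx n" and i: "i \<in> {1..l}"
    obtain K L where K: "x = (K, L)" "1 \<le> l" "scpx l K" "scpx l L" "L \<subseteq> K" "L \<noteq> {}" using x by (rule relscpxE)
    obtain M N where M: "y = (M, N)" "1 \<le> m" "scpx m M" "scpx m N" "N \<subseteq> M" "N \<noteq> {}" using y by (rule relscpxE)
    obtain R S where R: "z = (R, S)" "1 \<le> n" "scpx n R" "scpx n S" "S \<subseteq> R" "S \<noteq> {}" using z by (rule relscpxE)
    { fix j assume j: "j \<in> {1..m}"
      show "rel_comp (l+m-1) (i+j-1) n (rel_comp l i m x y) z = rel_comp l i (m+n-1) x (rel_comp m j n y z)"
        unfolding K M R rel_comp_def prod.case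
        by (simp only: triangle_join_seq[OF K(3) M(3,4,5) R(3,4,5) i j R(2)] triangle_join_seq[OF K(4) M(3,4,5) R(3,4,5) i j R(2)]) }
    { assume k: "k \<in> {1..l}" "i < k"
      show "rel_comp (l+m-1) (k+m-1) n (rel_comp l i m x y) z = rel_comp (l+n-1) i m (rel_comp l k n x z) y"
        unfolding K M R rel_comp_def prod.case
        by (simp only: triangle_join_par[OF K(3) M(3,4,5) R(3,4,5) i k M(2) R(2)] triangle_join_par[OF K(4) M(3,4,5) R(3,4,5) i k M(2) R(2)]) }
  }
  show "rel_unit \<in> relscpx 1" by (auto simp: relscpx_def rel_unit_def scpx_def pt_def)
  { assume x: "x \<in> relscpx n"
    obtain K L where K: "x = (K, L)" "1 \<le> n" "scpx n K" "scpx n L" "L \<subseteq> K" "L \<noteq> {}" using x by (rule relscpxE)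
    show "rel_comp 1 1 n rel_unit x = x"
      unfolding K rel_comp_def rel_unit_def prod.case by (simp only: triangle_join_unit_left[OF K(3,4,5,2)])
    assume k: "k \<in> {1..n}"
    show "rel_comp n k 1 x rel_unit = x"
      unfolding K rel_comp_def rel_unit_def prod.case by (simp only: triangle_join_unit_right[OF K(3) k] triangle_join_unit_right[OF K(4) k])
  }
qed

end

theory Submission
  imports Defs "HOL-Homology.Invariance_of_Domain"
begin

text \<open>
  Write \<open>X \<triangleleft> (C, N)\<close> for the complex obtained from \<open>X\<close> by composing at a vertex \<open>v\<close>, where \<open>C\<close> is a PL
  ball with boundary \<open>N\<close>. Its faces are \<open>A \<union> D\<close> with \<open>A \<union> {v} \<in> X\<close> and \<open>D \<in> C\<close>, or with \<open>A \<in> X\<close> and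
  \<open>D \<in> N\<close>. The main point is that this is the join \<open>X * N\<close> up to a PL homeomorphism. In \<open>X * N\<close> the
  vertex \<open>v\<close> occurs only through the cone \<open>v * N\<close>, and a PL homeomorphism from \<open>C\<close> to a simplex
  turns this cone into the simplex starred at its barycentre, so \<open>v * N\<close> is PL homeomorphic to \<open>C\<close>
  by a map that fixes \<open>N\<close> (\<open>pl_iso_cone\<close>). Joined with the identity on the other vertices this map
  carries \<open>X * N\<close> onto \<open>X \<triangleleft> (C, N)\<close>, and it does so for all \<open>X\<close> at once (\<open>pl_iso_replace\<close>).

  For the pair \<open>(B, \<partial>B)\<close> the composite is therefore \<open>(B * \<partial>C, \<partial>B * \<partial>C)\<close> up to a PL homeomorphism of
  pairs. Since PL homeomorphisms can be joined, \<open>B\<close> and \<open>C\<close> may be replaced by simplices of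
  dimensions \<open>d\<close> and \<open>e\<close>. In this case the same map leads to the composite of two simplices,
  which is the simplex of dimension \<open>d + e\<close> together with its boundary (\<open>ball_pair_join_sphere\<close>).

  It remains to see that links are PL balls or spheres. If \<open>D\<close> is an interior face of \<open>C\<close>, the link
  of \<open>A \<union> D\<close> is the join of the links of \<open>A \<union> {v}\<close> in \<open>B\<close> and of \<open>D\<close> in \<open>C\<close>. If \<open>D\<close> is a face of \<open>\<partial>C\<close>,
  it is the composite of the link of \<open>A\<close> in \<open>B\<close> with the pair of links of \<open>D\<close> in \<open>C\<close> and in \<open>\<partial>C\<close>, to
  which the first step applies once this pair is known to be a ball with its boundary
  (\<open>ball_pair_link\<close>). The latter is a topological fact: by invariance of domain, the
  boundary points of \<open>C\<close> are the points without a Euclidean neighbourhood, and the points of the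
  star of \<open>D\<close> of this kind can be read off from the link of \<open>D\<close>. The same argument shows that a
  face of a sphere cannot have a ball as its link, so that the recursive definition of a PL ball
  amounts to one condition on the links of all nonempty faces (\<open>pl_ball_iff\<close>).

  Absence of interior vertices is immediate from the description of the faces.
\<close>

(* As a conditional rewrite rule this fact loops on goals of the form "finite A". *)
declare card_of_ordIso_finite [simp del]

section \<open>Finitely supported vectors\<close>

type_synonym vec = "(nat, real) poly_mapping"

lemma lookup_scaleR [simp]: "Poly_Mapping.lookup (r *\<^sub>R x) i = r *\<^sub>R Poly_Mapping.lookup x i"
proof -
  have "finite {i. r *\<^sub>R Poly_Mapping.lookup x i \<noteq> 0}"
    by (rule finite_subset[OF _ finite_keys[of x]]) (auto simp: in_keys_iff)
  then show ?thesis by (simp add: scaleR_poly_mapping_def)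
qed

abbreviation coord :: "vec \<Rightarrow> nat \<Rightarrow> real" where "coord \<equiv> Poly_Mapping.lookup"
abbreviation supp :: "vec \<Rightarrow> nat set" where "supp \<equiv> Poly_Mapping.keys"
abbreviation basis_vec :: "nat \<Rightarrow> vec" where "basis_vec i \<equiv> Poly_Mapping.single i 1"

definition coord_sum :: "vec \<Rightarrow> real" where "coord_sum x = (\<Sum>i\<in>supp x. coord x i)"

definition restrict_vec :: "nat set \<Rightarrow> vec \<Rightarrow> vec" where
  "restrict_vec V x = Abs_poly_mapping (\<lambda>i. if i \<in> V then coord x i else 0)"

lemma coord_restrict_vec [simp]: "coord (restrict_vec V x) i = (if i \<in> V then coord x i else 0)"
proof -
  have "finite {i. (if i \<in> V then coord x i else 0) \<noteq> 0}"
    by (rule finite_subset[OF _ finite_keys[of x]]) (auto simp: in_keys_iff)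
  then show ?thesis by (simp add: restrict_vec_def)
qed

lemma supp_restrict_vec [simp]: "supp (restrict_vec V x) = supp x \<inter> V"
  by (auto simp: in_keys_iff split: if_splits)

lemma linear_restrict_vec: "linear (restrict_vec V)"
  by (rule linearI) (auto intro!: poly_mapping_eqI simp: lookup_add)

lemma coord_sum_eq_sum: "finite F \<Longrightarrow> supp x \<subseteq> F \<Longrightarrow> coord_sum x = (\<Sum>i\<in>F. coord x i)"
  unfolding coord_sum_def by (rule sum.mono_neutral_left) (auto simp: in_keys_iff)

lemma linear_coord_sum: "linear coord_sum"
proof (rule linearI)
  fix x y :: vec
  have "coord_sum z = (\<Sum>i\<in>supp x \<union> supp y. coord z i)" if "supp z \<subseteq> supp x \<union> supp y" for z
    by (rule coord_sum_eq_sum[OF _ that]) auto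
  then show "coord_sum (x + y) = coord_sum x + coord_sum y"
    by (simp add: Poly_Mapping.keys_add lookup_add sum.distrib)
next
  fix r and x :: vec
  have "supp (r *\<^sub>R x) \<subseteq> supp x" by (auto simp: in_keys_iff)
  then have "coord_sum (r *\<^sub>R x) = (\<Sum>i\<in>supp x. coord (r *\<^sub>R x) i)" by (intro coord_sum_eq_sum) auto
  then show "coord_sum (r *\<^sub>R x) = r *\<^sub>R coord_sum x"
    by (simp add: coord_sum_def sum_distrib_left)
qed

lemma coord_sum_add [simp]: "coord_sum (x + y) = coord_sum x + coord_sum y"
  and coord_sum_scaleR [simp]: "coord_sum (r *\<^sub>R x) = r * coord_sum x"
  and coord_sum_zero [simp]: "coord_sum 0 = 0"
  using linear_coord_sum by (simp_all add: linear_add linear_scale linear_0)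

lemma restrict_vec_add [simp]: "restrict_vec V (x + y) = restrict_vec V x + restrict_vec V y"
  and restrict_vec_scaleR [simp]: "restrict_vec V (r *\<^sub>R x) = r *\<^sub>R restrict_vec V x"
  and restrict_vec_zero [simp]: "restrict_vec V 0 = 0"
  using linear_restrict_vec[of V] by (simp_all add: linear_add linear_scale linear_0)

lemma restrict_vec_id: "supp x \<subseteq> V \<Longrightarrow> restrict_vec V x = x"
  by (rule poly_mapping_eqI) (auto simp: in_keys_iff)

lemma restrict_vec_disjoint: "supp x \<inter> V = {} \<Longrightarrow> restrict_vec V x = 0"
  by (rule poly_mapping_eqI) (auto simp: in_keys_iff)

lemma supp_scaleR_subset: "supp (r *\<^sub>R x) \<subseteq> supp x"
  by (auto simp: in_keys_iff)

lemma abs_coord_le_norm: "\<bar>coord x i\<bar> \<le> norm x"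
proof (cases "i \<in> supp x")
  case True
  then have "\<bar>coord x i\<bar> \<le> (\<Sum>n\<in>supp x. \<bar>coord x n\<bar>)"
    by (intro member_le_sum) auto
  then show ?thesis by (simp add: norm_poly_mapping_def dist_poly_mapping_def)
qed (auto simp: in_keys_iff)

lemma continuous_on_coord: "continuous_on S (\<lambda>x. coord x i)"
proof -
  have "bounded_linear (\<lambda>x. coord x i)"
    by (rule bounded_linear_intro[where K=1]) (auto simp: lookup_add abs_coord_le_norm)
  then show ?thesis by (rule linear_continuous_on)
qed

lemma vec_sum_basis: "finite F \<Longrightarrow> supp x \<subseteq> F \<Longrightarrow> x = (\<Sum>i\<in>F. coord x i *\<^sub>R basis_vec i)"
  by (rule poly_mapping_eqI) (auto simp: lookup_sum lookup_single when_def if_distrib in_keys_iff sum.delta cong: if_cong)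

text \<open>A linear map on this infinite-dimensional space need not be continuous, but it is on a set of
  vectors with finitely many coordinates in common.\<close>

lemma continuous_on_linear_finite_supp:
  fixes h :: "vec \<Rightarrow> vec"
  assumes "linear h" "finite F" "\<And>x. x \<in> S \<Longrightarrow> supp x \<subseteq> F"
  shows "continuous_on S h"
proof -
  have "h x = (\<Sum>i\<in>F. coord x i *\<^sub>R h (basis_vec i))" if "x \<in> S" for x
  proof -
    have "h x = h (\<Sum>i\<in>F. coord x i *\<^sub>R basis_vec i)"
      using vec_sum_basis[OF assms(2) assms(3)[OF that]] by simp
    then show ?thesis using assms(1) by (simp add: linear_sum linear_scale)
  qed
  moreover have "continuous_on S (\<lambda>x. \<Sum>i\<in>F. coord x i *\<^sub>R h (basis_vec i))"
    by (intro continuous_on_sum continuous_on_scaleR continuous_on_coord continuous_on_const)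
  ultimately show ?thesis by (simp cong: continuous_on_cong)
qed

lemma convex_supp_subset: "convex {x :: vec. supp x \<subseteq> F}"
proof (rule convexI, clarify)
  fix x y :: vec and u v :: real and i
  assume "supp x \<subseteq> F" "supp y \<subseteq> F" "i \<in> supp (u *\<^sub>R x + v *\<^sub>R y)"
  moreover from this have "coord x i \<noteq> 0 \<or> coord y i \<noteq> 0" by (auto simp: in_keys_iff lookup_add)
  ultimately show "i \<in> F" by (auto simp: in_keys_iff subset_iff)
qed

lemma polytope_finite_supp:
  assumes "polytope (P :: vec set)"
  obtains F where "finite F" "\<And>x. x \<in> P \<Longrightarrow> supp x \<subseteq> F"
proof -
  obtain S where S: "finite S" "P = convex hull S" using assms polytope_def by blast
  have "P \<subseteq> {x. supp x \<subseteq> \<Union>(supp ` S)}"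
    unfolding S(2) by (rule hull_minimal) (auto simp: convex_supp_subset)
  then show ?thesis using S(1) by (intro that[of "\<Union>(supp ` S)"]) auto
qed

section \<open>Polytopes\<close>

text \<open>
  A hyperplane cuts \<open>convex hull S\<close> in the convex hull of the points of \<open>S\<close> on the hyperplane and the
  points where the segments between points of \<open>S\<close> on different sides cross it. To write a point of
  the section in this form, match the weights on one side with those on the other side: the
  crossing point of the segment from \<open>a\<close> to \<open>b\<close> gets the weight \<open>u a * u b * (h a - h b)\<close> up to
  normalization.
\<close>

lemma polytope_Int_hyperplane:
  fixes h :: "'a::real_vector \<Rightarrow> real"
  assumes "polytope P" "linear h"
  shows "polytope (P \<inter> {x. h x = c})"
proof -
  obtain S where S: "finite S" "P = convex hull S" using assms polytope_def by blast
  define S0 where "S0 = {s\<in>S. h s = c}"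
  define Sp where "Sp = {s\<in>S. h s > c}"
  define Sm where "Sm = {s\<in>S. h s < c}"
  define q where "q = (\<lambda>(a, b). ((c - h b) / (h a - h b)) *\<^sub>R a + ((h a - c) / (h a - h b)) *\<^sub>R b)"
  define T where "T = S0 \<union> q ` (Sp \<times> Sm)"
  have fin: "finite S0" "finite Sp" "finite Sm" "finite T"
    using S by (auto simp: S0_def Sp_def Sm_def T_def)
  note lin = linear_add[OF assms(2)] linear_scale[OF assms(2)] linear_sum[OF assms(2)]
  have hq: "h (q p) = c" if pS: "p \<in> Sp \<times> Sm" for p
  proof -
    obtain a b where p: "p = (a, b)" "h a > c" "h b < c" using pS unfolding Sp_def Sm_def by blast
    have "(c - h b) * h a + (h a - c) * h b = c * (h a - h b)" by (simp add: algebra_simps)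
    then show ?thesis using p(2,3) unfolding p(1) q_def by (simp add: lin add_divide_distrib[symmetric])
  qed
  have qP: "q p \<in> P" if pS: "p \<in> Sp \<times> Sm" for p
  proof -
    obtain a b where p: "p = (a, b)" "h a > c" "h b < c" "a \<in> S" "b \<in> S" using pS unfolding Sp_def Sm_def by blast
    have "a \<in> P" "b \<in> P" using p S by (simp_all add: hull_inc)
    moreover have "convex P" using S convex_convex_hull by blast
    moreover have "(c - h b) / (h a - h b) + (h a - c) / (h a - h b) = 1"
      using p by (simp add: add_divide_distrib[symmetric])
    ultimately show ?thesis unfolding p q_def prod.case
      using p by (intro convexD) auto
  qed
  have "convex hull T \<subseteq> P \<inter> {x. h x = c}"
  proof (rule hull_minimal)
    show "T \<subseteq> P \<inter> {x. h x = c}"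
      using hq qP S by (auto simp: T_def S0_def hull_inc)
    have "convex {x. h x = c}"
      by (rule convexI) (auto simp: lin distrib_right[symmetric])
    then show "convex (P \<inter> {x. h x = c})" using S convex_convex_hull by (auto intro: convex_Int)
  qed
  moreover have "x \<in> convex hull T" if x: "x \<in> P" "h x = c" for x
  proof -
    obtain u where u: "\<And>s. s \<in> S \<Longrightarrow> 0 \<le> u s" "sum u S = 1" "(\<Sum>s\<in>S. u s *\<^sub>R s) = x"
      using x(1) S by (auto simp: convex_hull_finite)
    have S_eq: "S = (S0 \<union> Sp) \<union> Sm" unfolding S0_def Sp_def Sm_def by force
    have disj: "S0 \<inter> Sp = {}" "(S0 \<union> Sp) \<inter> Sm = {}" unfolding S0_def Sp_def Sm_def by force+
    have split: "sum f S = sum f S0 + sum f Sp + sum f Sm" for f :: "'a \<Rightarrow> 'b::comm_monoid_add"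
      unfolding S_eq sum.union_disjoint[OF finite_UnI[OF fin(1,2)] fin(3) disj(2)] sum.union_disjoint[OF fin(1,2) disj(1)] ..
    \<comment> \<open>The moments of the two sides about the hyperplane balance.\<close>
    define M where "M = (\<Sum>a\<in>Sp. u a * (h a - c))"
    have "(\<Sum>s\<in>S. u s * (h s - c)) = h x - c * sum u S"
      unfolding u(3)[symmetric] by (simp add: lin algebra_simps sum_subtractf sum_distrib_left)
    then have "(\<Sum>s\<in>S. u s * (h s - c)) = 0" using x u by simp
    moreover have "(\<Sum>s\<in>S0. u s * (h s - c)) = 0" by (simp add: S0_def)
    ultimately have M': "M = (\<Sum>b\<in>Sm. u b * (c - h b))"
      unfolding split M_def by (simp add: algebra_simps sum_subtractf)
    have pos: "0 \<le> u a * (h a - c)" if "a \<in> Sp" for a using that u(1) by (auto simp: Sp_def)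
    have neg: "0 \<le> u b * (c - h b)" if "b \<in> Sm" for b using that u(1) by (auto simp: Sm_def)
    have M0: "0 \<le> M" unfolding M_def using pos by (rule sum_nonneg)
    show ?thesis
    proof (cases "M = 0")
      case True
      have "u a = 0" if "a \<in> Sp" for a
        using True that pos fin unfolding M_def by (simp add: sum_nonneg_eq_0_iff) (auto simp: Sp_def)
      moreover have "u b = 0" if "b \<in> Sm" for b
        using True that neg fin unfolding M' by (simp add: sum_nonneg_eq_0_iff) (auto simp: Sm_def)
      ultimately have "sum u S0 = 1" "(\<Sum>s\<in>S0. u s *\<^sub>R s) = x"
        using u(2,3) unfolding split by simp_all
      then have "x \<in> convex hull S0" using fin u(1) by (auto simp: convex_hull_finite S0_def)
      then show ?thesis using hull_mono[of S0 T] by (auto simp: T_def)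
    next
      case False
      then have Mp: "0 < M" using M0 by simp
      define w where "w = (\<lambda>(a, b). u a * u b * (h a - h b) / M)"
      let ?A = "S0 <+> (Sp \<times> Sm)"
      let ?w = "case_sum u w" and ?y = "case_sum id q"
      have wq: "w (a, b) *\<^sub>R q (a, b) = (u a * (u b * (c - h b)) / M) *\<^sub>R a + (u b * (u a * (h a - c)) / M) *\<^sub>R b"
        if "a \<in> Sp" "b \<in> Sm" for a b
      proof -
        have "h a - h b \<noteq> 0" using that by (auto simp: Sp_def Sm_def)
        then have "w (a, b) * ((c - h b) / (h a - h b)) = u a * (u b * (c - h b)) / M"
          "w (a, b) * ((h a - c) / (h a - h b)) = u b * (u a * (h a - c)) / M"
          by (simp_all add: w_def)
        then show ?thesis unfolding q_def prod.case scaleR_add_right scaleR_scaleR by simp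
      qed
      have A: "(\<Sum>b\<in>Sm. u a * (u b * (c - h b)) / M) = u a" for a
        using Mp by (simp add: sum_divide_distrib[symmetric] sum_distrib_left[symmetric] M'[symmetric])
      have B: "(\<Sum>a\<in>Sp. u b * (u a * (h a - c)) / M) = u b" for b
        using Mp by (simp add: sum_divide_distrib[symmetric] sum_distrib_left[symmetric] M_def[symmetric])
      have "(\<Sum>p\<in>Sp\<times>Sm. w p *\<^sub>R q p) =
          (\<Sum>a\<in>Sp. \<Sum>b\<in>Sm. (u a * (u b * (c - h b)) / M) *\<^sub>R a) + (\<Sum>a\<in>Sp. \<Sum>b\<in>Sm. (u b * (u a * (h a - c)) / M) *\<^sub>R b)"
        unfolding sum.cartesian_product[symmetric] sum.distrib[symmetric]
        using wq fin
        by (simp add: sum.cartesian_product' sum.distrib[symmetric] cong: sum.cong)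
      also have "(\<Sum>a\<in>Sp. \<Sum>b\<in>Sm. (u b * (u a * (h a - c)) / M) *\<^sub>R b) = (\<Sum>b\<in>Sm. \<Sum>a\<in>Sp. (u b * (u a * (h a - c)) / M) *\<^sub>R b)"
        by (rule sum.swap)
      finally have wq_sum: "(\<Sum>p\<in>Sp\<times>Sm. w p *\<^sub>R q p) = (\<Sum>a\<in>Sp. u a *\<^sub>R a) + (\<Sum>b\<in>Sm. u b *\<^sub>R b)"
        unfolding scaleR_sum_left[symmetric] A B .
      have "(\<Sum>p\<in>Sp\<times>Sm. w p) =
          (\<Sum>a\<in>Sp. \<Sum>b\<in>Sm. u a * (u b * (c - h b)) / M) + (\<Sum>a\<in>Sp. \<Sum>b\<in>Sm. u b * (u a * (h a - c)) / M)"
        using fin by (simp add: sum.cartesian_product' sum.distrib[symmetric] w_def add_divide_distrib[symmetric] algebra_simps)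
      also have "(\<Sum>a\<in>Sp. \<Sum>b\<in>Sm. u b * (u a * (h a - c)) / M) = (\<Sum>b\<in>Sm. \<Sum>a\<in>Sp. u b * (u a * (h a - c)) / M)"
        by (rule sum.swap)
      finally have w_sum: "(\<Sum>p\<in>Sp\<times>Sm. w p) = sum u Sp + sum u Sm" unfolding A B .
      have "(\<Sum>i\<in>?A. ?w i *\<^sub>R ?y i) \<in> convex hull T"
      proof (rule convex_sum)
        show "finite ?A" using fin by simp
        show "convex (convex hull T)" by (rule convex_convex_hull)
        show "sum ?w ?A = 1" using fin u(2) by (simp add: sum.Plus w_sum split comp_def add.assoc)
        fix i assume i: "i \<in> ?A"
        show "0 \<le> ?w i"
          using i u(1) Mp by (auto simp: w_def S0_def Sp_def Sm_def intro!: divide_nonneg_pos mult_nonneg_nonneg)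
        show "?y i \<in> convex hull T" using i by (auto simp: T_def intro!: hull_inc)
      qed
      also have "(\<Sum>i\<in>?A. ?w i *\<^sub>R ?y i) = x"
        using fin u(3) by (simp add: sum.Plus wq_sum split comp_def add.assoc)
      finally show ?thesis .
    qed
  qed
  ultimately have "P \<inter> {x. h x = c} = convex hull T" by blast
  then show ?thesis using fin polytope_def by blast
qed

lemma polytope_Int_hyperplanes:
  fixes h :: "nat \<Rightarrow> 'a::real_vector \<Rightarrow> real"
  assumes "polytope P" "finite F" "\<And>i. linear (h i)"
  shows "polytope {x\<in>P. \<forall>i\<in>F. h i x = c i}"
  using assms(2)
proof induction
  case empty then show ?case using assms by simp
next
  case (insert j F)
  have "{x\<in>P. \<forall>i\<in>insert j F. h i x = c i} = {x\<in>P. \<forall>i\<in>F. h i x = c i} \<inter> {x. h j x = c j}" by auto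
  then show ?case using polytope_Int_hyperplane[OF insert.IH assms(3)] by simp
qed

text \<open>
  The preimage is the projection of the part of \<open>C \<times> D\<close> on which the coordinates of \<open>f x\<close> and \<open>y\<close> agree.
  Only finitely many coordinates matter, since polytopes have finitely many coordinates in common.
\<close>

lemma polytope_affine_vimage:
  fixes f h :: "vec \<Rightarrow> vec"
  assumes "polytope C" "polytope D" and h: "linear h" "\<And>x. x \<in> C \<Longrightarrow> f x = h x + c"
  shows "polytope {x\<in>C. f x \<in> D}"
proof -
  obtain F1 where F1: "finite F1" "\<And>x. x \<in> h ` C \<Longrightarrow> supp x \<subseteq> F1"
    using polytope_linear_image[OF h(1) assms(1)] polytope_finite_supp by metis
  obtain F2 where F2: "finite F2" "\<And>x. x \<in> D \<Longrightarrow> supp x \<subseteq> F2"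
    using assms(2) polytope_finite_supp by metis
  define F where "F = F1 \<union> F2 \<union> supp c"
  have F: "finite F" using F1 F2 by (simp add: F_def)
  define g where "g = (\<lambda>i (x, y). coord (h x) i - coord y i)"
  have lin: "linear (g i)" for i
    by (rule linearI) (auto simp: g_def linear_add[OF h(1)] linear_scale[OF h(1)] lookup_add algebra_simps)
  have "polytope (fst ` {z\<in>C\<times>D. \<forall>i\<in>F. g i z = - coord c i})"
    by (intro polytope_linear_image linear_fst polytope_Int_hyperplanes polytope_Times assms F lin)
  also have "fst ` {z\<in>C\<times>D. \<forall>i\<in>F. g i z = - coord c i} = {x\<in>C. f x \<in> D}"
  proof -
    have "(\<forall>i\<in>F. g i (x, y) = - coord c i) \<longleftrightarrow> y = f x" if "x \<in> C" "y \<in> D" for x y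
    proof -
      have "coord (h x) i = 0 \<and> coord y i = 0 \<and> coord c i = 0" if "i \<notin> F" for i
        using that F1(2)[of "h x"] F2(2)[of y] \<open>x \<in> C\<close> \<open>y \<in> D\<close> by (auto simp: F_def in_keys_iff subset_iff)
      then have "(\<forall>i\<in>F. g i (x, y) = - coord c i) \<longleftrightarrow> (\<forall>i. coord y i = coord (h x) i + coord c i)"
        unfolding g_def prod.case by (metis add_0_right add.commute add_diff_cancel_right' diff_eq_eq eq_diff_eq minus_diff_eq neg_equal_iff_equal uminus_add_conv_diff)
      then show ?thesis using h(2)[OF that(1)] by (auto simp: poly_mapping_eq_iff lookup_add fun_eq_iff)
    qed
    then show ?thesis by force
  qed
  finally show ?thesis .
qed

section \<open>Piecewise affine maps\<close>

text \<open>
  Continuity is not part of \<open>pw_affine\<close>; it follows, because the pieces are closed and finite in number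
  (\<open>pw_affine_continuous\<close>). Inverses of injective piecewise affine maps are piecewise affine as well
  (\<open>pw_affine_inverse\<close>), so \<open>pl_iso\<close> asks for one bijective map only.
\<close>

definition polyhedral :: "vec set \<Rightarrow> bool" where
  "polyhedral S \<longleftrightarrow> (\<exists>\<C>. finite \<C> \<and> \<Union>\<C> = S \<and> (\<forall>C\<in>\<C>. polytope C))"

definition affine_on :: "vec set \<Rightarrow> (vec \<Rightarrow> vec) \<Rightarrow> bool" where
  "affine_on C f \<longleftrightarrow> (\<exists>h c. linear h \<and> (\<forall>x\<in>C. f x = h x + c))"

definition pw_affine :: "vec set \<Rightarrow> (vec \<Rightarrow> vec) \<Rightarrow> bool" where
  "pw_affine S f \<longleftrightarrow> (\<exists>\<C>. finite \<C> \<and> \<Union>\<C> = S \<and> (\<forall>C\<in>\<C>. polytope C \<and> affine_on C f))"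

definition pl_iso :: "vec set \<Rightarrow> vec set \<Rightarrow> (vec \<Rightarrow> vec) \<Rightarrow> bool" where
  "pl_iso S T f \<longleftrightarrow> pw_affine S f \<and> bij_betw f S T"

lemma pw_affineE:
  assumes "pw_affine S f"
  obtains \<C> where "finite \<C>" "\<Union>\<C> = S" "\<And>C. C \<in> \<C> \<Longrightarrow> polytope C" "\<And>C. C \<in> \<C> \<Longrightarrow> affine_on C f"
  using assms unfolding pw_affine_def by blast

lemma pw_affine_imp_polyhedral: "pw_affine S f \<Longrightarrow> polyhedral S"
  unfolding pw_affine_def polyhedral_def by blast

lemma affine_on_linear: "linear h \<Longrightarrow> affine_on C h"
  unfolding affine_on_def by (intro exI[of _ h] exI[of _ 0]) simp

lemma pw_affine_linear: "polyhedral S \<Longrightarrow> linear h \<Longrightarrow> pw_affine S h"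
  unfolding polyhedral_def pw_affine_def using affine_on_linear by blast

lemma affine_on_subset: "affine_on C f \<Longrightarrow> D \<subseteq> C \<Longrightarrow> affine_on D f"
  unfolding affine_on_def by blast

lemma affine_on_comp:
  assumes "affine_on C f" "affine_on D g" "f ` C \<subseteq> D"
  shows "affine_on C (g \<circ> f)"
proof -
  obtain h c where h: "linear h" "\<And>x. x \<in> C \<Longrightarrow> f x = h x + c" using assms by (auto simp: affine_on_def)
  obtain k d where k: "linear k" "\<And>x. x \<in> D \<Longrightarrow> g x = k x + d" using assms by (auto simp: affine_on_def)
  have "(g \<circ> f) x = (k \<circ> h) x + (k c + d)" if "x \<in> C" for x
    using h(2)[OF that] k(2)[of "f x"] assms(3) that by (auto simp: linear_add[OF k(1)])
  moreover have "linear (k \<circ> h)" using h k by (simp add: linear_compose)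
  ultimately show ?thesis unfolding affine_on_def by blast
qed

lemma pw_affine_comp:
  assumes "pw_affine S f" "pw_affine T g" "f ` S \<subseteq> T"
  shows "pw_affine S (g \<circ> f)"
proof -
  from assms(1) obtain \<C> where C: "finite \<C>" "\<Union>\<C> = S" "\<And>C. C \<in> \<C> \<Longrightarrow> polytope C" "\<And>C. C \<in> \<C> \<Longrightarrow> affine_on C f"
    by (rule pw_affineE) blast
  from assms(2) obtain \<D> where D: "finite \<D>" "\<Union>\<D> = T" "\<And>C. C \<in> \<D> \<Longrightarrow> polytope C" "\<And>C. C \<in> \<D> \<Longrightarrow> affine_on C g"
    by (rule pw_affineE) blast
  define \<E> where "\<E> = (\<lambda>(C, D). {x\<in>C. f x \<in> D}) ` (\<C> \<times> \<D>)"
  have "finite \<E>" using C D by (simp add: \<E>_def)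
  moreover have "\<Union>\<E> = S" using C(2) D(2) assms(3) by (fastforce simp: \<E>_def)
  moreover have "polytope E \<and> affine_on E (g \<circ> f)" if EE: "E \<in> \<E>" for E
  proof -
    obtain C1 D1 where E: "E = {x\<in>C1. f x \<in> D1}" "C1 \<in> \<C>" "D1 \<in> \<D>" using EE by (auto simp: \<E>_def)
    have "polytope E" unfolding E(1)
      using C(3,4)[OF E(2)] D(3)[OF E(3)] unfolding affine_on_def by (metis (no_types, lifting) polytope_affine_vimage)
    moreover have "affine_on E (g \<circ> f)"
      by (rule affine_on_comp[OF affine_on_subset[OF C(4)[OF E(2)]] D(4)[OF E(3)]]) (auto simp: E)
    ultimately show ?thesis ..
  qed
  ultimately show ?thesis unfolding pw_affine_def by blast
qed

lemma pw_affine_subset: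
  assumes "pw_affine S f" "polyhedral S'" "S' \<subseteq> S"
  shows "pw_affine S' f"
  using pw_affine_comp[OF pw_affine_linear[OF assms(2) linear_id] assms(1)] assms(3) by simp

lemma polytope_affine_image: assumes "polytope C" "affine_on C f" shows "polytope (f ` C)"
proof -
  obtain h c where h: "linear h" "\<And>x. x \<in> C \<Longrightarrow> f x = h x + c" using assms by (auto simp: affine_on_def)
  have "f ` C = (+) c ` (h ` C)" using h(2) by (auto simp: image_image add.commute)
  then show ?thesis using polytope_linear_image[OF h(1) assms(1)] by (simp add: polytope_translation_eq)
qed

lemma polyhedral_image: assumes "pw_affine S f" shows "polyhedral (f ` S)"
proof -
  from assms obtain \<C> where C: "finite \<C>" "\<Union>\<C> = S" "\<And>C. C \<in> \<C> \<Longrightarrow> polytope C" "\<And>C. C \<in> \<C> \<Longrightarrow> affine_on C f"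
    by (rule pw_affineE) blast
  then show ?thesis unfolding polyhedral_def
    by (intro exI[of _ "(`) f ` \<C>"]) (auto intro: polytope_affine_image)
qed

text \<open>
  An affine map that is injective on a convex set \<open>C\<close> has a linear part that is injective on the
  span of the differences of points of \<open>C\<close>. By convexity every element of the span is a multiple of
  a single difference, which is how injectivity on \<open>C\<close> becomes applicable.
\<close>

lemma subspace_scaled_differences:
  fixes C :: "'a::real_vector set"
  assumes "convex C" "C \<noteq> {}"
  shows "subspace {t *\<^sub>R (x - y) | t x y. x \<in> C \<and> y \<in> C \<and> 0 \<le> t}" (is "subspace ?V")
proof (rule subspaceI)
  obtain x where "x \<in> C" using assms by blast
  then have "0 = 0 *\<^sub>R (x - x)" "x \<in> C" by auto
  then show "0 \<in> ?V" by blast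
next
  fix a b assume "a \<in> ?V" "b \<in> ?V"
  then obtain t x y s z w where ab: "a = t *\<^sub>R (x - y)" "b = s *\<^sub>R (z - w)"
    "x \<in> C" "y \<in> C" "z \<in> C" "w \<in> C" "0 \<le> t" "0 \<le> s" by blast
  show "a + b \<in> ?V"
  proof (cases "t + s = 0")
    case True then have "t = 0" "s = 0" using ab by auto
    then have "a + b = 0 *\<^sub>R (x - x)" using ab by simp
    then show ?thesis using ab by blast
  next
    case False
    let ?p = "(t / (t+s)) *\<^sub>R x + (s / (t+s)) *\<^sub>R z" and ?q = "(t / (t+s)) *\<^sub>R y + (s / (t+s)) *\<^sub>R w"
    have "t / (t+s) + s / (t+s) = 1" using False by (simp add: add_divide_distrib[symmetric])
    then have "?p \<in> C" "?q \<in> C" using ab assms(1) by (auto intro!: convexD)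
    moreover have "a + b = (t+s) *\<^sub>R (?p - ?q)"
      using False unfolding ab by (simp add: scaleR_diff_right scaleR_add_right)
    moreover have "0 \<le> t + s" using ab by simp
    ultimately show ?thesis by blast
  qed
next
  fix c a assume "a \<in> ?V"
  then obtain t x y where a: "a = t *\<^sub>R (x - y)" "x \<in> C" "y \<in> C" "0 \<le> t" by blast
  show "c *\<^sub>R a \<in> ?V"
  proof (cases "0 \<le> c")
    case True
    then have "c *\<^sub>R a = (c * t) *\<^sub>R (x - y)" "0 \<le> c * t" using a by auto
    then show ?thesis using a by blast
  next
    case False
    then have "c *\<^sub>R a = (- c * t) *\<^sub>R (y - x)" "0 \<le> - c * t"
      using a(4) unfolding a(1) by (simp_all add: algebra_simps mult_nonpos_nonneg)
    then show ?thesis using a by blast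
  qed
qed

lemma affine_on_inverse:
  assumes "convex C" "affine_on C f" "inj_on f C" "\<And>x. x \<in> C \<Longrightarrow> g (f x) = x"
  shows "affine_on (f ` C) g"
proof (cases "C = {}")
  case True then show ?thesis by (auto simp: affine_on_def intro: linear_id)
next
  case False
  then obtain x0 where x0: "x0 \<in> C" by blast
  obtain h c where h: "linear h" "\<And>x. x \<in> C \<Longrightarrow> f x = h x + c" using assms by (auto simp: affine_on_def)
  let ?V = "{t *\<^sub>R (x - y) | t x y. x \<in> C \<and> y \<in> C \<and> 0 \<le> t}"
  have V: "subspace ?V" by (rule subspace_scaled_differences[OF assms(1) False])
  have "inj_on h ?V"
  proof (rule linear_inj_on_iff_eq_0[OF h(1) V, THEN iffD2], intro ballI impI)
    fix v assume "v \<in> ?V" and h0: "h v = 0"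
    then obtain t x y where v: "v = t *\<^sub>R (x - y)" "x \<in> C" "y \<in> C" "0 \<le> t" by blast
    have "t *\<^sub>R (h x - h y) = 0" using h0 h(1) unfolding v by (simp add: linear_scale linear_diff)
    then have "t = 0 \<or> f x = f y" using h(2) v by auto
    then show "v = 0" using v assms(3) by (auto dest: inj_onD)
  qed
  then obtain k where k: "linear k" "\<And>v. v \<in> ?V \<Longrightarrow> k (h v) = v"
    using linear_exists_left_inverse_on[OF h(1) V] by blast
  have "g y = k y + (x0 - k (f x0))" if yC: "y \<in> f ` C" for y
  proof -
    obtain x where x: "x \<in> C" "y = f x" using yC by blast
    have "1 *\<^sub>R (x - x0) \<in> ?V" using x x0 zero_le_one by blast
    then have "k (h (x - x0)) = x - x0" using k(2)[of "1 *\<^sub>R (x - x0)"] by simp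
    moreover have "h (x - x0) = f x - f x0" using h x x0 by (simp add: linear_diff)
    ultimately have "k (f x) - k (f x0) = x - x0" using k(1) by (simp add: linear_diff)
    then show ?thesis using assms(4)[OF x(1)] x by (simp add: algebra_simps)
  qed
  then show ?thesis unfolding affine_on_def using k(1) by blast
qed

lemma pw_affine_inverse:
  assumes "pw_affine S f" "inj_on f S"
  shows "pw_affine (f ` S) (inv_into S f)"
proof -
  from assms(1) obtain \<C> where C: "finite \<C>" "\<Union>\<C> = S" "\<And>C. C \<in> \<C> \<Longrightarrow> polytope C" "\<And>C. C \<in> \<C> \<Longrightarrow> affine_on C f"
    by (rule pw_affineE) blast
  have "affine_on (f ` C) (inv_into S f)" if "C \<in> \<C>" for C
    using C(2-4) that assms(2)
    by (intro affine_on_inverse) (auto intro: polytope_imp_convex inj_on_subset inv_into_f_f)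
  then show ?thesis using C unfolding pw_affine_def
    by (intro exI[of _ "(`) f ` \<C>"]) (auto intro: polytope_affine_image)
qed

lemma pw_affine_continuous: assumes "pw_affine S f" shows "continuous_on S f"
proof -
  from assms obtain \<C> where C: "finite \<C>" "\<Union>\<C> = S" "\<And>C. C \<in> \<C> \<Longrightarrow> polytope C" "\<And>C. C \<in> \<C> \<Longrightarrow> affine_on C f"
    by (rule pw_affineE) blast
  have "continuous_on (\<Union>C\<in>\<C>. C) f"
  proof (rule continuous_on_closed_Union)
    fix C assume "C \<in> \<C>"
    then have "polytope C" "affine_on C f" using C by auto
    obtain F where F: "finite F" "\<And>x. x \<in> C \<Longrightarrow> supp x \<subseteq> F" using polytope_finite_supp \<open>polytope C\<close> by blast
    obtain h c where h: "linear h" "\<And>x. x \<in> C \<Longrightarrow> f x = h x + c" using \<open>affine_on C f\<close> by (auto simp: affine_on_def)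
    have "continuous_on C (\<lambda>x. h x + c)"
      by (intro continuous_on_add continuous_on_const continuous_on_linear_finite_supp[OF h(1) F])
    then show "continuous_on C f" using h(2) by (simp cong: continuous_on_cong)
    show "closed C" using \<open>polytope C\<close> by (rule polytope_imp_closed)
  qed (rule C(1))
  then show ?thesis using C(2) by simp
qed

lemma pl_on_iff_pw_affine: "pl_on S f \<longleftrightarrow> pw_affine S f"
  using pw_affine_continuous[of S f] unfolding pl_on_def pw_affine_def affine_on_def by blast

lemma pl_iso_inverse: "pl_iso S T f \<Longrightarrow> pl_iso T S (inv_into S f)"
  unfolding pl_iso_def
  using pw_affine_inverse[of S f] bij_betw_inv_into[of f S T] by (simp add: bij_betw_def)

lemma pl_iso_homeomorphism: assumes "pl_iso S T f" shows "homeomorphism S T f (inv_into S f)"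
proof -
  have b: "bij_betw f S T" using assms by (simp add: pl_iso_def)
  have "pw_affine S f" "pw_affine T (inv_into S f)" using assms pl_iso_inverse[OF assms] by (simp_all add: pl_iso_def)
  then show ?thesis unfolding homeomorphism_def
    using b bij_betw_inv_into[OF b] by (auto intro: pw_affine_continuous simp: bij_betw_inv_into_left bij_betw_inv_into_right bij_betw_imp_surj_on)
qed

lemma pl_iso_imp_pl_homeomorphism: "pl_iso S T f \<Longrightarrow> pl_homeomorphism S T f (inv_into S f)"
  using pl_iso_homeomorphism pl_iso_inverse
  unfolding pl_homeomorphism_def pl_on_iff_pw_affine by (auto simp: pl_iso_def)

lemma pl_homeomorphism_imp_pl_iso: "pl_homeomorphism S T f g \<Longrightarrow> pl_iso S T f"
  unfolding pl_homeomorphism_def pl_on_iff_pw_affine pl_iso_def homeomorphism_def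
  by (auto intro!: bij_betwI[where g=g])

lemma pl_homeomorphic_iff: "pl_homeomorphic S T \<longleftrightarrow> (\<exists>f. pl_iso S T f)"
  unfolding pl_homeomorphic_def using pl_iso_imp_pl_homeomorphism pl_homeomorphism_imp_pl_iso by metis

lemma pl_iso_comp: "pl_iso S T f \<Longrightarrow> pl_iso T U g \<Longrightarrow> pl_iso S U (g \<circ> f)"
  unfolding pl_iso_def using pw_affine_comp[of S f T g] by (auto intro: bij_betw_trans simp: bij_betw_imp_surj_on)

lemma pl_iso_restrict: "pl_iso S T f \<Longrightarrow> polyhedral S' \<Longrightarrow> S' \<subseteq> S \<Longrightarrow> pl_iso S' (f ` S') f"
  unfolding pl_iso_def using pw_affine_subset by (auto simp: bij_betw_def intro: inj_on_subset)

lemma pl_iso_image: "pl_iso S T f \<Longrightarrow> f ` S = T"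
  by (simp add: pl_iso_def bij_betw_def)

lemma pl_iso_inj_on: "pl_iso S T f \<Longrightarrow> inj_on f S"
  by (simp add: pl_iso_def bij_betw_def)

lemma pl_iso_polyhedral: "pl_iso S T f \<Longrightarrow> polyhedral S" "pl_iso S T f \<Longrightarrow> polyhedral T"
  using polyhedral_image pw_affine_imp_polyhedral by (auto simp: pl_iso_def bij_betw_def)

lemma pl_iso_linear: "polyhedral S \<Longrightarrow> linear h \<Longrightarrow> inj_on h S \<Longrightarrow> pl_iso S (h ` S) h"
  by (simp add: pl_iso_def pw_affine_linear bij_betw_def)

lemma pl_iso_id: "polyhedral S \<Longrightarrow> pl_iso S S id"
  using pl_iso_linear[OF _ linear_id] by simp

section \<open>Joins\<close>

text \<open>
  Realizations lie in the hyperplane on which the coordinates sum to \<open>1\<close>. A map between sets in such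
  hyperplanes extends to the cones over them by homogeneity (\<open>homog\<close>), and the join of two maps is
  then their direct sum. This treats the points of the two ends of a join, where one of the two
  summands vanishes, like all the others.
\<close>

definition slice :: "nat set \<Rightarrow> vec set" where
  "slice V = {x. supp x \<subseteq> V \<and> coord_sum x = 1}"

definition cone_over :: "vec set \<Rightarrow> vec set" where
  "cone_over S = insert 0 {t *\<^sub>R x | t x. 0 \<le> t \<and> x \<in> S}"

definition join_set :: "vec set \<Rightarrow> vec set \<Rightarrow> vec set" where
  "join_set S T = {a + b | a b. a \<in> cone_over S \<and> b \<in> cone_over T \<and> coord_sum (a + b) = 1}"

definition homog :: "(vec \<Rightarrow> vec) \<Rightarrow> vec \<Rightarrow> vec" where
  "homog f w = coord_sum w *\<^sub>R f (w /\<^sub>R coord_sum w)"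

definition join_map :: "nat set \<Rightarrow> nat set \<Rightarrow> (vec \<Rightarrow> vec) \<Rightarrow> (vec \<Rightarrow> vec) \<Rightarrow> vec \<Rightarrow> vec" where
  "join_map V W f g z = homog f (restrict_vec V z) + homog g (restrict_vec W z)"

lemma join_setE:
  assumes "z \<in> join_set S T"
  obtains a b where "z = a + b" "a \<in> cone_over S" "b \<in> cone_over T" "coord_sum (a + b) = 1"
  using assms unfolding join_set_def by blast

lemma homog_scaleR: "coord_sum x = 1 \<Longrightarrow> homog f (t *\<^sub>R x) = t *\<^sub>R f x"
  by (cases "t = 0") (auto simp: homog_def)

lemma homog_zero [simp]: "homog f 0 = 0"
  by (simp add: homog_def)

lemma cone_overE:
  assumes "a \<in> cone_over S" "S \<subseteq> slice V"
  obtains "a = 0" | t x where "a = t *\<^sub>R x" "0 < t" "x \<in> S" "supp x \<subseteq> V" "coord_sum x = 1" "coord_sum a = t"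
proof (cases "a = 0")
  case False
  then obtain t x where a: "a = t *\<^sub>R x" "0 \<le> t" "x \<in> S" using assms(1) by (auto simp: cone_over_def)
  moreover have "t \<noteq> 0" using a False by auto
  moreover have "supp x \<subseteq> V" "coord_sum x = 1" using a(3) assms(2) by (auto simp: slice_def)
  ultimately show ?thesis using that(2)[of t x] by simp
qed (rule that(1))

lemma cone_over_supp: "a \<in> cone_over S \<Longrightarrow> S \<subseteq> slice V \<Longrightarrow> supp a \<subseteq> V"
  by (erule cone_overE) (use supp_scaleR_subset in force)+

lemma cone_over_mono: "S \<subseteq> T \<Longrightarrow> cone_over S \<subseteq> cone_over T"
  by (auto simp: cone_over_def)

lemma zero_in_cone_over [simp]: "0 \<in> cone_over S"
  by (simp add: cone_over_def)

lemma scaleR_in_cone_over: "0 \<le> t \<Longrightarrow> x \<in> S \<Longrightarrow> t *\<^sub>R x \<in> cone_over S"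
  by (auto simp: cone_over_def)

lemma homog_cone_over: "a \<in> cone_over S \<Longrightarrow> S \<subseteq> slice V \<Longrightarrow> homog f a \<in> cone_over (f ` S)"
  by (erule cone_overE) (auto simp: homog_scaleR intro!: scaleR_in_cone_over)

lemma homog_image_cone_over:
  assumes "S \<subseteq> slice V"
  shows "homog f ` cone_over S = cone_over (f ` S)"
proof
  show "homog f ` cone_over S \<subseteq> cone_over (f ` S)" using homog_cone_over[OF _ assms] by blast
  show "cone_over (f ` S) \<subseteq> homog f ` cone_over S"
  proof
    fix b assume "b \<in> cone_over (f ` S)"
    then consider "b = 0" | t x where "b = t *\<^sub>R f x" "0 \<le> t" "x \<in> S" by (auto simp: cone_over_def)
    then show "b \<in> homog f ` cone_over S"
    proof cases
      case 1 then show ?thesis using homog_zero zero_in_cone_over by (metis image_eqI)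
    next
      case (2 t x)
      then have "b = homog f (t *\<^sub>R x)" using assms by (simp add: homog_scaleR slice_def subset_iff)
      then show ?thesis using scaleR_in_cone_over 2 by blast
    qed
  qed
qed

lemma coord_sum_homog: "a \<in> cone_over S \<Longrightarrow> S \<subseteq> slice V \<Longrightarrow> f ` S \<subseteq> slice W \<Longrightarrow> coord_sum (homog f a) = coord_sum a"
  by (erule cone_overE) (auto simp: homog_scaleR slice_def)

lemma homog_inj_on:
  assumes "S \<subseteq> slice V" "f ` S \<subseteq> slice W" "inj_on f S"
  shows "inj_on (homog f) (cone_over S)"
proof (rule inj_onI)
  fix a b assume a: "a \<in> cone_over S" and b: "b \<in> cone_over S" and eq: "homog f a = homog f b"
  have t: "coord_sum a = coord_sum b" using coord_sum_homog[OF a assms(1,2)] coord_sum_homog[OF b assms(1,2)] eq by simp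
  show "a = b" using a assms(1)
  proof (cases rule: cone_overE)
    case 1
    then have "coord_sum b = 0" using t by simp
    then show ?thesis using 1 by (cases rule: cone_overE[OF b assms(1)]) auto
  next
    case (2 s x)
    then have "coord_sum b = s" using t by simp
    show ?thesis using b assms(1)
    proof (cases rule: cone_overE)
      case 1 then show ?thesis using \<open>coord_sum b = s\<close> 2 by simp
    next
      case (2 s' y)
      then have "s' = s" using \<open>coord_sum b = s\<close> by simp
      then have "s *\<^sub>R f x = s *\<^sub>R f y" using eq 2 \<open>a = s *\<^sub>R x\<close> \<open>coord_sum x = 1\<close> by (simp add: homog_scaleR)
      then have "f x = f y" using \<open>0 < s\<close> by simp
      then show ?thesis using assms(3) 2 \<open>x \<in> S\<close> \<open>a = s *\<^sub>R x\<close> \<open>s' = s\<close> by (auto dest: inj_onD)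
    qed
  qed
qed

lemma cone_over_convex: assumes "convex C" shows "convex (cone_over C)"
proof (rule convexI)
  fix a b :: vec and u v :: real
  assume a: "a \<in> cone_over C" and b: "b \<in> cone_over C" and uv: "0 \<le> u" "0 \<le> v" "u + v = 1"
  have scale: "r *\<^sub>R w \<in> cone_over C" if "w \<in> cone_over C" "0 \<le> r" for r w
    using that unfolding cone_over_def by (clarsimp, metis mult_nonneg_nonneg)
  have add: "a + b \<in> cone_over C" if a: "a \<in> cone_over C" and b: "b \<in> cone_over C" for a b
  proof -
    have pos: "\<exists>s x. w = s *\<^sub>R x \<and> 0 < s \<and> x \<in> C" if "w \<in> cone_over C" "w \<noteq> 0" for w
    proof -
      obtain t x where "w = t *\<^sub>R x" "0 \<le> t" "x \<in> C" using \<open>w \<in> cone_over C\<close> \<open>w \<noteq> 0\<close> by (auto simp: cone_over_def)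
      moreover from this have "t \<noteq> 0" using \<open>w \<noteq> 0\<close> by auto
      ultimately show ?thesis by (metis less_eq_real_def)
    qed
    consider "a = 0 \<or> b = 0" | s x t y where "a = s *\<^sub>R x" "b = t *\<^sub>R y" "0 < s" "0 < t" "x \<in> C" "y \<in> C"
      using pos[OF a] pos[OF b] by blast
    then show ?thesis
    proof cases
      case 1 then show ?thesis using a b by auto
    next
      case (2 s x t y)
      have "(s / (s+t)) *\<^sub>R x + (t / (s+t)) *\<^sub>R y \<in> C"
        using 2 assms by (intro convexD) (auto simp: add_divide_distrib[symmetric])
      then have "(s + t) *\<^sub>R ((s / (s+t)) *\<^sub>R x + (t / (s+t)) *\<^sub>R y) \<in> cone_over C"
        using 2 by (intro scaleR_in_cone_over) auto
      moreover have "s + t \<noteq> 0" using 2 by simp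
      ultimately show ?thesis using 2 by (simp add: scaleR_add_right)
    qed
  qed
  show "u *\<^sub>R a + v *\<^sub>R b \<in> cone_over C" using a b uv by (intro add scale)
qed

text \<open>The pieces of the join of two piecewise affine maps are the joins of pieces.\<close>

lemma join_set_convex_hull:
  assumes "convex hull A \<subseteq> slice V" "convex hull B \<subseteq> slice W"
  shows "join_set (convex hull A) (convex hull B) = convex hull (A \<union> B)"
proof
  let ?C = "convex hull A" and ?D = "convex hull B"
  show "join_set ?C ?D \<subseteq> convex hull (A \<union> B)"
  proof
    fix z assume "z \<in> join_set ?C ?D"
    then obtain a b where z: "z = a + b" "a \<in> cone_over ?C" "b \<in> cone_over ?D" "coord_sum (a + b) = 1" by (rule join_setE)
    have sub: "?C \<subseteq> convex hull (A \<union> B)" "?D \<subseteq> convex hull (A \<union> B)" by (simp_all add: hull_mono)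
    show "z \<in> convex hull (A \<union> B)" using z(2) assms(1)
    proof (cases rule: cone_overE)
      case 1
      then show ?thesis using z sub by (cases rule: cone_overE[OF z(3) assms(2)]) auto
    next
      case (2 s x)
      show ?thesis using z(3) assms(2)
      proof (cases rule: cone_overE)
        case 1
        then show ?thesis using z 2 sub by auto
      next
        case (2 t y)
        then show ?thesis unfolding z(1)
          using \<open>a = s *\<^sub>R x\<close> \<open>0 < s\<close> \<open>x \<in> ?C\<close> \<open>coord_sum a = s\<close> sub z(4)
          by (auto intro!: convexD[OF convex_convex_hull])
      qed
    qed
  qed
  show "convex hull (A \<union> B) \<subseteq> join_set ?C ?D"
  proof (rule hull_minimal)
    have 1: "x \<in> join_set ?C ?D" if "x \<in> A" for x
    proof -
      have "x \<in> ?C" using that by (rule hull_inc)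
      then have "1 *\<^sub>R x \<in> cone_over ?C" "coord_sum x = 1" using scaleR_in_cone_over[of 1] assms(1) by (auto simp: slice_def)
      then show ?thesis unfolding join_set_def by (intro CollectI exI[of _ x] exI[of _ 0]) auto
    qed
    have 2: "x \<in> join_set ?C ?D" if "x \<in> B" for x
    proof -
      have "x \<in> ?D" using that by (rule hull_inc)
      then have "1 *\<^sub>R x \<in> cone_over ?D" "coord_sum x = 1" using scaleR_in_cone_over[of 1] assms(2) by (auto simp: slice_def)
      then show ?thesis unfolding join_set_def by (intro CollectI exI[of _ 0] exI[of _ x]) auto
    qed
    show "A \<union> B \<subseteq> join_set ?C ?D" using 1 2 by blast
    show "convex (join_set ?C ?D)"
    proof (rule convexI)
      fix z w :: vec and u v :: real
      assume z: "z \<in> join_set ?C ?D" and w: "w \<in> join_set ?C ?D" and uv: "0 \<le> u" "0 \<le> v" "u + v = 1"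
      obtain a b where ab: "z = a + b" "a \<in> cone_over ?C" "b \<in> cone_over ?D" "coord_sum (a + b) = 1" using z by (rule join_setE)
      obtain c d where cd: "w = c + d" "c \<in> cone_over ?C" "d \<in> cone_over ?D" "coord_sum (c + d) = 1" using w by (rule join_setE)
      have "u *\<^sub>R a + v *\<^sub>R c \<in> cone_over ?C" "u *\<^sub>R b + v *\<^sub>R d \<in> cone_over ?D"
        using ab cd uv by (auto intro!: convexD cone_over_convex)
      moreover have "u *\<^sub>R z + v *\<^sub>R w = (u *\<^sub>R a + v *\<^sub>R c) + (u *\<^sub>R b + v *\<^sub>R d)"
        unfolding ab cd by (simp add: scaleR_add_right)
      moreover have "coord_sum (u *\<^sub>R z + v *\<^sub>R w) = 1" using ab cd uv by simp
      ultimately show "u *\<^sub>R z + v *\<^sub>R w \<in> join_set ?C ?D" unfolding join_set_def by (metis (mono_tags, lifting) mem_Collect_eq)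
    qed
  qed
qed

lemma polytope_join_set:
  assumes "polytope C" "polytope D" "C \<subseteq> slice V" "D \<subseteq> slice W"
  shows "polytope (join_set C D)"
proof -
  obtain A B where "finite A" "C = convex hull A" "finite B" "D = convex hull B" using assms by (auto simp: polytope_def)
  then show ?thesis using join_set_convex_hull[of A V B W] assms by (auto simp: polytope_convex_hull)
qed

locale join_setting =
  fixes V W V' W' :: "nat set" and S T :: "vec set" and f g :: "vec \<Rightarrow> vec"
  assumes disj: "V \<inter> W = {}" and disj': "V' \<inter> W' = {}"
    and S: "S \<subseteq> slice V" and T: "T \<subseteq> slice W" and fS: "f ` S \<subseteq> slice V'" and gT: "g ` T \<subseteq> slice W'"
begin

lemma restrict_sum:
  assumes "a \<in> cone_over S" "b \<in> cone_over T"
  shows "restrict_vec V (a + b) = a" "restrict_vec W (a + b) = b"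
  using cone_over_supp[OF assms(1) S] cone_over_supp[OF assms(2) T] disj
  by (auto simp: restrict_vec_id intro!: restrict_vec_disjoint)

lemma join_map_sum:
  assumes "a \<in> cone_over S" "b \<in> cone_over T"
  shows "join_map V W f g (a + b) = homog f a + homog g b"
  by (simp only: join_map_def restrict_sum[OF assms])

lemma join_map_image: "join_map V W f g ` join_set S T = join_set (f ` S) (g ` T)"
proof
  show "join_map V W f g ` join_set S T \<subseteq> join_set (f ` S) (g ` T)"
  proof clarify
    fix z assume "z \<in> join_set S T"
    then obtain a b where z: "z = a + b" "a \<in> cone_over S" "b \<in> cone_over T" "coord_sum (a + b) = 1" by (rule join_setE)
    then have "homog f a \<in> cone_over (f ` S)" "homog g b \<in> cone_over (g ` T)" "coord_sum (homog f a + homog g b) = 1"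
      using homog_cone_over S T coord_sum_homog[OF z(2) S fS] coord_sum_homog[OF z(3) T gT] by auto
    then show "join_map V W f g z \<in> join_set (f ` S) (g ` T)"
      unfolding z(1) join_map_sum[OF z(2,3)] join_set_def by blast
  qed
  show "join_set (f ` S) (g ` T) \<subseteq> join_map V W f g ` join_set S T"
  proof
    fix z assume "z \<in> join_set (f ` S) (g ` T)"
    then obtain a' b' where z: "z = a' + b'" "a' \<in> cone_over (f ` S)" "b' \<in> cone_over (g ` T)" "coord_sum (a' + b') = 1"
      by (rule join_setE)
    obtain a b where ab: "a' = homog f a" "b' = homog g b" "a \<in> cone_over S" "b \<in> cone_over T"
      using z(2,3) unfolding homog_image_cone_over[OF S, of f, symmetric] homog_image_cone_over[OF T, of g, symmetric] by blast
    then have "coord_sum (a + b) = 1" using z(4) coord_sum_homog[OF ab(3) S fS] coord_sum_homog[OF ab(4) T gT] by simp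
    then have "a + b \<in> join_set S T" using ab unfolding join_set_def by blast
    moreover have "join_map V W f g (a + b) = z" using join_map_sum ab z by simp
    ultimately show "z \<in> join_map V W f g ` join_set S T" by blast
  qed
qed

lemma join_map_inj_on:
  assumes "inj_on f S" "inj_on g T"
  shows "inj_on (join_map V W f g) (join_set S T)"
proof (rule inj_onI)
  fix z w assume zJ: "z \<in> join_set S T" and wJ: "w \<in> join_set S T" and eq: "join_map V W f g z = join_map V W f g w"
  obtain a b where z: "z = a + b" "a \<in> cone_over S" "b \<in> cone_over T" using zJ by (rule join_setE)
  obtain c d where w: "w = c + d" "c \<in> cone_over S" "d \<in> cone_over T" using wJ by (rule join_setE)
  interpret image: join_setting V' W' V' W' "f ` S" "g ` T" id id
    using disj' fS gT by unfold_locales auto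
  have eq': "homog f a + homog g b = homog f c + homog g d"
    using eq unfolding z(1) w(1) join_map_sum[OF z(2,3)] join_map_sum[OF w(2,3)] .
  note h = homog_cone_over[OF z(2) S, of f] homog_cone_over[OF z(3) T, of g] homog_cone_over[OF w(2) S, of f] homog_cone_over[OF w(3) T, of g]
  have "homog f a = homog f c" "homog g b = homog g d"
    using image.restrict_sum[OF h(1,2)] image.restrict_sum[OF h(3,4)] eq' by simp_all
  then show "z = w" unfolding z w
    using homog_inj_on[OF S fS assms(1)] homog_inj_on[OF T gT assms(2)] z w by (auto dest: inj_onD)
qed

lemma join_map_pw_affine:
  assumes "pw_affine S f" "pw_affine T g"
  shows "pw_affine (join_set S T) (join_map V W f g)"
proof -
  from assms(1) obtain \<C> where C: "finite \<C>" "\<Union>\<C> = S" "\<And>C. C \<in> \<C> \<Longrightarrow> polytope C" "\<And>C. C \<in> \<C> \<Longrightarrow> affine_on C f"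
    by (rule pw_affineE) blast
  from assms(2) obtain \<D> where D: "finite \<D>" "\<Union>\<D> = T" "\<And>C. C \<in> \<D> \<Longrightarrow> polytope C" "\<And>C. C \<in> \<D> \<Longrightarrow> affine_on C g"
    by (rule pw_affineE) blast
  \<comment> \<open>If \<open>S\<close> or \<open>T\<close> is empty, its family of pieces may be empty, but the join is still the other set.\<close>
  define \<E> where "\<E> = (\<lambda>(C, D). join_set C D) ` (insert {} \<C> \<times> insert {} \<D>)"
  have C': "polytope C1 \<and> affine_on C1 f \<and> C1 \<subseteq> S" if "C1 \<in> insert {} \<C>" for C1
    using that C by (auto simp: affine_on_def polytope_empty intro: linear_id)
  have D': "polytope C1 \<and> affine_on C1 g \<and> C1 \<subseteq> T" if "C1 \<in> insert {} \<D>" for C1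
    using that D by (auto simp: affine_on_def polytope_empty intro: linear_id)
  have cone_C: "\<exists>C1\<in>insert {} \<C>. a \<in> cone_over C1" if "a \<in> cone_over S" for a
    using that C(2) by (force simp: cone_over_def)
  have cone_D: "\<exists>C1\<in>insert {} \<D>. a \<in> cone_over C1" if "a \<in> cone_over T" for a
    using that D(2) by (force simp: cone_over_def)
  have "finite \<E>" using C D by (simp add: \<E>_def)
  moreover have "\<Union>\<E> = join_set S T"
  proof
    show "\<Union>\<E> \<subseteq> join_set S T"
    proof
      fix z assume "z \<in> \<Union>\<E>"
      then obtain C1 D1 where CD: "C1 \<in> insert {} \<C>" "D1 \<in> insert {} \<D>" "z \<in> join_set C1 D1" by (auto simp: \<E>_def)
      show "z \<in> join_set S T" using CD(3)
      proof (rule join_setE)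
        fix a b assume "z = a + b" "a \<in> cone_over C1" "b \<in> cone_over D1" "coord_sum (a + b) = 1"
        moreover have "C1 \<subseteq> S" "D1 \<subseteq> T" using C' D' CD by blast+
        ultimately show ?thesis using cone_over_mono unfolding join_set_def by blast
      qed
    qed
    show "join_set S T \<subseteq> \<Union>\<E>"
    proof
      fix z assume "z \<in> join_set S T"
      then obtain a b where z: "z = a + b" "a \<in> cone_over S" "b \<in> cone_over T" "coord_sum (a + b) = 1" by (rule join_setE)
      obtain C1 D1 where "C1 \<in> insert {} \<C>" "D1 \<in> insert {} \<D>" "a \<in> cone_over C1" "b \<in> cone_over D1"
        using cone_C[OF z(2)] cone_D[OF z(3)] by blast
      then have "z \<in> join_set C1 D1" "join_set C1 D1 \<in> \<E>" using z by (auto simp: join_set_def \<E>_def)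
      then show "z \<in> \<Union>\<E>" by blast
    qed
  qed
  moreover have "polytope E \<and> affine_on E (join_map V W f g)" if EE: "E \<in> \<E>" for E
  proof -
    obtain C1 D1 where E: "E = join_set C1 D1" "C1 \<in> insert {} \<C>" "D1 \<in> insert {} \<D>" using EE by (auto simp: \<E>_def)
    note c = C'[OF E(2)] and d = D'[OF E(3)]
    have sub: "C1 \<subseteq> slice V" "D1 \<subseteq> slice W" using c d S T by auto
    have "polytope E" unfolding E(1) using c d sub by (auto intro: polytope_join_set)
    moreover obtain h k :: "vec \<Rightarrow> vec" and u v where h: "linear h" "\<And>x. x \<in> C1 \<Longrightarrow> f x = h x + u" and k: "linear k" "\<And>x. x \<in> D1 \<Longrightarrow> g x = k x + v"
      using c d by (auto simp: affine_on_def)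
    define j where "j z = (h (restrict_vec V z) + coord_sum (restrict_vec V z) *\<^sub>R u) + (k (restrict_vec W z) + coord_sum (restrict_vec W z) *\<^sub>R v)" for z
    have "linear j"
      by (rule linearI) (simp_all add: j_def linear_add[OF h(1)] linear_add[OF k(1)] linear_scale[OF h(1)] linear_scale[OF k(1)] algebra_simps)
    moreover have "join_map V W f g z = j z" if zE: "z \<in> E" for z
    proof -
      obtain a b where z: "z = a + b" "a \<in> cone_over C1" "b \<in> cone_over D1" using zE[unfolded E(1)] by (rule join_setE)
      have ab: "a \<in> cone_over S" "b \<in> cone_over T" using z c d cone_over_mono by blast+
      have "homog f a = h a + coord_sum a *\<^sub>R u" using z(2) sub(1)
        by (cases rule: cone_overE) (auto simp: homog_scaleR h linear_0 linear_scale scaleR_add_right)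
      moreover have "homog g b = k b + coord_sum b *\<^sub>R v" using z(3) sub(2)
        by (cases rule: cone_overE) (auto simp: homog_scaleR k linear_0 linear_scale scaleR_add_right)
      ultimately show ?thesis unfolding z(1) join_map_sum[OF ab] j_def restrict_sum[OF ab] by simp
    qed
    ultimately show ?thesis unfolding affine_on_def by (metis add.right_neutral)
  qed
  ultimately show ?thesis unfolding pw_affine_def by blast
qed

end

lemma pl_iso_join:
  assumes "V \<inter> W = {}" "V' \<inter> W' = {}" "S \<subseteq> slice V" "T \<subseteq> slice W" "S' \<subseteq> slice V'" "T' \<subseteq> slice W'"
    and f: "pl_iso S S' f" and g: "pl_iso T T' g"
  shows "pl_iso (join_set S T) (join_set S' T') (join_map V W f g)"
proof -
  interpret join_setting V W V' W' S T f g
    using assms by unfold_locales (auto simp: pl_iso_image)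
  show ?thesis using join_map_pw_affine join_map_inj_on join_map_image f g
    by (auto simp: pl_iso_def bij_betw_def)
qed

section \<open>Realizations of complexes\<close>

text \<open>
  Unlike \<open>scpx\<close>, this allows an arbitrary finite ground set, so that joins and replacements need no
  renumbering of vertices.
\<close>

definition complex_on :: "nat set \<Rightarrow> nat set set \<Rightarrow> bool" where
  "complex_on V K \<longleftrightarrow> finite V \<and> K \<subseteq> Pow V \<and> (\<forall>I\<in>K. \<forall>J. J \<subseteq> I \<longrightarrow> J \<in> K)"

lemma complex_onD:
  assumes "complex_on V K"
  shows "finite V" "I \<in> K \<Longrightarrow> I \<subseteq> V" "I \<in> K \<Longrightarrow> J \<subseteq> I \<Longrightarrow> J \<in> K" "I \<in> K \<Longrightarrow> finite I" "finite K"
proof -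
  show 1: "finite V" and 2: "I \<in> K \<Longrightarrow> I \<subseteq> V" and "I \<in> K \<Longrightarrow> J \<subseteq> I \<Longrightarrow> J \<in> K"
    using assms unfolding complex_on_def by blast+
  show "I \<in> K \<Longrightarrow> finite I" using 1 2 finite_subset by blast
  have "K \<subseteq> Pow V" using assms unfolding complex_on_def by blast
  then show "finite K" by (rule finite_subset) (simp add: 1)
qed

lemma complex_on_mono: "complex_on V K \<Longrightarrow> V \<subseteq> W \<Longrightarrow> finite W \<Longrightarrow> complex_on W K"
  by (auto simp: complex_on_def)

lemma hull_basis_vec:
  assumes "finite I"
  shows "convex hull (basis_vec ` I) = {x. (\<forall>i. 0 \<le> coord x i) \<and> supp x \<subseteq> I \<and> coord_sum x = 1}" (is "_ = ?R")
proof
  have "convex {x :: vec. \<forall>i. 0 \<le> coord x i}" by (rule convexI) (simp add: lookup_add)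
  moreover have "convex {x. coord_sum x = 1}" by (rule convexI) simp
  ultimately have "convex ({x. \<forall>i. 0 \<le> coord x i} \<inter> {x. supp x \<subseteq> I} \<inter> {x. coord_sum x = 1})"
    by (intro convex_Int convex_supp_subset)
  moreover have "{x. \<forall>i. 0 \<le> coord x i} \<inter> {x. supp x \<subseteq> I} \<inter> {x. coord_sum x = 1} = ?R" by blast
  moreover have "basis_vec ` I \<subseteq> ?R" by (auto simp: coord_sum_def lookup_single when_def)
  ultimately show "convex hull (basis_vec ` I) \<subseteq> ?R" by (intro hull_minimal) simp_all
  show "?R \<subseteq> convex hull (basis_vec ` I)"
  proof
    fix x assume "x \<in> ?R"
    then have x: "\<And>i. 0 \<le> coord x i" "supp x \<subseteq> I" "coord_sum x = 1" by auto
    have "(\<Sum>i\<in>I. coord x i *\<^sub>R basis_vec i) \<in> convex hull (basis_vec ` I)"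
      using assms x coord_sum_eq_sum[OF assms x(2)] by (intro convex_sum) (auto intro: hull_inc)
    then show "x \<in> convex hull (basis_vec ` I)" using vec_sum_basis[OF assms x(2)] by simp
  qed
qed

lemma realization_iff:
  assumes "complex_on V K"
  shows "x \<in> realization K \<longleftrightarrow> (\<forall>i. 0 \<le> coord x i) \<and> supp x \<in> K \<and> coord_sum x = 1"
proof -
  have "x \<in> realization K \<longleftrightarrow> (\<exists>I\<in>K. (\<forall>i. 0 \<le> coord x i) \<and> supp x \<subseteq> I \<and> coord_sum x = 1)"
    unfolding realization_def UN_iff using hull_basis_vec complex_onD(4)[OF assms] by (intro bex_cong) auto
  then show ?thesis using complex_onD(3)[OF assms] by blast
qed

lemma realization_mono: "K \<subseteq> L \<Longrightarrow> realization K \<subseteq> realization L"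
  unfolding realization_def by blast

lemma realization_subset_slice: "complex_on V K \<Longrightarrow> realization K \<subseteq> slice V"
  using complex_onD(2)[of V K] realization_iff[of V K] unfolding slice_def by blast

lemma polyhedral_realization: assumes "complex_on V K" shows "polyhedral (realization K)"
proof -
  have "polytope (convex hull (basis_vec ` I))" if "I \<in> K" for I
    using complex_onD(4)[OF assms that] by (intro polytope_convex_hull finite_imageI)
  then show ?thesis unfolding polyhedral_def realization_def
    using complex_onD(5)[OF assms] by (intro exI[of _ "(\<lambda>I. convex hull (basis_vec ` I)) ` K"] conjI) auto
qed

lemma cone_over_realization_iff:
  assumes "complex_on V K" "{} \<in> K"
  shows "a \<in> cone_over (realization K) \<longleftrightarrow> (\<forall>i. 0 \<le> coord a i) \<and> supp a \<in> K"
proof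
  assume "a \<in> cone_over (realization K)"
  then show "(\<forall>i. 0 \<le> coord a i) \<and> supp a \<in> K"
    using realization_subset_slice[OF assms(1)]
  proof (cases rule: cone_overE)
    case 1 then show ?thesis using assms by simp
  next
    case (2 t x)
    then have "supp a = supp x" by (auto simp: in_keys_iff)
    then show ?thesis using 2 realization_iff[OF assms(1), of x] by simp
  qed
next
  assume a: "(\<forall>i. 0 \<le> coord a i) \<and> supp a \<in> K"
  show "a \<in> cone_over (realization K)"
  proof (cases "coord_sum a = 0")
    case True
    then have "\<forall>i\<in>supp a. coord a i = 0" using a by (simp add: coord_sum_def sum_nonneg_eq_0_iff)
    then have "a = 0" by (auto intro!: poly_mapping_eqI simp: in_keys_iff)
    then show ?thesis by simp
  next
    case False
    moreover have "0 \<le> coord_sum a" using a by (auto simp: coord_sum_def intro: sum_nonneg)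
    ultimately have s: "0 < coord_sum a" by simp
    have "supp (a /\<^sub>R coord_sum a) = supp a" using s by (auto simp: in_keys_iff)
    then have "a /\<^sub>R coord_sum a \<in> realization K" using a s by (simp add: realization_iff[OF assms(1)])
    then have "coord_sum a *\<^sub>R (a /\<^sub>R coord_sum a) \<in> cone_over (realization K)" using s by (intro scaleR_in_cone_over) auto
    then show ?thesis using s by simp
  qed
qed

definition join_complex :: "nat set \<Rightarrow> nat set \<Rightarrow> nat set set \<Rightarrow> nat set set \<Rightarrow> nat set set" where
  "join_complex V W K L = {J. J \<subseteq> V \<union> W \<and> J \<inter> V \<in> K \<and> J \<inter> W \<in> L}"

lemma complex_on_join:
  assumes "complex_on V K" "complex_on W L"
  shows "complex_on (V \<union> W) (join_complex V W K L)"
  unfolding complex_on_def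
proof (intro conjI ballI allI impI)
  show "finite (V \<union> W)" using assms by (auto dest: complex_onD)
  show "join_complex V W K L \<subseteq> Pow (V \<union> W)" by (auto simp: join_complex_def)
  fix I J assume "I \<in> join_complex V W K L" "J \<subseteq> I"
  then show "J \<in> join_complex V W K L" unfolding join_complex_def
    using complex_onD(3)[OF assms(1), of "I \<inter> V" "J \<inter> V"] complex_onD(3)[OF assms(2), of "I \<inter> W" "J \<inter> W"] by auto
qed

lemma supp_add_nonneg:
  assumes "\<And>i. 0 \<le> coord a i" "\<And>i. 0 \<le> coord b i"
  shows "supp (a + b) = supp a \<union> supp b"
proof (rule Set.set_eqI)
  fix i show "i \<in> supp (a + b) \<longleftrightarrow> i \<in> supp a \<union> supp b"
    using assms(1)[of i] assms(2)[of i] by (auto simp: in_keys_iff lookup_add)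
qed

lemma restrict_vec_split:
  assumes "supp z \<subseteq> V \<union> W" "V \<inter> W = {}"
  shows "z = restrict_vec V z + restrict_vec W z"
proof (rule poly_mapping_eqI)
  fix i show "coord z i = coord (restrict_vec V z + restrict_vec W z) i"
    using assms by (cases "i \<in> supp z") (auto simp: lookup_add in_keys_iff)
qed

lemma realization_join:
  assumes K: "complex_on V K" "{} \<in> K" and L: "complex_on W L" "{} \<in> L" and disj: "V \<inter> W = {}"
  shows "realization (join_complex V W K L) = join_set (realization K) (realization L)"
proof (rule Set.set_eqI, rule iffI)
  note r = realization_iff[OF complex_on_join[OF K(1) L(1)]]
  fix z
  { assume "z \<in> realization (join_complex V W K L)"
    then have z: "\<And>i. 0 \<le> coord z i" "supp z \<subseteq> V \<union> W" "supp z \<inter> V \<in> K" "supp z \<inter> W \<in> L" "coord_sum z = 1"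
      unfolding r by (auto simp: join_complex_def)
    have "restrict_vec V z \<in> cone_over (realization K)" "restrict_vec W z \<in> cone_over (realization L)"
      using z cone_over_realization_iff[OF K] cone_over_realization_iff[OF L] by simp_all
    moreover note restrict_vec_split[OF z(2) disj]
    ultimately show "z \<in> join_set (realization K) (realization L)" using z(5) unfolding join_set_def
      by (metis (mono_tags, lifting) mem_Collect_eq) }
  assume "z \<in> join_set (realization K) (realization L)"
  then obtain a b where z: "z = a + b" "a \<in> cone_over (realization K)" "b \<in> cone_over (realization L)" "coord_sum (a + b) = 1"
    by (rule join_setE)
  then have ab: "\<And>i. 0 \<le> coord a i" "supp a \<in> K" "\<And>i. 0 \<le> coord b i" "supp b \<in> L"
    using cone_over_realization_iff[OF K] cone_over_realization_iff[OF L] by auto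
  have sub: "supp a \<subseteq> V" "supp b \<subseteq> W" using ab complex_onD(2)[OF K(1)] complex_onD(2)[OF L(1)] by auto
  have s: "supp z = supp a \<union> supp b" unfolding z(1) by (rule supp_add_nonneg) (use ab in auto)
  then have "supp z \<inter> V = supp a" "supp z \<inter> W = supp b" using sub disj by auto
  then have "supp z \<in> join_complex V W K L" using ab s sub by (auto simp: join_complex_def)
  moreover have "0 \<le> coord z i" for i using ab(1,3)[of i] by (simp add: z lookup_add)
  ultimately show "z \<in> realization (join_complex V W K L)" unfolding r using z(1,4) by simp
qed

subsection \<open>Relabelling\<close>

text \<open>
  The linear map that relabels the basis vectors. Since \<open>\<sigma>\<close> may fail to be injective outside the
  relevant vertices, the coordinates are summed over fibres.
\<close>

definition push :: "(nat \<Rightarrow> nat) \<Rightarrow> vec \<Rightarrow> vec" where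
  "push \<sigma> x = (\<Sum>i\<in>supp x. coord x i *\<^sub>R basis_vec (\<sigma> i))"

lemma push_eq_sum: "finite F \<Longrightarrow> supp x \<subseteq> F \<Longrightarrow> push \<sigma> x = (\<Sum>i\<in>F. coord x i *\<^sub>R basis_vec (\<sigma> i))"
  unfolding push_def by (rule sum.mono_neutral_left) (auto simp: in_keys_iff)

lemma linear_push: "linear (push \<sigma>)"
proof (rule linearI)
  fix x y :: vec
  have "push \<sigma> z = (\<Sum>i\<in>supp x \<union> supp y. coord z i *\<^sub>R basis_vec (\<sigma> i))" if "supp z \<subseteq> supp x \<union> supp y" for z
    by (rule push_eq_sum[OF _ that]) auto
  then show "push \<sigma> (x + y) = push \<sigma> x + push \<sigma> y"
    by (simp add: Poly_Mapping.keys_add lookup_add sum.distrib scaleR_add_left)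
next
  fix r and x :: vec
  have "push \<sigma> (r *\<^sub>R x) = (\<Sum>i\<in>supp x. coord (r *\<^sub>R x) i *\<^sub>R basis_vec (\<sigma> i))"
    by (rule push_eq_sum) (auto simp: supp_scaleR_subset)
  then show "push \<sigma> (r *\<^sub>R x) = r *\<^sub>R push \<sigma> x"
    by (simp add: push_def scaleR_sum_right)
qed

lemma push_basis_vec: "push \<sigma> (basis_vec i) = basis_vec (\<sigma> i)"
  by (simp add: push_def)

lemma push_push: "push \<sigma> (push \<tau> x) = push (\<sigma> \<circ> \<tau>) x"
proof -
  have "push \<sigma> (push \<tau> x) = (\<Sum>i\<in>supp x. push \<sigma> (coord x i *\<^sub>R basis_vec (\<tau> i)))"
    unfolding push_def[of \<tau>] by (rule linear_sum[OF linear_push])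
  then show ?thesis by (simp only: linear_scale[OF linear_push] push_basis_vec) (simp add: push_def)
qed

lemma push_cong_id: assumes "\<And>i. i \<in> supp x \<Longrightarrow> \<sigma> i = i" shows "push \<sigma> x = x"
proof -
  have "push \<sigma> x = (\<Sum>i\<in>supp x. coord x i *\<^sub>R basis_vec i)" unfolding push_def using assms by (intro sum.cong) auto
  then show ?thesis using vec_sum_basis[of "supp x" x] by simp
qed

lemma complex_on_image: assumes "complex_on V K" shows "complex_on (\<sigma> ` V) ((`) \<sigma> ` K)"
  unfolding complex_on_def
proof (intro conjI ballI allI impI)
  show "finite (\<sigma> ` V)" "(`) \<sigma> ` K \<subseteq> Pow (\<sigma> ` V)" using assms by (auto simp: complex_on_def)
  fix I J assume "I \<in> (`) \<sigma> ` K" "J \<subseteq> I"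
  then obtain I0 where "I0 \<in> K" "J \<subseteq> \<sigma> ` I0" by auto
  then obtain J0 where "J = \<sigma> ` J0" "J0 \<subseteq> I0" by (meson subset_image_iff)
  then show "J \<in> (`) \<sigma> ` K" using complex_onD(3)[OF assms \<open>I0 \<in> K\<close>] by blast
qed

lemma push_realization:
  assumes "complex_on V K" "x \<in> realization K"
  shows "push \<sigma> x \<in> realization ((`) \<sigma> ` K)"
proof -
  have x: "\<And>i. 0 \<le> coord x i" "supp x \<in> K" "coord_sum x = 1" using assms by (auto simp: realization_iff)
  have "push \<sigma> x \<in> convex hull (basis_vec ` \<sigma> ` supp x)" unfolding push_def
    using x by (intro convex_sum) (auto intro: hull_inc simp: coord_sum_def)
  then show ?thesis using x(2) unfolding realization_def by blast
qed

lemma pl_iso_push: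
  assumes K: "complex_on V K" and inj: "inj_on \<sigma> V"
  shows "pl_iso (realization K) (realization ((`) \<sigma> ` K)) (push \<sigma>)"
proof -
  define \<tau> where "\<tau> = inv_into V \<sigma>"
  have inv_image: "(`) \<tau> ` (`) \<sigma> ` K = K"
  proof -
    have "\<tau> ` \<sigma> ` I = I" if "I \<in> K" for I
      using complex_onD(2)[OF K that] inj by (simp add: inv_into_image_cancel \<tau>_def)
    then show ?thesis by (simp add: image_image)
  qed
  have "bij_betw (push \<sigma>) (realization K) (realization ((`) \<sigma> ` K))"
  proof (rule bij_betwI[where g = "push \<tau>"])
    show "push \<sigma> \<in> realization K \<rightarrow> realization ((`) \<sigma> ` K)" using push_realization[OF K] by blast
    show "push \<tau> \<in> realization ((`) \<sigma> ` K) \<rightarrow> realization K"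
      using push_realization[OF complex_on_image[OF K], of _ \<sigma> \<tau>] unfolding inv_image by blast
    show "push \<tau> (push \<sigma> x) = x" if "x \<in> realization K" for x
    proof -
      have "supp x \<subseteq> V" using realization_subset_slice[OF K] that by (auto simp: slice_def)
      then show ?thesis unfolding push_push by (intro push_cong_id) (use inj in \<open>auto simp: \<tau>_def\<close>)
    qed
    show "push \<sigma> (push \<tau> y) = y" if "y \<in> realization ((`) \<sigma> ` K)" for y
    proof -
      have "supp y \<subseteq> \<sigma> ` V" using realization_subset_slice[OF complex_on_image[OF K]] that by (auto simp: slice_def)
      then show ?thesis unfolding push_push by (intro push_cong_id) (auto simp: f_inv_into_f \<tau>_def)
    qed
  qed
  then show ?thesis using pw_affine_linear[OF polyhedral_realization[OF K] linear_push] by (simp add: pl_iso_def)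
qed

section \<open>Balls and spheres\<close>

text \<open>
  The models are simplices on arbitrary finite vertex sets, whose vertices can be chosen apart from
  any given ones (\<open>ball_pair_fresh\<close>). In \<open>ball_pair S S'\<close> the set \<open>S'\<close> is the boundary of the ball \<open>S\<close>.
\<close>

abbreviation full_simplex :: "nat set \<Rightarrow> vec set" where "full_simplex V \<equiv> realization (Pow V)"
abbreviation simplex_boundary :: "nat set \<Rightarrow> vec set" where "simplex_boundary V \<equiv> realization (Pow V - {V})"

lemma complex_on_Pow: "finite V \<Longrightarrow> complex_on V (Pow V)"
  and complex_on_boundary: "finite V \<Longrightarrow> complex_on V (Pow V - {V})"
  by (auto simp: complex_on_def)

definition ball_pair :: "vec set \<Rightarrow> vec set \<Rightarrow> bool" where
  "ball_pair S S' \<longleftrightarrow> (\<exists>V f. finite V \<and> V \<noteq> {} \<and> pl_iso S (full_simplex V) f \<and> S' \<subseteq> S \<and> f ` S' = simplex_boundary V)"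

definition ball_like :: "vec set \<Rightarrow> bool" where
  "ball_like S \<longleftrightarrow> (\<exists>V f. finite V \<and> V \<noteq> {} \<and> pl_iso S (full_simplex V) f)"

definition sphere_like :: "vec set \<Rightarrow> bool" where
  "sphere_like S \<longleftrightarrow> (\<exists>V f. finite V \<and> V \<noteq> {} \<and> pl_iso S (simplex_boundary V) f)"

abbreviation ball_or_sphere :: "vec set \<Rightarrow> bool" where
  "ball_or_sphere S \<equiv> ball_like S \<or> sphere_like S"

lemma pl_iso_simplex_push:
  assumes "finite V" "inj_on \<sigma> V"
  shows "pl_iso (full_simplex V) (full_simplex (\<sigma> ` V)) (push \<sigma>)"
    "pl_iso (simplex_boundary V) (simplex_boundary (\<sigma> ` V)) (push \<sigma>)"
proof -
  have 1: "(`) \<sigma> ` Pow V = Pow (\<sigma> ` V)" by (rule image_Pow_surj) simp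
  have 2: "(`) \<sigma> ` (Pow V - {V}) = Pow (\<sigma> ` V) - {\<sigma> ` V}"
    using inj_on_image_set_diff[OF inj_on_image_Pow[OF assms(2)], of "Pow V" "{V}"] 1 by simp
  show "pl_iso (full_simplex V) (full_simplex (\<sigma> ` V)) (push \<sigma>)"
    using pl_iso_push[OF complex_on_Pow[OF assms(1)] assms(2)] 1 by simp
  show "pl_iso (simplex_boundary V) (simplex_boundary (\<sigma> ` V)) (push \<sigma>)"
    using pl_iso_push[OF complex_on_boundary[OF assms(1)] assms(2)] 2 by simp
qed

lemma ball_pair_relabel:
  assumes "pl_iso S (full_simplex V) f" "f ` S' = simplex_boundary V" "finite V" "finite V'" "card V' = card V"
  obtains g where "pl_iso S (full_simplex V') g" "g ` S' = simplex_boundary V'"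
proof -
  obtain \<sigma> where "bij_betw \<sigma> V V'" using assms finite_same_card_bij by metis
  then have \<sigma>: "inj_on \<sigma> V" "\<sigma> ` V = V'" by (auto simp: bij_betw_def)
  note p = pl_iso_simplex_push[OF assms(3) \<sigma>(1), unfolded \<sigma>(2)]
  show ?thesis
  proof (rule that)
    show "pl_iso S (full_simplex V') (push \<sigma> \<circ> f)" by (rule pl_iso_comp[OF assms(1) p(1)])
    show "(push \<sigma> \<circ> f) ` S' = simplex_boundary V'"
      unfolding image_comp[symmetric] assms(2) by (rule pl_iso_image[OF p(2)])
  qed
qed

lemma fresh_set:
  assumes "finite (U :: nat set)"
  obtains V' where "finite V'" "card V' = n" "V' \<inter> U = {}"
proof -
  have "infinite (- U)" using assms by (simp add: Compl_eq_Diff_UNIV Diff_infinite_finite)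
  then obtain V' where "V' \<subseteq> - U" "finite V'" "card V' = n" using infinite_arbitrarily_large by blast
  then show ?thesis using that by blast
qed

lemma ball_pair_fresh:
  assumes "ball_pair S S'" "finite U"
  obtains V f where "finite V" "V \<noteq> {}" "V \<inter> U = {}" "pl_iso S (full_simplex V) f" "f ` S' = simplex_boundary V"
proof -
  obtain V f where V: "finite V" "V \<noteq> {}" "pl_iso S (full_simplex V) f" "f ` S' = simplex_boundary V"
    using assms by (auto simp: ball_pair_def)
  obtain V' where V': "finite V'" "card V' = card V" "V' \<inter> U = {}" using fresh_set[OF assms(2)] by metis
  obtain g where "pl_iso S (full_simplex V') g" "g ` S' = simplex_boundary V'"
    using ball_pair_relabel[OF V(3,4,1) V'(1,2)] by metis
  moreover have "V' \<noteq> {}" using V V' by auto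
  ultimately show ?thesis using that V' by blast
qed

lemma sphere_fresh:
  assumes "sphere_like S" "finite U"
  obtains V f where "finite V" "V \<noteq> {}" "V \<inter> U = {}" "pl_iso S (simplex_boundary V) f"
proof -
  obtain V f where V: "finite V" "V \<noteq> {}" "pl_iso S (simplex_boundary V) f"
    using assms by (auto simp: sphere_like_def)
  obtain V' where V': "finite V'" "card V' = card V" "V' \<inter> U = {}" using fresh_set[OF assms(2)] by metis
  obtain \<sigma> where "bij_betw \<sigma> V V'" using V V' finite_same_card_bij by metis
  then have \<sigma>: "inj_on \<sigma> V" "\<sigma> ` V = V'" by (auto simp: bij_betw_def)
  show ?thesis
    using that[of V' "push \<sigma> \<circ> f"] pl_iso_comp[OF V(3) pl_iso_simplex_push(2)[OF V(1) \<sigma>(1)]] V V' \<sigma> by auto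
qed

lemma ball_imp_ball_pair:
  assumes "ball_like S" obtains S' where "ball_pair S S'" "polyhedral S'"
proof -
  obtain V f where V: "finite V" "V \<noteq> {}" "pl_iso S (full_simplex V) f" using assms by (auto simp: ball_like_def)
  let ?g = "inv_into S f"
  have g: "pl_iso (full_simplex V) S ?g" by (rule pl_iso_inverse[OF V(3)])
  have sub: "simplex_boundary V \<subseteq> full_simplex V" by (rule realization_mono) blast
  have "f ` ?g ` simplex_boundary V = simplex_boundary V"
    using sub pl_iso_image[OF V(3)] by (auto simp: image_image f_inv_into_f subset_iff cong: image_cong)
  moreover have "?g ` simplex_boundary V \<subseteq> S" using sub pl_iso_image[OF g] by blast
  moreover have "polyhedral (?g ` simplex_boundary V)"
    using pl_iso_polyhedral(2)[OF pl_iso_restrict[OF g polyhedral_realization[OF complex_on_boundary[OF V(1)]] sub]] .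
  ultimately show ?thesis using that V unfolding ball_pair_def by blast
qed

lemma ball_pair_imp_ball: "ball_pair S S' \<Longrightarrow> ball_like S"
  unfolding ball_pair_def ball_like_def by (elim exE conjE) (intro exI conjI)

lemma ball_pair_imp_sphere:
  assumes "ball_pair S S'" "polyhedral S'"
  shows "sphere_like S'"
proof -
  obtain V f where V: "finite V" "V \<noteq> {}" "pl_iso S (full_simplex V) f" "S' \<subseteq> S" "f ` S' = simplex_boundary V"
    using assms(1) unfolding ball_pair_def by blast
  show ?thesis using pl_iso_restrict[OF V(3) assms(2) V(4)] V unfolding sphere_like_def by auto
qed

lemma ball_pair_pl_iso:
  assumes "ball_pair S S'" "pl_iso T S f" "T' \<subseteq> T" "f ` T' = S'"
  shows "ball_pair T T'"
proof -
  obtain V g where V: "finite V" "V \<noteq> {}" "pl_iso S (full_simplex V) g" "g ` S' = simplex_boundary V"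
    using assms(1) unfolding ball_pair_def by blast
  have "(g \<circ> f) ` T' = simplex_boundary V" using V(4) assms(4) by (simp only: image_comp[symmetric])
  then show ?thesis unfolding ball_pair_def using pl_iso_comp[OF assms(2) V(3)] V(1,2) assms(3) by blast
qed

lemma sphere_pl_iso: "sphere_like S \<Longrightarrow> pl_iso T S f \<Longrightarrow> sphere_like T"
  unfolding sphere_like_def using pl_iso_comp[of T S f] by (elim exE conjE) (intro exI conjI)

lemma ball_pl_iso: "ball_like S \<Longrightarrow> pl_iso T S f \<Longrightarrow> ball_like T"
  unfolding ball_like_def using pl_iso_comp[of T S f] by (elim exE conjE) (intro exI conjI)

lemma ball_pair_simplex:
  assumes "finite V" "V \<noteq> {}"
  shows "ball_pair (full_simplex V) (simplex_boundary V)"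
proof -
  have "pl_iso (full_simplex V) (full_simplex V) id"
    by (rule pl_iso_id[OF polyhedral_realization[OF complex_on_Pow[OF assms(1)]]])
  moreover have "simplex_boundary V \<subseteq> full_simplex V" by (rule realization_mono) (rule Diff_subset)
  ultimately show ?thesis unfolding ball_pair_def
    using assms by (intro exI[of _ V] exI[of _ id] conjI) (simp_all only: image_id id_apply simp_thms)
qed

section \<open>Replacing a cone point by a ball\<close>

text \<open>
  The cone with apex \<open>v\<close> over the boundary of the simplex on \<open>W\<close> is mapped to that simplex by
  sending \<open>v\<close> to the barycentre. The map is linear; the inverse is only piecewise linear, as it reads off the
  coordinate at \<open>v\<close> from the minimum of the coordinates of the image.
\<close>

definition star_map :: "nat \<Rightarrow> nat set \<Rightarrow> vec \<Rightarrow> vec" where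
  "star_map v W z = restrict_vec W z + (coord z v / card W) *\<^sub>R (\<Sum>i\<in>W. basis_vec i)"

lemma coord_star_map: "finite W \<Longrightarrow> coord (star_map v W z) i = (if i \<in> W then coord z i + coord z v / card W else 0)"
  by (simp add: star_map_def lookup_add lookup_sum lookup_single when_def cong: if_cong)

lemma linear_star_map: "linear (star_map v W)"
  by (rule linearI) (simp_all add: star_map_def lookup_add add_divide_distrib algebra_simps)

lemma star_map_id: "supp z \<subseteq> W \<Longrightarrow> v \<notin> W \<Longrightarrow> star_map v W z = z"
  by (auto simp: star_map_def restrict_vec_id in_keys_iff subset_iff)

lemma pl_iso_star_map:
  assumes W: "finite W" "W \<noteq> {}" "v \<notin> W"
  shows "pl_iso (realization (join_complex {v} W (Pow {v}) (Pow W - {W}))) (full_simplex W) (star_map v W)"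
proof -
  let ?K = "join_complex {v} W (Pow {v}) (Pow W - {W})"
  let ?n = "real (card W)"
  have n: "0 < ?n" using W by (simp add: card_gt_0_iff)
  have K: "complex_on ({v} \<union> W) ?K" using W by (intro complex_on_join complex_on_Pow complex_on_boundary) auto
  note rK = realization_iff[OF K] and rW = realization_iff[OF complex_on_Pow[OF W(1)]]
  note c = coord_star_map[OF W(1), of v]
  have tot: "coord_sum z = coord z v + (\<Sum>i\<in>W. coord z i)" if "supp z \<subseteq> {v} \<union> W" for z
    using coord_sum_eq_sum[of "insert v W" z] that W by simp
  have zero: "\<exists>i\<in>W. coord z i = 0" if "z \<in> realization ?K" for z
    using that W unfolding rK by (auto simp: join_complex_def in_keys_iff)
  have vz: "supp z \<subseteq> {v} \<union> W" "0 \<le> coord z i" if "z \<in> realization ?K" for z i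
    using that unfolding rK by (auto simp: join_complex_def)
  have "star_map v W ` realization ?K \<subseteq> full_simplex W"
  proof clarify
    fix z assume z: "z \<in> realization ?K"
    have "coord_sum (star_map v W z) = (\<Sum>i\<in>W. coord (star_map v W z) i)"
      by (rule coord_sum_eq_sum[OF W(1)]) (auto simp: in_keys_iff c split: if_splits)
    also have "\<dots> = (\<Sum>i\<in>W. coord z i) + coord z v" using n by (simp add: c sum.distrib)
    also have "\<dots> = 1" using tot[OF vz(1)[OF z]] z rK by simp
    finally show "star_map v W z \<in> full_simplex W"
      unfolding rW using vz(2)[OF z] n by (auto simp: c in_keys_iff split: if_splits)
  qed
  moreover have "inj_on (star_map v W) (realization ?K)"
  proof (rule inj_onI)
    fix z w assume z: "z \<in> realization ?K" and w: "w \<in> realization ?K" and eq: "star_map v W z = star_map v W w"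
    have e: "coord z i + coord z v / ?n = coord w i + coord w v / ?n" if "i \<in> W" for i
      using arg_cong[OF eq, of "\<lambda>x. coord x i"] that by (simp add: c)
    obtain i where i: "i \<in> W" "coord z i = 0" using zero[OF z] by blast
    obtain j where j: "j \<in> W" "coord w j = 0" using zero[OF w] by blast
    \<comment> \<open>Both sides are the minimal coordinate of the common image.\<close>
    have "coord z v / ?n = coord w v / ?n"
      using e[OF i(1)] e[OF j(1)] i(2) j(2) vz(2)[OF z, of j] vz(2)[OF w, of i] by linarith
    then have v: "coord z v = coord w v" using n by simp
    show "z = w"
    proof (rule poly_mapping_eqI)
      fix i show "coord z i = coord w i"
      proof (cases "i \<in> W")
        case True then show ?thesis using e[OF True] v by simp
      next
        case False then show ?thesis
        proof (cases "i = v")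
          case False
          then have "i \<notin> supp z" "i \<notin> supp w" using \<open>i \<notin> W\<close> vz(1)[OF z] vz(1)[OF w] by blast+
          then show ?thesis by (simp add: in_keys_iff)
        qed (use v in simp)
      qed
    qed
  qed
  moreover have "full_simplex W \<subseteq> star_map v W ` realization ?K"
  proof
    fix y assume "y \<in> full_simplex W"
    then have y: "\<And>i. 0 \<le> coord y i" "supp y \<subseteq> W" "coord_sum y = 1" unfolding rW by auto
    define m where "m = Min (coord y ` W)"
    have m: "m \<le> coord y i" if "i \<in> W" for i using that W by (simp add: m_def)
    have "m \<in> coord y ` W" unfolding m_def using W by (intro Min_in) auto
    then obtain j where j: "j \<in> W" "m = coord y j" by blast
    define z where "z = y + (?n * m) *\<^sub>R basis_vec v + (- m) *\<^sub>R (\<Sum>i\<in>W. basis_vec i)"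
    have yv: "coord y v = 0" using y(2) W(3) by (auto simp: in_keys_iff)
    have cz: "coord z i = (if i = v then ?n * m else if i \<in> W then coord y i - m else 0)" for i
      using W yv y(2) by (auto simp: z_def lookup_add lookup_minus lookup_sum lookup_single when_def in_keys_iff subset_iff cong: if_cong)
    have sz: "supp z \<subseteq> {v} \<union> W" by (auto simp: in_keys_iff cz split: if_splits)
    have "coord_sum z = ?n * m + (\<Sum>i\<in>W. coord y i - m)"
      unfolding tot[OF sz] using W(3) by (simp add: cz cong: sum.cong) (intro sum.cong; auto)
    also have "\<dots> = (\<Sum>i\<in>W. coord y i)" by (simp add: sum_subtractf)
    also have "\<dots> = 1" using coord_sum_eq_sum[OF W(1) y(2)] y(3) by simp
    finally have s1: "coord_sum z = 1" .
    have "0 \<le> m" using j y(1) by simp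
    then have "0 \<le> coord z i" for i using m n by (simp add: cz)
    moreover have "j \<notin> supp z" using j W by (auto simp: in_keys_iff cz)
    then have "supp z \<in> ?K" using sz j by (auto simp: join_complex_def)
    ultimately have "z \<in> realization ?K" unfolding rK using s1 by simp
    moreover have "star_map v W z = y"
    proof (rule poly_mapping_eqI)
      fix i show "coord (star_map v W z) i = coord y i"
        using n W(3) y(2) by (auto simp: c cz in_keys_iff)
    qed
    ultimately show "y \<in> star_map v W ` realization ?K" by blast
  qed
  ultimately show ?thesis unfolding pl_iso_def bij_betw_def
    using pw_affine_linear[OF polyhedral_realization[OF K] linear_star_map] by blast
qed

text \<open>
  Transport along \<open>f\<close>, from \<open>C\<close> to a simplex: cone off \<open>f\<close> on the boundary \<open>N\<close>, star the simplex at its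
  barycentre, and return by the inverse of \<open>f\<close>. On \<open>N\<close> the first and the last step cancel.
\<close>

lemma pl_iso_cone:
  assumes C: "complex_on I C" and N: "complex_on I N" "{} \<in> N" and v: "v \<notin> I"
    and pair: "ball_pair (realization C) (realization N)"
  obtains \<gamma> where "pl_iso (realization (join_complex {v} I (Pow {v}) N)) (realization C) \<gamma>"
    "\<forall>x\<in>realization N. \<gamma> x = x"
proof -
  obtain W f where W: "finite W" "W \<noteq> {}" "W \<inter> {v} = {}" and f: "pl_iso (realization C) (full_simplex W) f"
    and fN: "f ` realization N = simplex_boundary W"
    using ball_pair_fresh[OF pair, of "{v}"] by auto
  have NC: "realization N \<subseteq> realization C" using pair by (auto simp: ball_pair_def)
  have fN': "pl_iso (realization N) (simplex_boundary W) f"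
    using pl_iso_restrict[OF f polyhedral_realization[OF N(1)] NC] fN by simp
  have vs: "complex_on {v} (Pow {v})" by (intro complex_on_Pow) simp
  have sl: "full_simplex {v} \<subseteq> slice {v}" "realization N \<subseteq> slice I" "simplex_boundary W \<subseteq> slice W"
    using realization_subset_slice[OF vs] realization_subset_slice[OF N(1)]
      realization_subset_slice[OF complex_on_boundary[OF W(1)]] by auto
  define j where "j = join_map {v} I id f"
  have "pl_iso (join_set (full_simplex {v}) (realization N)) (join_set (full_simplex {v}) (simplex_boundary W)) j"
    unfolding j_def using pl_iso_join[OF _ _ sl(1,2) sl(1,3) pl_iso_id[OF polyhedral_realization[OF vs]] fN'] v W by auto
  moreover have "join_set (full_simplex {v}) (realization N) = realization (join_complex {v} I (Pow {v}) N)"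
    using realization_join[OF vs _ N] v by simp
  moreover have "join_set (full_simplex {v}) (simplex_boundary W) = realization (join_complex {v} W (Pow {v}) (Pow W - {W}))"
    using realization_join[OF vs _ complex_on_boundary[OF W(1)]] W by auto
  ultimately have j: "pl_iso (realization (join_complex {v} I (Pow {v}) N)) (realization (join_complex {v} W (Pow {v}) (Pow W - {W}))) j"
    by simp
  have b: "pl_iso (realization (join_complex {v} W (Pow {v}) (Pow W - {W}))) (full_simplex W) (star_map v W)"
    using W by (intro pl_iso_star_map) auto
  show ?thesis
  proof (rule that)
    show "pl_iso (realization (join_complex {v} I (Pow {v}) N)) (realization C) (inv_into (realization C) f \<circ> (star_map v W \<circ> j))"
      by (rule pl_iso_comp[OF pl_iso_comp[OF j b] pl_iso_inverse[OF f]])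
    show "\<forall>x\<in>realization N. (inv_into (realization C) f \<circ> (star_map v W \<circ> j)) x = x"
    proof
    fix x assume x: "x \<in> realization N"
    then have xs: "supp x \<subseteq> I" "coord_sum x = 1" using sl(2) by (auto simp: slice_def)
    have "f x \<in> simplex_boundary W" using x fN by blast
    then have "supp (f x) \<subseteq> W" using sl(3) by (auto simp: slice_def)
    moreover have "supp x \<inter> {v} = {}" using xs v by blast
    then have "j x = f x" unfolding j_def join_map_def
      using homog_scaleR[of x f 1] restrict_vec_id[OF xs(1)] restrict_vec_disjoint[OF \<open>supp x \<inter> {v} = {}\<close>] xs(2) by simp
    ultimately have "star_map v W (j x) = f x" using star_map_id W by simp
    then show "(inv_into (realization C) f \<circ> (star_map v W \<circ> j)) x = x"
      using inv_into_f_f[OF pl_iso_inj_on[OF f]] x NC by auto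
    qed
  qed
qed

text \<open>
  The composition \<open>X \<triangleleft> (C, N)\<close> at \<open>v\<close>, without renumbering: \<open>V\<close> contains the remaining vertices of \<open>X\<close>
  and \<open>I\<close> those of \<open>C\<close>.
\<close>

definition replace_complex :: "nat \<Rightarrow> nat set \<Rightarrow> nat set \<Rightarrow> nat set set \<Rightarrow> nat set set \<Rightarrow> nat set set \<Rightarrow> nat set set" where
  "replace_complex v V I X C N = {J. J \<subseteq> V \<union> I \<and> ((insert v (J \<inter> V) \<in> X \<and> J \<inter> I \<in> C) \<or> (J \<inter> V \<in> X \<and> J \<inter> I \<in> N))}"

lemma complex_on_replace:
  assumes X: "complex_on (insert v V) X" and C: "complex_on I C" and N: "complex_on I N"
  shows "complex_on (V \<union> I) (replace_complex v V I X C N)"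
  unfolding complex_on_def
proof (intro conjI ballI allI impI)
  show "finite (V \<union> I)" using assms by (auto dest!: complex_onD(1))
  show "replace_complex v V I X C N \<subseteq> Pow (V \<union> I)" by (auto simp: replace_complex_def)
  fix J J' assume J: "J \<in> replace_complex v V I X C N" and sub: "J' \<subseteq> J"
  have s: "J' \<inter> V \<subseteq> J \<inter> V" "J' \<inter> I \<subseteq> J \<inter> I" "insert v (J' \<inter> V) \<subseteq> insert v (J \<inter> V)" "J' \<subseteq> V \<union> I"
    using sub J by (auto simp: replace_complex_def)
  show "J' \<in> replace_complex v V I X C N"
    using J complex_onD(3)[OF X _ s(1)] complex_onD(3)[OF X _ s(3)] complex_onD(3)[OF C _ s(2)] complex_onD(3)[OF N _ s(2)] s(4)
    unfolding replace_complex_def by blast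
qed

text \<open>
  The map is the join of the identity on the full simplex on \<open>V\<close> with the map of \<open>pl_iso_cone\<close>. It does not
  depend on \<open>X\<close>, which is what makes it a map of pairs when it is applied to a ball and its
  boundary. That it takes \<open>X * N\<close> to \<open>X \<triangleleft> (C, N)\<close> can be checked point by point: the coordinates in
  \<open>V\<close> are kept, and the coordinate at \<open>v\<close> vanishes before the map iff the part in \<open>I\<close> lies over \<open>N\<close>
  after it.
\<close>

lemma pl_iso_replace:
  assumes C: "complex_on I C" and N: "complex_on I N" "{} \<in> N" and NC: "N \<subseteq> C"
    and V: "finite V" "V \<inter> I = {}" and v: "v \<notin> V \<union> I"
    and pair: "ball_pair (realization C) (realization N)"
  obtains F where "\<forall>X. complex_on (insert v V) X \<longrightarrow>
    pl_iso (realization (join_complex (insert v V) I X N)) (realization (replace_complex v V I X C N)) F"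
proof -
  let ?cN = "join_complex {v} I (Pow {v}) N"
  have C0: "{} \<in> C" using N NC by blast
  have vI: "v \<notin> I" "v \<notin> V" using v by auto
  obtain \<gamma> where \<gamma>: "pl_iso (realization ?cN) (realization C) \<gamma>" and fixN: "\<forall>x\<in>realization N. \<gamma> x = x"
    by (rule pl_iso_cone[OF C N vI(1) pair])
  have cN: "complex_on (insert v I) ?cN" using complex_on_join[OF complex_on_Pow[of "{v}"] N(1)] by simp
  have cN0: "{} \<in> ?cN" using N by (simp add: join_complex_def)
  note cV = complex_on_Pow[OF V(1)]
  have sl: "full_simplex V \<subseteq> slice V" "realization ?cN \<subseteq> slice (insert v I)" "realization C \<subseteq> slice I"
    using realization_subset_slice cV cN C by auto
  define F where "F = join_map V (insert v I) id \<gamma>"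
  have disj: "V \<inter> insert v I = {}" using V v by auto
  let ?D = "join_set (full_simplex V) (realization ?cN)" and ?E = "join_set (full_simplex V) (realization C)"
  have F: "pl_iso ?D ?E F" unfolding F_def
    using pl_iso_join[OF disj V(2) sl(1,2) sl(1,3) pl_iso_id[OF polyhedral_realization[OF cV]] \<gamma>] .
  interpret J: join_setting V "insert v I" V I "full_simplex V" "realization ?cN" id \<gamma>
    using disj V sl pl_iso_image[OF \<gamma>] by unfold_locales auto
  have D: "?D = realization (join_complex V (insert v I) (Pow V) ?cN)"
    using realization_join[OF cV _ cN cN0 disj] by simp
  have E: "?E = realization (join_complex V I (Pow V) C)"
    using realization_join[OF cV _ C C0 V(2)] by simp
  show ?thesis
  proof (rule that, intro allI impI)
    fix X assume X: "complex_on (insert v V) X"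
    let ?L = "join_complex (insert v V) I X N" and ?R = "replace_complex v V I X C N"
    have cL: "complex_on (insert v V \<union> I) ?L" by (rule complex_on_join[OF X N(1)])
    have cR: "complex_on (V \<union> I) ?R" by (rule complex_on_replace[OF X C N(1)])
    have Lsub: "realization ?L \<subseteq> ?D" unfolding D
      using v by (intro realization_mono) (auto simp: join_complex_def Int_Un_distrib Int_insert_right)
    have Rsub: "realization ?R \<subseteq> ?E" unfolding E
      using NC by (intro realization_mono) (auto simp: join_complex_def replace_complex_def)
    have mem: "z \<in> realization ?L \<longleftrightarrow> F z \<in> realization ?R" if "z \<in> ?D" for z
      using that
    proof (rule join_setE)
      fix a w assume z: "z = a + w" and a: "a \<in> cone_over (full_simplex V)" and w: "w \<in> cone_over (realization ?cN)" and s: "coord_sum (a + w) = 1"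
      let ?w' = "homog \<gamma> w"
      have ida: "homog id a = a" using a sl(1) by (cases rule: cone_overE) (auto simp: homog_scaleR)
      have Fz: "F z = a + ?w'" unfolding F_def z J.join_map_sum[OF a w] ida ..
      have w': "?w' \<in> cone_over (realization C)" using homog_cone_over[OF w sl(2), of \<gamma>] pl_iso_image[OF \<gamma>] by simp
      have aa: "\<And>i. 0 \<le> coord a i" "supp a \<subseteq> V" using a cone_over_realization_iff[OF cV, of a] by auto
      have ww: "\<And>i. 0 \<le> coord w i" "supp w \<in> ?cN" using w cone_over_realization_iff[OF cN cN0, of w] by auto
      have ww': "\<And>i. 0 \<le> coord ?w' i" "supp ?w' \<in> C" using w' cone_over_realization_iff[OF C C0, of ?w'] by auto
      have wI: "supp w \<subseteq> insert v I" "supp w \<inter> I \<in> N" using ww(2) by (auto simp: join_complex_def)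
      have w'I: "supp ?w' \<subseteq> I" using complex_onD(2)[OF C ww'(2)] .
      have sz: "supp z = supp a \<union> supp w" unfolding z by (rule supp_add_nonneg) (use aa ww in auto)
      have sFz: "supp (F z) = supp a \<union> supp ?w'" unfolding Fz by (rule supp_add_nonneg) (use aa ww' in auto)
      have fixed: "homog \<gamma> u = u" if "u \<in> cone_over (realization N)" for u
        using that realization_subset_slice[OF N(1)]
        by (cases rule: cone_overE) (auto simp: homog_scaleR fixN)
      have NN: "supp ?w' \<in> N \<longleftrightarrow> v \<notin> supp w"
      proof
        assume "v \<notin> supp w"
        then have "supp w \<inter> I = supp w" using wI by auto
        then have "w \<in> cone_over (realization N)" using cone_over_realization_iff[OF N] ww wI by simp
        then show "supp ?w' \<in> N" using fixed cone_over_realization_iff[OF N] by simp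
      next
        assume "supp ?w' \<in> N"
        then have w'N: "?w' \<in> cone_over (realization N)" using cone_over_realization_iff[OF N] ww' by simp
        then have "homog \<gamma> ?w' = homog \<gamma> w" using fixed by simp
        moreover have "?w' \<in> cone_over (realization ?cN)"
        proof -
          have "realization N \<subseteq> realization ?cN"
            using vI complex_onD(2)[OF N(1)] by (intro realization_mono) (auto simp: join_complex_def Int_absorb2)
          then show ?thesis using w'N cone_over_mono by blast
        qed
        ultimately have "?w' = w"
          using homog_inj_on[OF sl(2) _ pl_iso_inj_on[OF \<gamma>], of I] sl(3) pl_iso_image[OF \<gamma>] w by (auto dest: inj_onD)
        then show "v \<notin> supp w" using w'I vI by auto
      qed
      have s': "coord_sum (F z) = 1"
        using s coord_sum_homog[OF w sl(2), of \<gamma> I] pl_iso_image[OF \<gamma>] sl(3) by (simp add: Fz)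
      have "z \<in> realization ?L \<longleftrightarrow> supp z \<in> ?L"
        unfolding realization_iff[OF cL] using s z aa(1) ww(1) by (simp add: lookup_add)
      also have "\<dots> \<longleftrightarrow> supp z \<inter> insert v V \<in> X"
      proof -
        have "supp z \<inter> I = supp w \<inter> I" using sz aa(2) V(2) by auto
        moreover have "supp z \<subseteq> insert v V \<union> I" using sz aa(2) wI(1) by auto
        ultimately show ?thesis using wI(2) by (simp add: join_complex_def)
      qed
      also have "supp z \<inter> insert v V = (if v \<in> supp w then insert v (supp a) else supp a)"
        using sz aa(2) wI(1) v V(2) by auto
      also have "(if v \<in> supp w then insert v (supp a) else supp a) \<in> X \<longleftrightarrow>
          insert v (supp a) \<in> X \<or> (supp a \<in> X \<and> v \<notin> supp w)"
        using complex_onD(3)[OF X, of "insert v (supp a)" "supp a"] by auto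
      also have "\<dots> \<longleftrightarrow> supp (F z) \<in> ?R"
      proof -
        have "supp (F z) \<inter> V = supp a" "supp (F z) \<inter> I = supp ?w'" "supp (F z) \<subseteq> V \<union> I"
          using sFz aa(2) w'I V(2) by auto
        then show ?thesis using ww'(2) NN by (simp add: replace_complex_def)
      qed
      also have "\<dots> \<longleftrightarrow> F z \<in> realization ?R"
        unfolding realization_iff[OF cR] using s' aa(1) ww'(1) by (simp add: Fz lookup_add)
      finally show ?thesis .
    qed
    have "F ` realization ?L = realization ?R"
    proof
      show "F ` realization ?L \<subseteq> realization ?R"
      proof (rule image_subsetI)
        fix z assume "z \<in> realization ?L"
        then show "F z \<in> realization ?R" using mem[of z] Lsub by blast
      qed
      show "realization ?R \<subseteq> F ` realization ?L"
      proof
        fix y assume y: "y \<in> realization ?R"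
        then have "y \<in> F ` ?D" using Rsub pl_iso_image[OF F] by blast
        then obtain z where z: "z \<in> ?D" "y = F z" by (rule imageE)
        then have "z \<in> realization ?L" using mem[OF z(1)] y by simp
        then show "y \<in> F ` realization ?L" unfolding z(2) by (rule imageI)
      qed
    qed
    then show "pl_iso (realization ?L) (realization ?R) F"
      using pl_iso_restrict[OF F polyhedral_realization[OF cL] Lsub] by simp
  qed
qed

section \<open>Joins of balls and spheres\<close>

text \<open>
  In \<open>pl_iso_replace\<close> take for \<open>(C, N)\<close> a simplex and its boundary, and for \<open>X\<close> first a simplex and then its
  boundary: composing a simplex with a simplex yields a simplex, and likewise for the boundaries.
\<close>

lemma pl_iso_simplex_join_boundary:
  assumes A: "finite A" "A \<noteq> {}" and B: "finite B" "B \<noteq> {}" and AB: "A \<inter> B = {}"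
  obtains F U where "finite U" "U \<noteq> {}"
    "pl_iso (join_set (full_simplex A) (simplex_boundary B)) (full_simplex U) F"
    "pl_iso (join_set (simplex_boundary A) (simplex_boundary B)) (simplex_boundary U) F"
proof -
  obtain v where v: "v \<in> A" using A by blast
  define V where "V = A - {v}"
  have V: "finite V" "insert v V = A" "v \<notin> V" "V \<inter> B = {}" "v \<notin> V \<union> B" using A v AB by (auto simp: V_def)
  note cs = complex_on_Pow[OF A(1)] complex_on_boundary[OF A(1)] complex_on_Pow[OF B(1)] complex_on_boundary[OF B(1)]
  have B': "{} \<in> Pow B - {B}" "Pow B - {B} \<subseteq> Pow B" using B by auto
  obtain F where F: "\<forall>X. complex_on A X \<longrightarrow>
      pl_iso (realization (join_complex A B X (Pow B - {B}))) (realization (replace_complex v V B X (Pow B) (Pow B - {B}))) F"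
    by (rule pl_iso_replace[OF cs(3,4) B' V(1,4,5) ball_pair_simplex[OF B], unfolded V(2)])
  let ?U = "V \<union> B"
  have "replace_complex v V B (Pow A) (Pow B) (Pow B - {B}) = Pow ?U"
    using v V by (auto simp: replace_complex_def)
  moreover have "replace_complex v V B (Pow A - {A}) (Pow B) (Pow B - {B}) = Pow ?U - {?U}"
  proof (rule Set.set_eqI)
    fix J
    have 1: "insert v (J \<inter> V) = A \<longleftrightarrow> V \<subseteq> J" using v by (auto simp: V_def)
    have 2: "J \<inter> B = B \<longleftrightarrow> B \<subseteq> J" by blast
    have 4: "J = V \<union> B \<longleftrightarrow> V \<subseteq> J \<and> B \<subseteq> J" if "J \<subseteq> V \<union> B" using that by blast
    have 3: "J \<inter> V \<noteq> A" "J \<inter> V \<subseteq> A" "insert v (J \<inter> V) \<subseteq> A" using v by (auto simp: V_def)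
    show "J \<in> replace_complex v V B (Pow A - {A}) (Pow B) (Pow B - {B}) \<longleftrightarrow> J \<in> Pow ?U - {?U}"
      unfolding replace_complex_def mem_Collect_eq Diff_iff Pow_iff singleton_iff 1 2
      by (simp only: 3 Int_lower2 simp_thms) (use 4 in metis)
  qed
  ultimately have "pl_iso (realization (join_complex A B (Pow A) (Pow B - {B}))) (full_simplex ?U) F"
    "pl_iso (realization (join_complex A B (Pow A - {A}) (Pow B - {B}))) (simplex_boundary ?U) F"
    using F[rule_format, OF cs(1)] F[rule_format, OF cs(2)] by simp_all
  moreover have "realization (join_complex A B (Pow A) (Pow B - {B})) = join_set (full_simplex A) (simplex_boundary B)"
    "realization (join_complex A B (Pow A - {A}) (Pow B - {B})) = join_set (simplex_boundary A) (simplex_boundary B)"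
    using realization_join[OF cs(1) _ cs(4) _ AB] realization_join[OF cs(2) _ cs(4) _ AB] A B by auto
  ultimately show ?thesis using that[of ?U F] V B by simp
qed

lemma ball_pair_join_sphere:
  assumes pair: "ball_pair S S'" and T: "sphere_like T" and sl: "S \<subseteq> slice V" "T \<subseteq> slice W" and VW: "V \<inter> W = {}"
  shows "ball_pair (join_set S T) (join_set S' T)"
proof -
  obtain A f where A: "finite A" "A \<noteq> {}" and f: "pl_iso S (full_simplex A) f" "f ` S' = simplex_boundary A"
    using ball_pair_fresh[OF pair, of "{}"] by auto
  obtain B g where B: "finite B" "B \<noteq> {}" "B \<inter> A = {}" and g: "pl_iso T (simplex_boundary B) g"
    using sphere_fresh[OF T A(1)] by blast
  have AB: "A \<inter> B = {}" using B by blast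
  have S': "S' \<subseteq> S" using pair by (auto simp: ball_pair_def)
  note sA = realization_subset_slice[OF complex_on_Pow[OF A(1)]]
  note sB = realization_subset_slice[OF complex_on_boundary[OF B(1)]]
  let ?j = "join_map V W f g"
  have j: "pl_iso (join_set S T) (join_set (full_simplex A) (simplex_boundary B)) ?j"
    by (rule pl_iso_join[OF VW AB sl sA sB f(1) g])
  interpret J: join_setting V W A B S' T f g
    using VW AB sl S' pl_iso_image[OF f(1)] pl_iso_image[OF g] sA sB
    by unfold_locales (blast dest: subsetD)+
  have j': "?j ` join_set S' T = join_set (simplex_boundary A) (simplex_boundary B)"
    using J.join_map_image f(2) pl_iso_image[OF g] by simp
  obtain F U where U: "finite U" "U \<noteq> {}" and F: "pl_iso (join_set (full_simplex A) (simplex_boundary B)) (full_simplex U) F"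
    "pl_iso (join_set (simplex_boundary A) (simplex_boundary B)) (simplex_boundary U) F"
    by (rule pl_iso_simplex_join_boundary[OF A B(1,2) AB])
  have "(F \<circ> ?j) ` join_set S' T = simplex_boundary U"
    using pl_iso_image[OF F(2)] by (simp only: image_comp[symmetric] j')
  moreover have "join_set S' T \<subseteq> join_set S T"
    using cone_over_mono[OF S'] by (auto simp: join_set_def)
  ultimately show ?thesis unfolding ball_pair_def using pl_iso_comp[OF j F(1)] U by blast
qed

lemma sphere_join_sphere:
  assumes S: "sphere_like S" and T: "sphere_like T" and sl: "S \<subseteq> slice V" "T \<subseteq> slice W" and VW: "V \<inter> W = {}"
  shows "sphere_like (join_set S T)"
proof -
  obtain A f where A: "finite A" "A \<noteq> {}" and f: "pl_iso S (simplex_boundary A) f"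
    using sphere_fresh[OF S, of "{}"] by auto
  obtain B g where B: "finite B" "B \<noteq> {}" "B \<inter> A = {}" and g: "pl_iso T (simplex_boundary B) g"
    using sphere_fresh[OF T A(1)] by blast
  have AB: "A \<inter> B = {}" using B by blast
  have j: "pl_iso (join_set S T) (join_set (simplex_boundary A) (simplex_boundary B)) (join_map V W f g)"
    by (rule pl_iso_join[OF VW AB sl realization_subset_slice[OF complex_on_boundary[OF A(1)]]
          realization_subset_slice[OF complex_on_boundary[OF B(1)]] f g])
  obtain F U where U: "finite U" "U \<noteq> {}" and F: "pl_iso (join_set (simplex_boundary A) (simplex_boundary B)) (simplex_boundary U) F"
    by (rule pl_iso_simplex_join_boundary[OF A B(1,2) AB])
  show ?thesis unfolding sphere_like_def using pl_iso_comp[OF j F] U by blast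
qed

lemma ball_join_ball:
  assumes S: "ball_like S" and T: "ball_like T" and sl: "S \<subseteq> slice V" "T \<subseteq> slice W" and VW: "V \<inter> W = {}"
  shows "ball_like (join_set S T)"
proof -
  obtain S' where S': "ball_pair S S'" using ball_imp_ball_pair[OF S] by blast
  obtain T' where T': "ball_pair T T'" using ball_imp_ball_pair[OF T] by blast
  obtain A f where A: "finite A" "A \<noteq> {}" and f: "pl_iso S (full_simplex A) f"
    by (rule ball_pair_fresh[OF S' finite.emptyI])
  obtain B g where B: "finite B" "B \<noteq> {}" "B \<inter> A = {}" and g: "pl_iso T (full_simplex B) g"
    by (rule ball_pair_fresh[OF T' A(1)])
  have AB: "A \<inter> B = {}" using B by blast
  have j: "pl_iso (join_set S T) (join_set (full_simplex A) (full_simplex B)) (join_map V W f g)"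
    by (rule pl_iso_join[OF VW AB sl realization_subset_slice[OF complex_on_Pow[OF A(1)]]
          realization_subset_slice[OF complex_on_Pow[OF B(1)]] f g])
  have "join_complex A B (Pow A) (Pow B) = Pow (A \<union> B)" by (auto simp: join_complex_def)
  then have "join_set (full_simplex A) (full_simplex B) = full_simplex (A \<union> B)"
    using realization_join[OF complex_on_Pow[OF A(1)] _ complex_on_Pow[OF B(1)] _ AB] by simp
  then show ?thesis unfolding ball_like_def using j A B by (metis Un_empty finite_UnI)
qed

lemma join_set_commute: "join_set S T = join_set T S"
proof -
  have "join_set S T \<subseteq> join_set T S" for S T
  proof
    fix z assume "z \<in> join_set S T"
    then obtain a b where "z = a + b" "a \<in> cone_over S" "b \<in> cone_over T" "coord_sum (a + b) = 1"
      by (rule join_setE)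
    then have "z = b + a" "a \<in> cone_over S" "b \<in> cone_over T" "coord_sum (b + a) = 1" by (simp_all add: add.commute)
    then show "z \<in> join_set T S" unfolding join_set_def by blast
  qed
  then show ?thesis by blast
qed

lemma ball_or_sphere_join:
  assumes "ball_or_sphere S" "ball_or_sphere T" and sl: "S \<subseteq> slice V" "T \<subseteq> slice W" and VW: "V \<inter> W = {}"
  shows "ball_or_sphere (join_set S T)"
proof -
  have WV: "W \<inter> V = {}" using VW by blast
  have bs: "ball_like (join_set S T)" if st: "ball_like S" "sphere_like T" "S \<subseteq> slice V" "T \<subseteq> slice W" "V \<inter> W = {}" for S T V W
  proof -
    obtain S' where "ball_pair S S'" using ball_imp_ball_pair[OF st(1)] by blast
    then show ?thesis by (rule ball_pair_imp_ball[OF ball_pair_join_sphere[OF _ st(2-5)]])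
  qed
  show ?thesis
    using assms(1,2) bs[OF _ _ sl VW] bs[OF _ _ sl(2,1) WV] sphere_join_sphere[OF _ _ sl VW] ball_join_ball[OF _ _ sl VW] join_set_commute[of S T]
    by metis
qed

section \<open>Manifold points\<close>

text \<open>
  Dimensions are not known in advance, so Euclidean space of dimension \<open>d\<close> is the subspace \<open>Eucl d\<close> of
  the space of sequences.
\<close>

definition Eucl :: "nat \<Rightarrow> (nat \<Rightarrow> real) set" where "Eucl d = {x. \<forall>i\<ge>d. x i = 0}"

lemma Euclidean_space_eq: "Euclidean_space d = top_of_set (Eucl d)"
  by (simp add: Euclidean_space_def euclidean_product_topology Eucl_def)

lemma invariance_of_domain_Eucl:
  assumes "n \<le> m" "openin (top_of_set (Eucl m)) U" "continuous_on U f" "f ` U \<subseteq> Eucl n" "inj_on f U"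
  shows "openin (top_of_set (Eucl n)) (f ` U)"
proof -
  have "U \<subseteq> Eucl m" using assms(2) openin_imp_subset by blast
  then have "subtopology (top_of_set (Eucl m)) U = top_of_set U" by (simp add: subtopology_subtopology Int_absorb1)
  moreover have "continuous_map (top_of_set U) (top_of_set (Eucl n)) f"
    using assms(3,4) by (auto simp: continuous_map_in_subtopology)
  ultimately show ?thesis
    using invariance_of_domain_Euclidean_space_gen[of n m U f] assms unfolding Euclidean_space_eq by simp
qed

lemma openin_Eucl_move:
  assumes "openin (top_of_set (Eucl d)) P" "a \<in> P" "v \<in> Eucl d"
  obtains t :: real where "0 < t" "(\<lambda>i. a i + t * v i) \<in> P"
proof -
  obtain G where G: "open G" "P = Eucl d \<inter> G" using assms(1) by (auto simp: openin_open)
  have aE: "a \<in> Eucl d" using assms(2) G by auto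
  let ?f = "\<lambda>t i. a i + t * v i"
  have "continuous_on UNIV ?f" by (intro continuous_on_coordinatewise_then_product continuous_intros)
  then have "open (?f -` G)" using G(1) by (simp add: continuous_on_open_vimage)
  moreover have "0 \<in> ?f -` G" using assms(2) G by simp
  ultimately obtain e where e: "0 < e" "\<And>t. dist t 0 < e \<Longrightarrow> t \<in> ?f -` G" unfolding open_dist by blast
  have "e / 2 \<in> ?f -` G" using e by (intro e(2)) simp
  moreover have "?f (e / 2) \<in> Eucl d" using aE assms(3) by (simp add: Eucl_def)
  ultimately show ?thesis using that[of "e / 2"] e(1) G(2) by simp
qed

text \<open>
  The dimension \<open>d\<close> is not prescribed. This makes the notion invariant under homeomorphisms and local without
  further data, at the price of a case distinction on \<open>d\<close> when a point is to be shown not to be of this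
  kind.
\<close>

definition manifold_point :: "'a::topological_space set \<Rightarrow> 'a \<Rightarrow> bool" where
  "manifold_point S x \<longleftrightarrow> (\<exists>d U W f g. openin (top_of_set S) U \<and> x \<in> U \<and>
     openin (top_of_set (Eucl d)) W \<and> homeomorphism U W f g)"

lemma manifold_point_homeomorphism_imp:
  assumes h: "homeomorphism S T h k" and mp: "manifold_point S x"
  shows "manifold_point T (h x)"
proof -
  obtain d U W f g where U: "openin (top_of_set S) U" "x \<in> U" and W: "openin (top_of_set (Eucl d)) W" and f: "homeomorphism U W f g"
    using mp unfolding manifold_point_def by blast
  have US: "U \<subseteq> S" using U openin_imp_subset by blast
  have "openin (top_of_set T) (h ` U)" by (rule homeomorphism_imp_open_map[OF h U(1)])
  moreover have "homeomorphism (h ` U) U k h"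
  proof -
    have "h ` U \<subseteq> T" using homeomorphism_image1[OF h] US by blast
    then show ?thesis by (rule homeomorphism_symD[OF homeomorphism_of_subsets[OF h US _ refl]])
  qed
  then have "homeomorphism (h ` U) W (f \<circ> k) (h \<circ> g)" using f by (rule homeomorphism_compose)
  ultimately show ?thesis using U(2) W unfolding manifold_point_def by blast
qed

lemma manifold_point_homeomorphism:
  assumes "homeomorphism S T h k" "x \<in> S"
  shows "manifold_point T (h x) \<longleftrightarrow> manifold_point S x"
  using manifold_point_homeomorphism_imp[OF assms(1)]
    manifold_point_homeomorphism_imp[OF homeomorphism_symD[OF assms(1)], of "h x"]
    homeomorphism_apply1[OF assms] by auto

lemma manifold_point_pl_iso:
  assumes "pl_iso S T h" "x \<in> S"
  shows "manifold_point T (h x) \<longleftrightarrow> manifold_point S x"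
  by (rule manifold_point_homeomorphism[OF pl_iso_homeomorphism[OF assms(1)] assms(2)])

lemma manifold_point_open:
  assumes G: "openin (top_of_set S) G" and x: "x \<in> G"
  shows "manifold_point S x \<longleftrightarrow> manifold_point G x"
proof
  assume "manifold_point G x"
  then show "manifold_point S x" unfolding manifold_point_def using openin_trans[OF _ G] by metis
next
  assume "manifold_point S x"
  then obtain d U W f g where U: "openin (top_of_set S) U" "x \<in> U" and W: "openin (top_of_set (Eucl d)) W" and f: "homeomorphism U W f g"
    unfolding manifold_point_def by blast
  have GS: "G \<subseteq> S" and US: "U \<subseteq> S" using G U openin_imp_subset by blast+
  have UG: "openin (top_of_set S) (U \<inter> G)" using U(1) G by (rule openin_Int)
  have 1: "openin (top_of_set G) (U \<inter> G)" by (rule openin_subset_trans[OF UG]) (use GS in auto)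
  have 2: "openin (top_of_set U) (U \<inter> G)" by (rule openin_subset_trans[OF UG]) (use US in auto)
  have "openin (top_of_set W) (f ` (U \<inter> G))" by (rule homeomorphism_imp_open_map[OF f 2])
  then have "openin (top_of_set (Eucl d)) (f ` (U \<inter> G))" using W by (rule openin_trans)
  moreover have "homeomorphism (U \<inter> G) (f ` (U \<inter> G)) f g"
  proof -
    have "f ` (U \<inter> G) \<subseteq> W" using homeomorphism_image1[OF f] by blast
    then show ?thesis by (rule homeomorphism_of_subsets[OF f Int_lower1 _ refl])
  qed
  ultimately show "manifold_point G x" using 1 U(2) x unfolding manifold_point_def by blast
qed

lemma manifold_point_local:
  assumes "openin (top_of_set S) G" "G \<subseteq> T" "T \<subseteq> S" "x \<in> G"
  shows "manifold_point S x \<longleftrightarrow> manifold_point T x"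
  using manifold_point_open[OF assms(1,4)] manifold_point_open[OF openin_subset_trans[OF assms(1-3)] assms(4)] by simp

lemma openin_coord_pos: "finite D \<Longrightarrow> openin (top_of_set S) {z\<in>S. \<forall>i\<in>D. 0 < coord z i}"
proof (induction D rule: finite_induct)
  case empty then show ?case by simp
next
  case (insert j D)
  have "openin (top_of_set S) {z\<in>S. 0 < coord z j}"
  proof -
    have "open {z. 0 < coord z j}" by (intro open_Collect_less continuous_on_const continuous_on_coord)
    moreover have "{z\<in>S. 0 < coord z j} = S \<inter> {z. 0 < coord z j}" by blast
    ultimately show ?thesis by (simp add: openin_open_Int)
  qed
  moreover have "{z\<in>S. \<forall>i\<in>insert j D. 0 < coord z i} = {z\<in>S. \<forall>i\<in>D. 0 < coord z i} \<inter> {z\<in>S. 0 < coord z j}" by blast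
  ultimately show ?case using openin_Int[OF insert.IH] by simp
qed

lemma simplex_boundary_iff:
  assumes "finite V" "x \<in> full_simplex V"
  shows "x \<in> simplex_boundary V \<longleftrightarrow> (\<exists>j\<in>V. coord x j = 0)"
  using assms(2) unfolding realization_iff[OF complex_on_Pow[OF assms(1)]] realization_iff[OF complex_on_boundary[OF assms(1)]]
  by (auto simp: in_keys_iff)

text \<open>The chart of the standard simplex drops the last coordinate.\<close>

definition simplex_chart :: "nat \<Rightarrow> vec \<Rightarrow> nat \<Rightarrow> real" where
  "simplex_chart d x = (\<lambda>i. if i < d then coord x i else 0)"

definition simplex_unchart :: "nat \<Rightarrow> (nat \<Rightarrow> real) \<Rightarrow> vec" where
  "simplex_unchart d a = (\<Sum>i<d. a i *\<^sub>R basis_vec i) + (1 - (\<Sum>i<d. a i)) *\<^sub>R basis_vec d"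

lemma coord_simplex_unchart:
  "coord (simplex_unchart d a) i = (if i < d then a i else if i = d then 1 - (\<Sum>i<d. a i) else 0)"
proof -
  have "coord (\<Sum>i<d. a i *\<^sub>R basis_vec i) i = (\<Sum>j<d. if j = i then a j else 0)"
    unfolding lookup_sum by (rule sum.cong) (auto simp: lookup_single when_def)
  then show ?thesis by (auto simp: simplex_unchart_def lookup_add lookup_single when_def)
qed

lemma full_simplex_atMost_iff:
  "x \<in> full_simplex {..d} \<longleftrightarrow> (\<forall>i. 0 \<le> coord x i) \<and> supp x \<subseteq> {..d} \<and> (\<Sum>i<d. coord x i) + coord x d = 1"
proof -
  have "coord_sum x = (\<Sum>i<d. coord x i) + coord x d" if "supp x \<subseteq> {..d}"
    using coord_sum_eq_sum[OF _ that] by (simp add: lessThan_Suc_atMost[symmetric])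
  then show ?thesis unfolding realization_iff[OF complex_on_Pow[OF finite_atMost]] by auto
qed

lemma homeomorphism_simplex_chart:
  "homeomorphism (full_simplex {..d}) {a \<in> Eucl d. (\<forall>i. 0 \<le> a i) \<and> (\<Sum>i<d. a i) \<le> 1} (simplex_chart d) (simplex_unchart d)"
  (is "homeomorphism ?S ?T ?f ?g")
proof (rule homeomorphismI)
  have "continuous_on ?S (\<lambda>x. simplex_chart d x i)" for i
    by (cases "i < d") (simp_all add: simplex_chart_def continuous_on_coord)
  then show "continuous_on ?S ?f" by (intro continuous_on_coordinatewise_then_product)
  have c: "continuous_on ?T (\<lambda>a. a i)" for i
    by (rule continuous_on_product_coordinates[THEN continuous_on_subset]) simp
  show "continuous_on ?T ?g" unfolding simplex_unchart_def
    by (intro continuous_on_add continuous_on_sum continuous_on_scaleR continuous_on_diff continuous_on_const c)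
  show fS: "?f ` ?S \<subseteq> ?T"
  proof
    fix a assume "a \<in> ?f ` ?S"
    then obtain x where x: "a = ?f x" "x \<in> ?S" by blast
    then show "a \<in> ?T" unfolding full_simplex_atMost_iff
      by (auto simp: simplex_chart_def Eucl_def) (metis add_increasing2 order_refl)
  qed
  show "?g ` ?T \<subseteq> ?S"
  proof
    fix x assume "x \<in> ?g ` ?T"
    then obtain a where a: "x = ?g a" "a \<in> ?T" by blast
    then show "x \<in> ?S" unfolding full_simplex_atMost_iff a(1) coord_simplex_unchart
      by (auto simp: in_keys_iff coord_simplex_unchart split: if_splits)
  qed
  show "?g (?f x) = x" if "x \<in> ?S" for x
  proof (rule poly_mapping_eqI)
    fix i
    have x: "supp x \<subseteq> {..d}" "(\<Sum>i<d. coord x i) + coord x d = 1" using that full_simplex_atMost_iff by auto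
    have "(\<Sum>i<d. ?f x i) = (\<Sum>i<d. coord x i)" by (rule sum.cong) (auto simp: simplex_chart_def)
    then have "coord (?g (?f x)) d = coord x d" using x(2) by (simp add: coord_simplex_unchart)
    moreover have "coord x i = 0" if "d < i" using x(1) that by (auto simp: in_keys_iff subset_iff)
    ultimately show "coord (?g (?f x)) i = coord x i"
      by (cases i d rule: linorder_cases) (simp_all add: coord_simplex_unchart simplex_chart_def)
  qed
  show "?f (?g a) = a" if "a \<in> ?T" for a
    using that by (auto simp: coord_simplex_unchart simplex_chart_def Eucl_def)
qed

lemma openin_Eucl_simplex_interior:
  "openin (top_of_set (Eucl d)) {a \<in> Eucl d. (\<forall>i<d. 0 < a i) \<and> (\<Sum>i<d. a i) < 1}"
proof -
  have c: "continuous_on UNIV (\<lambda>a::nat\<Rightarrow>real. a i)" for i by (rule continuous_on_product_coordinates)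
  have "open ((\<Inter>i\<in>{..<d}. {a::nat\<Rightarrow>real. 0 < a i}) \<inter> {a. (\<Sum>i<d. a i) < 1})"
    by (intro open_Int open_INT open_Collect_less continuous_on_const continuous_on_sum c ballI finite_lessThan)
  moreover have "{a \<in> Eucl d. (\<forall>i<d. 0 < a i) \<and> (\<Sum>i<d. a i) < 1} =
      Eucl d \<inter> ((\<Inter>i\<in>{..<d}. {a. 0 < a i}) \<inter> {a. (\<Sum>i<d. a i) < 1})" by auto
  ultimately show ?thesis by (simp add: openin_open_Int)
qed

lemma full_simplex_interior_dense:
  assumes "openin (top_of_set (full_simplex {..d})) U" "x \<in> U"
  obtains y where "y \<in> U" "\<forall>i\<le>d. 0 < coord y i"
proof -
  obtain e where e: "0 < e" "\<And>y. y \<in> full_simplex {..d} \<Longrightarrow> dist y x < e \<Longrightarrow> y \<in> U"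
    using assms unfolding openin_euclidean_subtopology_iff by blast
  have x: "\<forall>i. 0 \<le> coord x i" "supp x \<subseteq> {..d}" "(\<Sum>i<d. coord x i) + coord x d = 1"
    using assms openin_imp_subset[OF assms(1)] full_simplex_atMost_iff by auto
  define c where "c = (1 / (real d + 1)) *\<^sub>R (\<Sum>i\<le>d. basis_vec i)"
  have c: "coord c i = (if i \<le> d then 1 / (real d + 1) else 0)" for i
    by (simp add: c_def lookup_sum lookup_single when_def cong: if_cong)
  define N where "N = norm (c - x) + 1"
  have N: "0 < N" unfolding N_def by (simp add: add_nonneg_pos)
  define t where "t = min 1 (e / (2 * N))"
  have t: "0 < t" "t \<le> 1" using N e(1) by (auto simp: t_def)
  have "t * N \<le> e / (2 * N) * N" using N by (intro mult_right_mono) (simp_all add: t_def)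
  then have te: "t * N \<le> e / 2" using N by simp
  define y where "y = (1 - t) *\<^sub>R x + t *\<^sub>R c"
  have cy: "coord y i = (1 - t) * coord x i + t * coord c i" for i by (simp add: y_def lookup_add)
  have yx: "y - x = t *\<^sub>R (c - x)" by (simp add: y_def algebra_simps)
  have "dist y x = t * norm (c - x)" unfolding dist_norm yx using t by simp
  also have "\<dots> < t * N" using t by (simp add: N_def)
  also have "\<dots> < e" using te e(1) by simp
  finally have d: "dist y x < e" .
  have pos: "0 < coord y i" if "i \<le> d" for i
    unfolding cy c using that x(1) t by (auto intro!: add_nonneg_pos)
  have "(\<Sum>i<d. coord y i) + coord y d = (1 - t) * ((\<Sum>i<d. coord x i) + coord x d) + t * ((\<Sum>i<d. coord c i) + coord c d)"
    unfolding cy sum.distrib sum_distrib_left[symmetric] by (simp only: algebra_simps)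
  also have "(\<Sum>i<d. coord c i) + coord c d = 1" by (simp add: c add_divide_distrib[symmetric])
  finally have "(\<Sum>i<d. coord y i) + coord y d = 1" using x(3) by simp
  moreover have "0 \<le> coord y i" for i unfolding cy c using x(1) t by auto
  moreover have "supp y \<subseteq> {..d}" using x(2) by (auto simp: in_keys_iff cy c subset_iff split: if_splits)
  ultimately have "y \<in> full_simplex {..d}" by (simp add: full_simplex_atMost_iff)
  then have "y \<in> U" using e(2) d by blast
  then show ?thesis using that pos by blast
qed

text \<open>
  Suppose that a boundary point \<open>x\<close> had a neighbourhood \<open>U\<close> homeomorphic to an open subset of \<open>Eucl m\<close>. If
  \<open>d \<le> m\<close>, then invariance of domain makes the image of \<open>U\<close> in the chart open in \<open>Eucl d\<close>, but it cannot
  contain points beyond the facet on which \<open>x\<close> lies. If \<open>m < d\<close>, then \<open>U\<close> contains interior points of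
  the simplex, and near these an open subset of \<open>Eucl d\<close> would embed into \<open>Eucl m\<close>, with an image that
  is open in \<open>Eucl d\<close>.
\<close>

lemma manifold_point_std_simplex:
  assumes "x \<in> full_simplex {..d}"
  shows "manifold_point (full_simplex {..d}) x \<longleftrightarrow> x \<notin> simplex_boundary {..d}"
proof -
  let ?S = "full_simplex {..d}"
  let ?T = "{a \<in> Eucl d. (\<forall>i. 0 \<le> a i) \<and> (\<Sum>i<d. a i) \<le> 1}"
  let ?Ti = "{a \<in> Eucl d. (\<forall>i<d. 0 < a i) \<and> (\<Sum>i<d. a i) < 1}"
  let ?Si = "{x\<in>?S. \<forall>i\<in>{..d}. 0 < coord x i}"
  note hom = homeomorphism_simplex_chart[of d]
  have Ti: "simplex_chart d ` ?Si = ?Ti"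
  proof
    show "simplex_chart d ` ?Si \<subseteq> ?Ti"
    proof
      fix a assume "a \<in> simplex_chart d ` ?Si"
      then obtain y where y: "a = simplex_chart d y" "y \<in> ?S" "\<forall>i\<in>{..d}. 0 < coord y i" by blast
      then have "0 < coord y d" "(\<Sum>i<d. coord y i) + coord y d = 1" unfolding full_simplex_atMost_iff by auto
      then have "(\<Sum>i<d. coord y i) < 1" by linarith
      then show "a \<in> ?Ti" using y by (simp add: simplex_chart_def Eucl_def)
    qed
    show "?Ti \<subseteq> simplex_chart d ` ?Si"
    proof
      fix a assume a: "a \<in> ?Ti"
      then have "0 \<le> a i" for i by (cases "i < d") (auto simp: Eucl_def less_imp_le)
      then have aT: "a \<in> ?T" using a by auto
      have 1: "simplex_unchart d a \<in> ?Si"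
        using a subsetD[OF equalityD1[OF homeomorphism_image2[OF hom]] imageI[OF aT]] by (auto simp: coord_simplex_unchart)
      show "a \<in> simplex_chart d ` ?Si"
        using imageI[OF 1, of "simplex_chart d"] homeomorphism_apply2[OF hom aT] by simp
    qed
  qed
  have "?Si \<subseteq> ?S" by (rule Collect_restrict)
  then have "simplex_chart d ` ?Si \<subseteq> simplex_chart d ` ?S" by (rule image_mono)
  then have "?Ti \<subseteq> ?T" by (simp only: Ti homeomorphism_image1[OF hom])
  then have hom0: "homeomorphism ?Si ?Ti (simplex_chart d) (simplex_unchart d)"
    by (rule homeomorphism_of_subsets[OF hom \<open>?Si \<subseteq> ?S\<close> _ Ti])
  have oS0: "openin (top_of_set ?S) ?Si" by (rule openin_coord_pos) simp
  have bd: "x \<in> simplex_boundary {..d} \<longleftrightarrow> x \<notin> ?Si"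
    using assms simplex_boundary_iff[OF finite_atMost assms] full_simplex_atMost_iff[of x d] by (auto simp: less_le)
  show ?thesis
  proof
    assume "x \<notin> simplex_boundary {..d}"
    then have "x \<in> ?Si" using bd by blast
    then show "manifold_point ?S x" unfolding manifold_point_def using oS0 openin_Eucl_simplex_interior[of d] hom0 by blast
  next
    assume "manifold_point ?S x"
    then obtain m U W f g where U: "openin (top_of_set ?S) U" "x \<in> U" and W: "openin (top_of_set (Eucl m)) W" and f: "homeomorphism U W f g"
      unfolding manifold_point_def by blast
    have US: "U \<subseteq> ?S" using U openin_imp_subset by blast
    have WE: "W \<subseteq> Eucl m" using W openin_imp_subset by blast
    have injchart: "inj_on (simplex_chart d) ?S" by (rule inj_on_inverseI[of _ "simplex_unchart d"]) (rule homeomorphism_apply1[OF hom])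
    show "x \<notin> simplex_boundary {..d}"
    proof
      assume "x \<in> simplex_boundary {..d}"
      then obtain j where j: "j \<le> d" "coord x j = 0" using simplex_boundary_iff[OF finite_atMost assms] by auto
      show False
      proof (cases "d \<le> m")
        case True
        have gW: "g ` W = U" by (rule homeomorphism_image2[OF f])
        have "openin (top_of_set (Eucl d)) ((simplex_chart d \<circ> g) ` W)"
        proof (rule invariance_of_domain_Eucl[OF True W])
          show "continuous_on W (simplex_chart d \<circ> g)"
            using homeomorphism_cont2[OF f] continuous_on_subset[OF homeomorphism_cont1[OF hom] US] gW
            by (intro continuous_on_compose) simp_all
          show "(simplex_chart d \<circ> g) ` W \<subseteq> Eucl d" by (auto simp: simplex_chart_def Eucl_def)
          have "inj_on g W" by (rule inj_on_inverseI[of _ f]) (rule homeomorphism_apply2[OF f])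
          then show "inj_on (simplex_chart d \<circ> g) W"
            using gW US by (intro comp_inj_on) (auto intro: inj_on_subset[OF injchart])
        qed
        moreover have "(simplex_chart d \<circ> g) ` W = simplex_chart d ` U" using gW by (simp only: image_comp[symmetric])
        ultimately have op: "openin (top_of_set (Eucl d)) (simplex_chart d ` U)" by simp
        have sub: "simplex_chart d ` U \<subseteq> ?T" using US homeomorphism_image1[OF hom] by blast
        have xs: "(\<Sum>i<d. coord x i) + coord x d = 1" using assms full_simplex_atMost_iff by simp
        show False
        proof (cases "j = d")
          case True
          \<comment> \<open>The facet opposite to the dropped vertex is where the coordinates of the chart sum to \<open>1\<close>.\<close>
          then have "0 < d" using xs j by (cases d) auto
          then have v: "(\<lambda>i. if i = 0 then 1 else 0) \<in> Eucl d" by (auto simp: Eucl_def)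
          obtain t :: real where t: "0 < t" "(\<lambda>i. simplex_chart d x i + t * (if i = 0 then 1 else 0)) \<in> simplex_chart d ` U"
            using openin_Eucl_move[OF op imageI[OF U(2)] v] by blast
          then have "(\<Sum>i<d. simplex_chart d x i + t * (if i = 0 then 1 else 0)) \<le> 1" using sub by blast
          then show False using xs j True t(1) \<open>0 < d\<close>
            by (simp add: sum.distrib simplex_chart_def sum_distrib_left[symmetric])
        next
          case False
          then have jd: "j < d" using j by simp
          then have v: "(\<lambda>i. if i = j then -1 else 0) \<in> Eucl d" by (auto simp: Eucl_def)
          obtain t :: real where t: "0 < t" "(\<lambda>i. simplex_chart d x i + t * (if i = j then -1 else 0)) \<in> simplex_chart d ` U"
            using openin_Eucl_move[OF op imageI[OF U(2)] v] by blast
          then have "\<forall>i. 0 \<le> simplex_chart d x i + t * (if i = j then -1 else 0)" using sub by blast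
          from spec[OF this, of j] show False using t(1) j jd by (simp add: simplex_chart_def)
        qed
      next
        case False
        then have md: "m \<le> d" "m < d" by auto
        let ?Ui = "U \<inter> ?Si"
        have "openin (top_of_set ?S) ?Ui" using U(1) oS0 by (rule openin_Int)
        then have "openin (top_of_set ?Si) ?Ui" by (rule openin_subset_trans) auto
        then have "openin (top_of_set ?Ti) (simplex_chart d ` ?Ui)" by (rule homeomorphism_imp_open_map[OF hom0])
        then have op: "openin (top_of_set (Eucl d)) (simplex_chart d ` ?Ui)" using openin_Eucl_simplex_interior by (rule openin_trans)
        have uc: "simplex_unchart d ` simplex_chart d ` ?Ui = ?Ui"
        proof -
          have "simplex_unchart d (simplex_chart d y) = y" if "y \<in> ?Ui" for y
            using that by (intro homeomorphism_apply1[OF hom]) auto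
          then have "(\<lambda>y. simplex_unchart d (simplex_chart d y)) ` ?Ui = (\<lambda>y. y) ` ?Ui" by (rule image_cong[OF refl])
          then show ?thesis by (simp only: image_image image_ident)
        qed
        have sub: "simplex_chart d ` ?Ui \<subseteq> ?T" using US homeomorphism_image1[OF hom] by blast
        let ?h = "f \<circ> simplex_unchart d"
        have him: "?h ` simplex_chart d ` ?Ui = f ` ?Ui" unfolding image_comp[symmetric] uc ..
        have fW: "f ` ?Ui \<subseteq> W" using homeomorphism_image1[OF f] by blast
        have "openin (top_of_set (Eucl d)) (?h ` simplex_chart d ` ?Ui)"
        proof (rule invariance_of_domain_Eucl[OF order_refl op])
          show "continuous_on (simplex_chart d ` ?Ui) ?h"
            using continuous_on_subset[OF homeomorphism_cont2[OF hom] sub] continuous_on_subset[OF homeomorphism_cont1[OF f], of ?Ui] uc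
            by (intro continuous_on_compose) simp_all
          show "?h ` simplex_chart d ` ?Ui \<subseteq> Eucl d"
          proof -
            have "Eucl m \<subseteq> Eucl d" using md by (auto simp: Eucl_def)
            then show ?thesis unfolding him using fW WE by blast
          qed
          have "inj_on (simplex_unchart d) ?T" by (rule inj_on_inverseI[of _ "simplex_chart d"]) (rule homeomorphism_apply2[OF hom])
          moreover have "inj_on f U" by (rule inj_on_inverseI[of _ g]) (rule homeomorphism_apply1[OF f])
          ultimately show "inj_on ?h (simplex_chart d ` ?Ui)"
            using sub uc by (intro comp_inj_on) (auto intro: inj_on_subset)
        qed
        then have op': "openin (top_of_set (Eucl d)) (f ` ?Ui)" unfolding him .
        obtain y where y: "y \<in> U" "\<forall>i\<le>d. 0 < coord y i" by (rule full_simplex_interior_dense[OF U])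
        then have "f y \<in> f ` ?Ui" using US by blast
        moreover have "(\<lambda>i. if i = m then 1 else 0) \<in> Eucl d" using md by (auto simp: Eucl_def)
        ultimately obtain t :: real where t: "0 < t" "(\<lambda>i. f y i + t * (if i = m then 1 else 0)) \<in> f ` ?Ui"
          using openin_Eucl_move[OF op'] by blast
        then have "(\<lambda>i. f y i + t * (if i = m then 1 else 0)) \<in> Eucl m" using fW WE by blast
        moreover have "f y \<in> Eucl m" using \<open>f y \<in> f ` ?Ui\<close> fW WE by blast
        ultimately show False using t(1) by (auto simp: Eucl_def)
      qed
    qed
  qed
qed

lemma manifold_point_ball_pair:
  assumes "pl_iso S (full_simplex V) f" "f ` S' = simplex_boundary V" "S' \<subseteq> S" "finite V" "V \<noteq> {}" "x \<in> S"
  shows "manifold_point S x \<longleftrightarrow> x \<notin> S'"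
proof -
  have "card {..card V - 1} = card V" using assms(4,5) by (simp add: card_gt_0_iff Suc_leI)
  then obtain g where g: "pl_iso S (full_simplex {..card V - 1}) g" "g ` S' = simplex_boundary {..card V - 1}"
    using ball_pair_relabel[OF assms(1,2,4) finite_atMost] by blast
  have gx: "g x \<in> full_simplex {..card V - 1}" using pl_iso_image[OF g(1)] assms(6) by blast
  have "manifold_point S x \<longleftrightarrow> g x \<notin> simplex_boundary {..card V - 1}"
    using manifold_point_pl_iso[OF g(1) assms(6)] manifold_point_std_simplex[OF gx] by simp
  also have "\<dots> \<longleftrightarrow> x \<notin> S'"
    unfolding g(2)[symmetric] using inj_on_image_mem_iff[OF pl_iso_inj_on[OF g(1)] assms(6,3)] by simp
  finally show ?thesis .
qed

lemma manifold_point_simplex: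
  assumes "finite V" "x \<in> full_simplex V"
  shows "manifold_point (full_simplex V) x \<longleftrightarrow> x \<notin> simplex_boundary V"
proof (rule manifold_point_ball_pair[OF _ _ _ assms(1) _ assms(2)])
  show "pl_iso (full_simplex V) (full_simplex V) id"
    by (rule pl_iso_id[OF polyhedral_realization[OF complex_on_Pow[OF assms(1)]]])
  show "simplex_boundary V \<subseteq> full_simplex V" by (rule realization_mono) (rule Diff_subset)
  show "V \<noteq> {}"
  proof
    assume "V = {}"
    then have "supp x = {}" "coord_sum x = 1" using assms(2) unfolding realization_iff[OF complex_on_Pow[OF assms(1)]] by auto
    then show False by (simp add: coord_sum_def)
  qed
qed simp

text \<open>
  The open star of a vertex \<open>i\<close> of the boundary is carried by \<open>star_map\<close> to the interior of the opposite facet.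
\<close>

lemma manifold_point_simplex_boundary:
  assumes W: "finite W" and x: "x \<in> simplex_boundary W"
  shows "manifold_point (simplex_boundary W) x"
proof -
  note rB = realization_iff[OF complex_on_boundary[OF W]]
  have x': "\<And>i. 0 \<le> coord x i" "supp x \<subseteq> W" "supp x \<noteq> W" "coord_sum x = 1" using x unfolding rB by auto
  have "supp x \<noteq> {}" using x'(4) by (auto simp: coord_sum_def)
  then obtain i where i: "i \<in> supp x" by blast
  define V where "V = W - {i}"
  have V: "finite V" "i \<notin> V" "W = insert i V" using W i x'(2) by (auto simp: V_def)
  have "V \<noteq> {}" using V(3) x'(2,3) i by auto
  let ?K = "join_complex {i} V (Pow {i}) (Pow V - {V})"
  have K: "complex_on ({i} \<union> V) ?K" using V by (intro complex_on_join complex_on_Pow complex_on_boundary) auto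
  let ?G = "{z \<in> simplex_boundary W. \<forall>j\<in>{i}. 0 < coord z j}"
  have G: "openin (top_of_set (simplex_boundary W)) ?G" by (rule openin_coord_pos) simp
  have xi: "0 < coord x i" using x'(1)[of i] i by (simp add: in_keys_iff less_le)
  have xG: "x \<in> ?G" using x xi by simp
  have GK: "?G \<subseteq> realization ?K"
  proof
    fix z assume z: "z \<in> ?G"
    then have "i \<in> supp z" "supp z \<subseteq> W" "supp z \<noteq> W" unfolding rB by (auto simp: in_keys_iff)
    then have "supp z \<in> ?K" using V by (auto simp: join_complex_def)
    then show "z \<in> realization ?K" using z unfolding rB realization_iff[OF K] by simp
  qed
  have KB: "realization ?K \<subseteq> simplex_boundary W"
    using V by (intro realization_mono) (auto simp: join_complex_def)
  have "manifold_point (realization ?K) x"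
  proof -
    have xK: "x \<in> realization ?K" using GK xG by blast
    note star = pl_iso_star_map[OF V(1) \<open>V \<noteq> {}\<close> V(2)]
    have sx: "star_map i V x \<in> full_simplex V" using pl_iso_image[OF star] xK by blast
    have "0 < coord (star_map i V x) j" if "j \<in> V" for j
      using that xi x'(1)[of j] V(1) unfolding coord_star_map[OF V(1)] by (auto intro!: add_nonneg_pos divide_pos_pos simp: card_gt_0_iff)
    then have "star_map i V x \<notin> simplex_boundary V" unfolding simplex_boundary_iff[OF V(1) sx] by force
    then show ?thesis using manifold_point_simplex[OF V(1) sx] manifold_point_pl_iso[OF star xK] by simp
  qed
  then show ?thesis using manifold_point_local[OF G GK KB xG] by simp
qed

lemma manifold_point_sphere_like:
  assumes "sphere_like S" "x \<in> S" shows "manifold_point S x"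
proof -
  obtain V f where V: "finite V" and f: "pl_iso S (simplex_boundary V) f"
    using assms(1) unfolding sphere_like_def by blast
  have "f x \<in> simplex_boundary V" using pl_iso_image[OF f] assms(2) by blast
  then have "manifold_point (simplex_boundary V) (f x)" by (rule manifold_point_simplex_boundary[OF V])
  then show ?thesis using manifold_point_pl_iso[OF f assms(2)] by simp
qed

section \<open>Links\<close>

lemma supp_scaleR: "r \<noteq> 0 \<Longrightarrow> supp (r *\<^sub>R x) = supp x"
  by (auto simp: in_keys_iff)

lemma complex_on_link: "complex_on V K \<Longrightarrow> complex_on (V - D) (link K D)"
proof -
  assume K: "complex_on V K"
  show ?thesis unfolding complex_on_def
  proof (intro conjI ballI allI impI)
    show "finite (V - D)" using complex_onD(1)[OF K] by simp
    show "link K D \<subseteq> Pow (V - D)" using complex_onD(2)[OF K] by (auto simp: link_def)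
    fix I J assume "I \<in> link K D" "J \<subseteq> I"
    then show "J \<in> link K D" using complex_onD(3)[OF K, of "D \<union> I" "D \<union> J"] by (auto simp: link_def)
  qed
qed

lemma empty_in_link: "D \<in> K \<Longrightarrow> {} \<in> link K D"
  by (simp add: link_def)

text \<open>
  Near a point with positive coordinates on \<open>D\<close>, the realization of \<open>K\<close> agrees with the join of the
  simplex \<open>D\<close> and the link of \<open>D\<close>.
\<close>

locale face_star =
  fixes V D :: "nat set" and K :: "nat set set"
  assumes K: "complex_on V K" and D: "D \<in> K" "D \<noteq> {}"
begin

abbreviation "\<Lambda> \<equiv> link K D"
abbreviation "star \<equiv> join_set (full_simplex D) (realization \<Lambda>)"

lemma D_finite: "finite D" and D_sub: "D \<subseteq> V"
  using complex_onD(2,4)[OF K D(1)] by auto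

lemma cD: "complex_on D (Pow D)" by (rule complex_on_Pow[OF D_finite])
lemma cL: "complex_on (V - D) \<Lambda>" by (rule complex_on_link[OF K])
lemma L0: "{} \<in> \<Lambda>" by (rule empty_in_link[OF D(1)])

lemma slices: "full_simplex D \<subseteq> slice D" "realization \<Lambda> \<subseteq> slice (V - D)"
  by (rule realization_subset_slice[OF cD], rule realization_subset_slice[OF cL])

lemma star_eq: "star = realization (join_complex D (V - D) (Pow D) \<Lambda>)"
  using realization_join[OF cD _ cL L0] by auto

lemma star_subset: "star \<subseteq> realization K"
  unfolding star_eq
proof (rule realization_mono, rule subsetI)
  fix J assume "J \<in> join_complex D (V - D) (Pow D) \<Lambda>"
  then have J: "J \<subseteq> D \<union> (V - D)" "D \<union> J \<inter> (V - D) \<in> K" by (auto simp: join_complex_def link_def)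
  have "J \<subseteq> D \<union> J \<inter> (V - D)" using J(1) by blast
  then show "J \<in> K" by (rule complex_onD(3)[OF K J(2)])
qed

lemma manifold_point_star:
  assumes a: "a \<in> cone_over (full_simplex D)" "supp a = D" and w: "w \<in> cone_over (realization \<Lambda>)" and s: "coord_sum (a + w) = 1"
  shows "a + w \<in> star" "manifold_point (realization K) (a + w) \<longleftrightarrow> manifold_point star (a + w)"
proof -
  have aa: "\<And>i. 0 \<le> coord a i" using a cone_over_realization_iff[OF cD, of a] by auto
  have ww: "\<And>i. 0 \<le> coord w i" using w cone_over_realization_iff[OF cL L0, of w] by auto
  let ?G = "{z \<in> realization K. \<forall>i\<in>D. 0 < coord z i}"
  show st: "a + w \<in> star" using a w s unfolding join_set_def by blast
  have "0 < coord (a + w) i" if "i \<in> D" for i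
    using aa[of i] ww[of i] that a(2) by (auto simp: lookup_add in_keys_iff less_le intro: add_pos_nonneg)
  then have zG: "a + w \<in> ?G" using st star_subset by blast
  have Gs: "?G \<subseteq> star"
  proof
    fix z assume z: "z \<in> ?G"
    then have zK: "z \<in> realization K" "D \<subseteq> supp z" by (auto simp: in_keys_iff)
    then have k: "supp z \<in> K" using realization_iff[OF K] by simp
    then have "supp z \<subseteq> V" by (rule complex_onD(2)[OF K])
    then have "D \<union> supp z \<inter> (V - D) = supp z" "supp z \<subseteq> D \<union> (V - D)" using zK(2) by auto
    then have "supp z \<in> join_complex D (V - D) (Pow D) \<Lambda>" using k by (auto simp: join_complex_def link_def)
    then show "z \<in> star" unfolding star_eq realization_iff[OF complex_on_join[OF cD cL]] using zK(1) realization_iff[OF K] by simp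
  qed
  show "manifold_point (realization K) (a + w) \<longleftrightarrow> manifold_point star (a + w)"
    by (rule manifold_point_local[OF openin_coord_pos[OF D_finite] Gs star_subset zG])
qed

text \<open>
  If the link is a ball, then the star is PL homeomorphic to a simplex with \<open>D\<close> as a face, and
  the manifold points of a simplex are those off its boundary. The case \<open>w = 0\<close> concerns the interior
  points of \<open>D\<close>, which are never manifold points.
\<close>

lemma manifold_point_link_ball:
  assumes W: "finite W" "W \<noteq> {}" "W \<inter> D = {}" and f: "pl_iso (realization \<Lambda>) (full_simplex W) f"
    and a: "a \<in> cone_over (full_simplex D)" "supp a = D" and w: "w \<in> cone_over (realization \<Lambda>)" and s: "coord_sum (a + w) = 1"
  shows "manifold_point (realization K) (a + w) \<longleftrightarrow> W \<subseteq> supp (homog f w)"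
proof -
  have DW: "D \<inter> W = {}" "D \<inter> (V - D) = {}" using W by auto
  note cW = complex_on_Pow[OF W(1)]
  have sW: "full_simplex W \<subseteq> slice W" by (rule realization_subset_slice[OF cW])
  let ?j = "join_map D (V - D) id f"
  have j: "pl_iso star (join_set (full_simplex D) (full_simplex W)) ?j"
    by (rule pl_iso_join[OF DW(2,1) slices slices(1) sW pl_iso_id[OF polyhedral_realization[OF cD]] f])
  have "join_complex D W (Pow D) (Pow W) = Pow (D \<union> W)" by (auto simp: join_complex_def)
  then have tgt: "join_set (full_simplex D) (full_simplex W) = full_simplex (D \<union> W)"
    using realization_join[OF cD _ cW _ DW(1)] by simp
  interpret J: join_setting D "V - D" D W "full_simplex D" "realization \<Lambda>" id f
    using DW slices pl_iso_image[OF f] sW by unfold_locales auto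
  have fin: "finite (D \<union> W)" using D_finite W by simp
  note st = manifold_point_star[OF a w s]
  have ida: "homog id a = a" using a(1) slices(1) by (cases rule: cone_overE) (auto simp: homog_scaleR)
  have ja: "?j (a + w) = a + homog f w" unfolding J.join_map_sum[OF a(1) w] ida ..
  have jS: "?j (a + w) \<in> full_simplex (D \<union> W)" using pl_iso_image[OF j] st(1) unfolding tgt by blast
  have w': "homog f w \<in> cone_over (full_simplex W)" using homog_cone_over[OF w slices(2), of f] pl_iso_image[OF f] by simp
  have nn: "0 \<le> coord a i" "0 \<le> coord (homog f w) i" "supp (homog f w) \<subseteq> W" for i
    using a(1) w' cone_over_realization_iff[OF cD, of a] cone_over_realization_iff[OF cW, of "homog f w"] by auto
  have supp_j: "supp (?j (a + w)) = D \<union> supp (homog f w)" unfolding ja using supp_add_nonneg[OF nn(1,2)] a(2) by simp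
  have "manifold_point (realization K) (a + w) \<longleftrightarrow> ?j (a + w) \<notin> simplex_boundary (D \<union> W)"
    using st(2) manifold_point_pl_iso[OF j st(1)] manifold_point_simplex[OF fin jS] unfolding tgt by simp
  also have "\<dots> \<longleftrightarrow> D \<union> W \<subseteq> supp (?j (a + w))"
    unfolding simplex_boundary_iff[OF fin jS] by (auto simp: in_keys_iff)
  also have "\<dots> \<longleftrightarrow> W \<subseteq> supp (homog f w)" unfolding supp_j using DW by blast
  finally show ?thesis .
qed

text \<open>
  If the link is a sphere, then the star is PL homeomorphic to \<open>D * \<partial>W\<close> for a simplex \<open>W\<close>. This is part of
  \<open>\<partial>(D * W)\<close>, and a neighbourhood of the interior points of \<open>D\<close> in it.
\<close>

lemma manifold_point_link_sphere:
  assumes "sphere_like (realization \<Lambda>)" and a: "a \<in> realization K" "supp a = D"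
  shows "manifold_point (realization K) a"
proof -
  obtain W f where W: "finite W" "W \<noteq> {}" "W \<inter> D = {}" and f: "pl_iso (realization \<Lambda>) (simplex_boundary W) f"
    by (rule sphere_fresh[OF assms(1) D_finite])
  have DW: "D \<inter> W = {}" "D \<inter> (V - D) = {}" using W by auto
  note cW = complex_on_boundary[OF W(1)]
  have sW: "simplex_boundary W \<subseteq> slice W" by (rule realization_subset_slice[OF cW])
  have W0: "{} \<in> Pow W - {W}" using W by auto
  have aK: "\<And>i. 0 \<le> coord a i" "coord_sum a = 1" using a(1) realization_iff[OF K] by auto
  have aD: "a \<in> cone_over (full_simplex D)" using aK a(2) cone_over_realization_iff[OF cD] by simp
  have s: "coord_sum (a + 0) = 1" using aK by simp
  note st = manifold_point_star[OF aD a(2) zero_in_cone_over s, simplified]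
  let ?j = "join_map D (V - D) id f"
  let ?Q = "realization (join_complex D W (Pow D) (Pow W - {W}))"
  have tgt: "join_set (full_simplex D) (simplex_boundary W) = ?Q"
    using realization_join[OF cD _ cW W0 DW(1)] by simp
  have j: "pl_iso star ?Q ?j" unfolding tgt[symmetric]
    by (rule pl_iso_join[OF DW(2,1) slices slices(1) sW pl_iso_id[OF polyhedral_realization[OF cD]] f])
  interpret J: join_setting D "V - D" D W "full_simplex D" "realization \<Lambda>" id f
    using DW slices pl_iso_image[OF f] sW by unfold_locales auto
  have ida: "homog id a = a" using aD slices(1) by (cases rule: cone_overE) (auto simp: homog_scaleR)
  have ja: "?j a = a" using J.join_map_sum[OF aD zero_in_cone_over] ida by simp
  have fin: "finite (D \<union> W)" using D_finite W by simp
  note cB = complex_on_boundary[OF fin]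
  let ?G = "{z \<in> simplex_boundary (D \<union> W). \<forall>i\<in>D. 0 < coord z i}"
  have "0 < coord a i" if "i \<in> D" for i using that a(2) aK(1)[of i] by (auto simp: in_keys_iff less_le)
  moreover have aB: "a \<in> simplex_boundary (D \<union> W)"
    using aK a(2) DW W(2) unfolding realization_iff[OF cB] by auto
  ultimately have aG: "a \<in> ?G" by blast
  have GQ: "?G \<subseteq> ?Q"
  proof
    fix z assume z: "z \<in> ?G"
    then have zs: "supp z \<subseteq> D \<union> W" "supp z \<noteq> D \<union> W" "D \<subseteq> supp z" unfolding realization_iff[OF cB] by (auto simp: in_keys_iff)
    then have "supp z \<in> join_complex D W (Pow D) (Pow W - {W})" by (auto simp: join_complex_def)
    then show "z \<in> ?Q" using z unfolding realization_iff[OF cB] realization_iff[OF complex_on_join[OF cD cW]] by simp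
  qed
  have QB: "?Q \<subseteq> simplex_boundary (D \<union> W)"
    by (rule realization_mono) (auto simp: join_complex_def)
  have "manifold_point ?Q a"
    using manifold_point_simplex_boundary[OF fin aB] manifold_point_local[OF openin_coord_pos[OF D_finite] GQ QB aG] by simp
  then show ?thesis using st manifold_point_pl_iso[OF j, of a] ja by simp
qed

definition barycentre :: vec where "barycentre = (1 / card D) *\<^sub>R (\<Sum>i\<in>D. basis_vec i)"

lemma barycentre: "\<And>i. 0 \<le> coord barycentre i" "supp barycentre = D" "coord_sum barycentre = 1"
proof -
  have n: "0 < card D" using D D_finite by (simp add: card_gt_0_iff)
  have c: "coord barycentre i = (if i \<in> D then 1 / card D else 0)" for i
    using D_finite by (simp add: barycentre_def lookup_sum lookup_single when_def cong: if_cong)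
  show "0 \<le> coord barycentre i" for i by (simp add: c)
  show s: "supp barycentre = D"
  proof (rule Set.set_eqI)
    fix i show "i \<in> supp barycentre \<longleftrightarrow> i \<in> D" unfolding in_keys_iff c using n by simp
  qed
  have "coord_sum barycentre = (\<Sum>i\<in>D. 1 / card D)" unfolding coord_sum_def s by (rule sum.cong) (simp_all add: c)
  then show "coord_sum barycentre = 1" using n by simp
qed

lemma barycentre_simplex: "barycentre \<in> realization K" "barycentre \<in> cone_over (full_simplex D)"
  unfolding realization_iff[OF K] cone_over_realization_iff[OF cD Pow_bottom] barycentre(2)
  using barycentre(1,3) D(1) by blast+

lemma barycentre_not_manifold_point:
  assumes "ball_like (realization \<Lambda>)" shows "\<not> manifold_point (realization K) barycentre"
proof -
  obtain S' where S': "ball_pair (realization \<Lambda>) S'" using ball_imp_ball_pair[OF assms] by blast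
  obtain W f where W: "finite W" "W \<noteq> {}" "W \<inter> D = {}" and f: "pl_iso (realization \<Lambda>) (full_simplex W) f"
    by (rule ball_pair_fresh[OF S' D_finite])
  have "manifold_point (realization K) (barycentre + 0) \<longleftrightarrow> W \<subseteq> supp (homog f 0)"
    by (rule manifold_point_link_ball[OF W f barycentre_simplex(2) barycentre(2) zero_in_cone_over]) (simp add: barycentre)
  then show ?thesis using W(2) by simp
qed

end

lemma link_in_sphere_not_ball:
  assumes "complex_on V K" "D \<in> K" "D \<noteq> {}" "sphere_like (realization K)"
  shows "\<not> ball_like (realization (link K D))"
proof -
  interpret face_star V D K using assms by unfold_locales
  show ?thesis using barycentre_not_manifold_point manifold_point_sphere_like[OF assms(4) barycentre_simplex(1)] by blast
qed

text \<open>
  The barycentre of \<open>D\<close> is a boundary point of \<open>C\<close>, so the link of \<open>D\<close> in \<open>C\<close> is not a sphere. A point \<open>p\<close> of the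
  link belongs to the link in \<open>N\<close> iff the midpoint between \<open>p\<close> and the barycentre is a boundary point
  of \<open>C\<close>, and this is decided by whether \<open>p\<close> is a boundary point of the link.
\<close>

lemma ball_pair_link:
  assumes C: "complex_on V C" and N: "complex_on V N" and NC: "N \<subseteq> C"
    and pair: "ball_pair (realization C) (realization N)" and DN: "D \<in> N" "D \<noteq> {}"
    and bs: "ball_or_sphere (realization (link C D))"
  shows "ball_pair (realization (link C D)) (realization (link N D))"
proof -
  have DC: "D \<in> C" using DN(1) NC by blast
  interpret face_star V D C using C DC DN(2) by unfold_locales
  interpret N: face_star V D N using N DN by unfold_locales
  have mp: "manifold_point (realization C) x \<longleftrightarrow> x \<notin> realization N" if "x \<in> realization C" for x
  proof -
    obtain U h where U: "finite U" "U \<noteq> {}" "pl_iso (realization C) (full_simplex U) h"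
      "realization N \<subseteq> realization C" "h ` realization N = simplex_boundary U"
      using pair unfolding ball_pair_def by blast
    show ?thesis by (rule manifold_point_ball_pair[OF U(3,5,4,1,2) that])
  qed
  have bN: "barycentre \<in> realization N" unfolding realization_iff[OF N] barycentre(2) using barycentre(1,3) DN(1) by blast
  then have "\<not> manifold_point (realization C) barycentre" using mp[OF barycentre_simplex(1)] by simp
  then have "\<not> sphere_like (realization \<Lambda>)"
    using manifold_point_link_sphere[OF _ barycentre_simplex(1) barycentre(2)] by blast
  then have "ball_like (realization \<Lambda>)" using bs by blast
  then obtain S' where S': "ball_pair (realization \<Lambda>) S'" using ball_imp_ball_pair by blast
  obtain W f where W: "finite W" "W \<noteq> {}" "W \<inter> D = {}" and f: "pl_iso (realization \<Lambda>) (full_simplex W) f"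
    by (rule ball_pair_fresh[OF S' D_finite])
  have sub: "link N D \<subseteq> link C D" using NC by (auto simp: link_def)
  have half_nonzero: "1/2 \<noteq> (0::real)" by simp
  have key: "p \<in> realization (link N D) \<longleftrightarrow> f p \<in> simplex_boundary W" if p: "p \<in> realization \<Lambda>" for p
  proof -
    have ps: "coord_sum p = 1" "supp p \<in> \<Lambda>" "\<And>i. 0 \<le> coord p i" using p realization_iff[OF cL] by auto
    let ?a = "(1/2) *\<^sub>R barycentre" and ?w = "(1/2) *\<^sub>R p"
    have sa: "supp ?a = D" "supp ?w = supp p" by (simp_all only: supp_scaleR[OF half_nonzero] barycentre(2))
    have a: "?a \<in> cone_over (full_simplex D)"
      unfolding cone_over_realization_iff[OF cD Pow_bottom] sa using barycentre(1) by simp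
    have w: "?w \<in> cone_over (realization \<Lambda>)" using p by (intro scaleR_in_cone_over) auto
    have s: "coord_sum (?a + ?w) = 1" using barycentre(3) ps(1) by simp
    have nn: "\<And>i. 0 \<le> coord ?a i" "\<And>i. 0 \<le> coord ?w i" using barycentre(1) ps(3) by simp_all
    have z: "?a + ?w \<in> realization C" using manifold_point_star(1)[OF a sa(1) w s] star_subset by blast
    have fp: "f p \<in> full_simplex W" using pl_iso_image[OF f] p by blast
    have hw: "homog f ?w = (1/2) *\<^sub>R f p" by (rule homog_scaleR[OF ps(1)])
    have "p \<in> realization (link N D) \<longleftrightarrow> supp p \<in> link N D"
      unfolding realization_iff[OF N.cL] using ps by simp
    also have "\<dots> \<longleftrightarrow> D \<union> supp p \<in> N" using ps(2) by (auto simp: link_def)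
    also have "\<dots> \<longleftrightarrow> ?a + ?w \<in> realization N"
      unfolding realization_iff[OF N] supp_add_nonneg[OF nn] sa using s nn by (simp add: lookup_add)
    also have "\<dots> \<longleftrightarrow> \<not> W \<subseteq> supp (homog f ?w)"
      using mp[OF z] manifold_point_link_ball[OF W f a sa(1) w s] by simp
    also have "\<dots> \<longleftrightarrow> f p \<in> simplex_boundary W"
      unfolding simplex_boundary_iff[OF W(1) fp] hw by (auto simp: in_keys_iff)
    finally show ?thesis .
  qed
  have "f ` realization (link N D) = simplex_boundary W"
  proof
    show "f ` realization (link N D) \<subseteq> simplex_boundary W"
    proof (rule image_subsetI)
      fix p assume p: "p \<in> realization (link N D)"
      then have "p \<in> realization \<Lambda>" using realization_mono[OF sub] by blast
      then show "f p \<in> simplex_boundary W" using key p by simp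
    qed
    show "simplex_boundary W \<subseteq> f ` realization (link N D)"
    proof
      fix y assume y: "y \<in> simplex_boundary W"
      then have "y \<in> full_simplex W" using realization_mono[OF Diff_subset] by blast
      then have "y \<in> f ` realization \<Lambda>" using pl_iso_image[OF f] by simp
      then obtain p where p: "p \<in> realization \<Lambda>" "y = f p" by blast
      then show "y \<in> f ` realization (link N D)" using key[OF p(1)] y by simp
    qed
  qed
  then show ?thesis unfolding ball_pair_def using W f realization_mono[OF sub] by blast
qed

section \<open>PL balls and spheres without recursion\<close>

lemma scpx_iff_complex_on: "scpx n K \<longleftrightarrow> complex_on {1..n} K"
  by (simp add: scpx_def complex_on_def)

lemma standard_labels:
  assumes "finite V" "V \<noteq> {}"
  obtains \<sigma> d where "inj_on \<sigma> V" "\<sigma> ` V = {1..d + 1 :: nat}"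
proof -
  have "card {1..(card V - 1) + 1} = card V" using assms by (simp add: card_gt_0_iff Suc_leI)
  then obtain \<sigma> where "bij_betw \<sigma> V {1..(card V - 1) + 1}" using assms(1) finite_same_card_bij by (metis finite_atLeastAtMost)
  then show ?thesis using that by (auto simp: bij_betw_def)
qed

lemma ball_like_iff: "ball_like S \<longleftrightarrow> (\<exists>d. pl_homeomorphic S (std_ball d))"
proof
  assume "ball_like S"
  then obtain V f where V: "finite V" "V \<noteq> {}" "pl_iso S (full_simplex V) f" unfolding ball_like_def by blast
  obtain \<sigma> and d :: nat where \<sigma>: "inj_on \<sigma> V" "\<sigma> ` V = {1..d + 1}" by (rule standard_labels[OF V(1,2)])
  have "pl_iso S (std_ball d) (push \<sigma> \<circ> f)"
    unfolding std_ball_def \<sigma>(2)[symmetric] by (rule pl_iso_comp[OF V(3) pl_iso_simplex_push(1)[OF V(1) \<sigma>(1)]])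
  then show "\<exists>d. pl_homeomorphic S (std_ball d)" unfolding pl_homeomorphic_iff by blast
next
  assume "\<exists>d. pl_homeomorphic S (std_ball d)"
  then obtain d f where "pl_iso S (full_simplex {1..d+1}) f" unfolding pl_homeomorphic_iff std_ball_def by blast
  then show "ball_like S" unfolding ball_like_def by (intro exI[of _ "{1..d+1}"] exI[of _ f]) simp
qed

lemma sphere_like_iff: "sphere_like S \<longleftrightarrow> (\<exists>d. pl_homeomorphic S (std_sphere d))"
proof
  assume "sphere_like S"
  then obtain V f where V: "finite V" "V \<noteq> {}" "pl_iso S (simplex_boundary V) f" unfolding sphere_like_def by blast
  obtain \<sigma> and d :: nat where \<sigma>: "inj_on \<sigma> V" "\<sigma> ` V = {1..d + 1}" by (rule standard_labels[OF V(1,2)])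
  have "pl_iso S (std_sphere d) (push \<sigma> \<circ> f)"
    unfolding std_sphere_def \<sigma>(2)[symmetric] by (rule pl_iso_comp[OF V(3) pl_iso_simplex_push(2)[OF V(1) \<sigma>(1)]])
  then show "\<exists>d. pl_homeomorphic S (std_sphere d)" unfolding pl_homeomorphic_iff by blast
next
  assume "\<exists>d. pl_homeomorphic S (std_sphere d)"
  then obtain d f where "pl_iso S (simplex_boundary {1..d+1}) f" unfolding pl_homeomorphic_iff std_sphere_def by blast
  then show "sphere_like S" unfolding sphere_like_def by (intro exI[of _ "{1..d+1}"] exI[of _ f]) simp
qed

lemma is_boundary_iff:
  "is_boundary n B L \<longleftrightarrow> scpx n L \<and> L \<subseteq> B \<and> {} \<in> L \<and> ball_pair (realization B) (realization L)"
proof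
  assume "is_boundary n B L"
  then obtain d f g where *: "scpx n L" "L \<subseteq> B" "{} \<in> L" and f: "pl_homeomorphism (realization B) (std_ball d) f g"
    "f ` realization L = std_sphere d" unfolding is_boundary_def by blast
  have "ball_pair (realization B) (realization L)" unfolding ball_pair_def
    using pl_homeomorphism_imp_pl_iso[OF f(1)] f(2) realization_mono[OF *(2)]
    by (intro exI[of _ "{1..d+1}"] exI[of _ f]) (simp add: std_ball_def std_sphere_def)
  then show "scpx n L \<and> L \<subseteq> B \<and> {} \<in> L \<and> ball_pair (realization B) (realization L)" using * by blast
next
  assume *: "scpx n L \<and> L \<subseteq> B \<and> {} \<in> L \<and> ball_pair (realization B) (realization L)"
  then obtain V f where V: "finite V" "V \<noteq> {}" "pl_iso (realization B) (full_simplex V) f" "f ` realization L = simplex_boundary V"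
    unfolding ball_pair_def by blast
  have "card {1..(card V - 1) + 1} = card V" using V by (simp add: card_gt_0_iff Suc_leI)
  then obtain g where "pl_iso (realization B) (full_simplex {1..(card V - 1) + 1}) g"
    "g ` realization L = simplex_boundary {1..(card V - 1) + 1}"
    using ball_pair_relabel[OF V(3,4,1) finite_atLeastAtMost] by blast
  then have "pl_homeomorphism (realization B) (std_ball (card V - 1)) g (inv_into (realization B) g)"
    "g ` realization L = std_sphere (card V - 1)"
    unfolding std_ball_def std_sphere_def by (simp_all only: pl_iso_imp_pl_homeomorphism)
  then show "is_boundary n B L" using * unfolding is_boundary_def by blast
qed

lemma link_empty [simp]: "link K {} = K"
  by (auto simp: link_def)

lemma link_link: "J \<in> link K I \<Longrightarrow> link (link K I) J = link K (I \<union> J)"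
proof (rule Set.set_eqI)
  fix X assume "J \<in> link K I"
  then have "I \<inter> J = {}" by (simp add: link_def)
  then show "X \<in> link (link K I) J \<longleftrightarrow> X \<in> link K (I \<union> J)"
    unfolding link_def mem_Collect_eq Un_assoc Int_Un_distrib Int_Un_distrib2 Un_empty by auto
qed

lemma mem_linkD: "J \<in> link K I \<Longrightarrow> I \<union> J \<in> K"
  by (simp add: link_def)

lemma card_link_less:
  assumes "complex_on V K" "I \<in> K" "I \<noteq> {}"
  shows "card (link K I) < card K"
proof (rule psubset_card_mono)
  show "finite K" by (rule complex_onD(5)[OF assms(1)])
  have "link K I \<subseteq> K" using complex_onD(3)[OF assms(1)] unfolding link_def by blast
  moreover have "I \<notin> link K I" using assms(3) by (simp add: link_def)
  ultimately show "link K I \<subset> K" using assms(2) by blast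
qed

lemma scpx_link: "scpx n K \<Longrightarrow> scpx n (link K I)"
  unfolding scpx_iff_complex_on
  by (erule complex_on_mono[OF complex_on_link]) simp_all

lemma pl_sphere_imp_sphere_like: "pl_sphere n K \<Longrightarrow> sphere_like (realization K)"
  unfolding sphere_like_iff by (erule pl_sphere.cases) (rule exI, simp only:)

lemma pl_ball_imp_ball_like: "pl_ball n K \<Longrightarrow> ball_like (realization K)"
  unfolding ball_like_iff by (erule pl_ball.cases) (rule exI, simp only:)

lemma pl_sphereI:
  "scpx n K \<Longrightarrow> {} \<in> K \<Longrightarrow> \<forall>I\<in>K. sphere_like (realization (link K I)) \<Longrightarrow> pl_sphere n K"
proof (induction "card K" arbitrary: K rule: less_induct)
  case less
  have cK: "complex_on {1..n} K" using less.prems by (simp add: scpx_iff_complex_on)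
  have "sphere_like (realization K)" using less.prems(2,3) link_empty by metis
  then obtain d where d: "pl_homeomorphic (realization K) (std_sphere d)" using sphere_like_iff by blast
  have "pl_sphere n (link K I)" if I: "I \<in> K" "I \<noteq> {}" for I
  proof (rule less.hyps[OF card_link_less[OF cK I] scpx_link[OF less.prems(1)] empty_in_link[OF I(1)]], rule ballI)
    fix J assume "J \<in> link K I"
    then show "sphere_like (realization (link (link K I) J))" using less.prems(3) mem_linkD by (simp add: link_link)
  qed
  then show ?case using pl_sphere.intros[OF less.prems(1,2) d] by blast
qed

text \<open>
  Links of links are links, so the recursion in \<open>pl_sphere\<close> and \<open>pl_ball\<close> unwinds to a condition on the
  realizations of all links. For \<open>pl_ball\<close> this needs that a link which is a sphere has spheres as its own
  links, not balls; this is \<open>link_in_sphere_not_ball\<close>.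
\<close>

definition ball_or_sphere_links :: "nat set set \<Rightarrow> bool" where
  "ball_or_sphere_links K \<longleftrightarrow>
     (\<forall>I\<in>K. I \<noteq> {} \<longrightarrow> ball_or_sphere (realization (link K I)))"

lemma ball_or_sphere_linksD:
  "ball_or_sphere_links K \<Longrightarrow> I \<in> K \<Longrightarrow> I \<noteq> {} \<Longrightarrow>
    ball_or_sphere (realization (link K I))"
  by (simp add: ball_or_sphere_links_def)

lemma ball_or_sphere_links_link:
  assumes "ball_or_sphere_links K" "I \<noteq> {}" shows "ball_or_sphere_links (link K I)"
  unfolding ball_or_sphere_links_def
proof (intro ballI impI)
  fix J assume J: "J \<in> link K I"
  have "I \<union> J \<in> K" "I \<union> J \<noteq> {}" using mem_linkD[OF J] assms(2) by auto
  then show "ball_or_sphere (realization (link (link K I) J))"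
    unfolding link_link[OF J] using assms(1)[unfolded ball_or_sphere_links_def, rule_format] by blast
qed

lemma pl_sphere_of_links:
  assumes "scpx n K" "{} \<in> K" "sphere_like (realization K)" "ball_or_sphere_links K"
  shows "pl_sphere n K"
proof (rule pl_sphereI[OF assms(1,2)], rule ballI)
  fix I assume I: "I \<in> K"
  show "sphere_like (realization (link K I))"
  proof (cases "I = {}")
    case False
    have "\<not> ball_like (realization (link K I))"
      using link_in_sphere_not_ball[OF assms(1)[unfolded scpx_iff_complex_on] I False assms(3)] .
    then show ?thesis using ball_or_sphere_linksD[OF assms(4) I False] by simp
  qed (use assms(3) in simp)
qed

lemma pl_ball_of_links:
  "scpx n K \<Longrightarrow> ball_like (realization K) \<Longrightarrow> ball_or_sphere_links K \<Longrightarrow> pl_ball n K"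
proof (induction "card K" arbitrary: K rule: less_induct)
  case less
  have cK: "complex_on {1..n} K" using less.prems by (simp add: scpx_iff_complex_on)
  obtain d where d: "pl_homeomorphic (realization K) (std_ball d)" using less.prems(2) ball_like_iff by blast
  have "pl_sphere n (link K I) \<or> pl_ball n (link K I)" if I: "I \<in> K" "I \<noteq> {}" for I
  proof -
    note l = scpx_link[OF less.prems(1), of I] ball_or_sphere_links_link[OF less.prems(3) I(2)]
    have "ball_or_sphere (realization (link K I))"
      by (rule ball_or_sphere_linksD[OF less.prems(3) I])
    then show ?thesis
    proof
      assume "ball_like (realization (link K I))"
      then show ?thesis using less.hyps[OF card_link_less[OF cK I] l(1) _ l(2)] by blast
    next
      assume "sphere_like (realization (link K I))"
      then show ?thesis using pl_sphere_of_links[OF l(1) empty_in_link[OF I(1)] _ l(2)] by blast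
    qed
  qed
  then show ?case using pl_ball.intros[OF less.prems(1) d] by blast
qed

lemma pl_ball_iff:
  "pl_ball n K \<longleftrightarrow> scpx n K \<and> ball_like (realization K) \<and> ball_or_sphere_links K"
proof
  assume b: "pl_ball n K"
  have 1: "scpx n K" using b by (rule pl_ball.cases) (hypsubst, assumption)
  have 2: "\<forall>I\<in>K. I \<noteq> {} \<longrightarrow> pl_sphere n (link K I) \<or> pl_ball n (link K I)"
    using b by (rule pl_ball.cases) (hypsubst, assumption)
  have "ball_or_sphere_links K" unfolding ball_or_sphere_links_def
    using 2 pl_sphere_imp_sphere_like pl_ball_imp_ball_like by blast
  then show "scpx n K \<and> ball_like (realization K) \<and> ball_or_sphere_links K"
    using 1 pl_ball_imp_ball_like[OF b] by blast
next
  assume "scpx n K \<and> ball_like (realization K) \<and> ball_or_sphere_links K"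
  then show "pl_ball n K" by (intro pl_ball_of_links) simp_all
qed

section \<open>Pairs of a ball and its boundary\<close>

definition pl_ball_pair :: "nat set \<Rightarrow> nat set set \<Rightarrow> nat set set \<Rightarrow> bool" where
  "pl_ball_pair V B L \<longleftrightarrow> complex_on V B \<and> complex_on V L \<and> L \<subseteq> B \<and> {} \<in> L \<and>
     ball_pair (realization B) (realization L) \<and> ball_or_sphere_links B"

lemma pl_ball_pairD:
  assumes "pl_ball_pair V B L"
  shows "complex_on V B" "complex_on V L" "L \<subseteq> B" "{} \<in> L" "{} \<in> B" "ball_pair (realization B) (realization L)"
    "ball_or_sphere_links B" "sphere_like (realization L)" "ball_like (realization B)"
proof -
  show 1: "complex_on V B" "complex_on V L" "L \<subseteq> B" "{} \<in> L" "ball_pair (realization B) (realization L)" "ball_or_sphere_links B"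
    using assms unfolding pl_ball_pair_def by simp_all
  show "{} \<in> B" using 1(3,4) by blast
  show "sphere_like (realization L)" by (rule ball_pair_imp_sphere[OF 1(5) polyhedral_realization[OF 1(2)]])
  show "ball_like (realization B)" by (rule ball_pair_imp_ball[OF 1(5)])
qed

lemma neat_pl_pairs_iff:
  "(B, L) \<in> neat_pl_pairs n \<longleftrightarrow>
     (1 \<le> n \<and> pl_ball_pair {1..n} B L \<and> vertices B \<subseteq> vertices L) \<or> (n = 1 \<and> (B, L) = rel_unit)"
proof -
  have "((B, L) \<in> relscpx n \<and> pl_ball n B \<and> is_boundary n B L) \<longleftrightarrow> (1 \<le> n \<and> pl_ball_pair {1..n} B L)"
    unfolding relscpx_def pl_ball_iff is_boundary_iff pl_ball_pair_def scpx_iff_complex_on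
    using ball_pair_imp_ball[of "realization B" "realization L"] by (simp, blast)
  moreover have "(B, L) \<in> (if n = 1 then {rel_unit} else {}) \<longleftrightarrow> n = 1 \<and> (B, L) = rel_unit" by simp
  ultimately show ?thesis unfolding neat_pl_pairs_def Un_iff mem_Collect_eq prod.case by metis
qed

lemma link_image:
  assumes K: "K \<subseteq> Pow V" and inj: "inj_on \<sigma> V" and I: "I \<in> K"
  shows "link ((`) \<sigma> ` K) (\<sigma> ` I) = (`) \<sigma> ` link K I"
proof
  have IV: "I \<subseteq> V" using K I by blast
  show "link ((`) \<sigma> ` K) (\<sigma> ` I) \<subseteq> (`) \<sigma> ` link K I"
  proof
    fix J' assume "J' \<in> link ((`) \<sigma> ` K) (\<sigma> ` I)"
    then obtain X where X: "X \<in> K" "\<sigma> ` I \<union> J' = \<sigma> ` X" and d: "\<sigma> ` I \<inter> J' = {}" unfolding link_def by blast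
    have XV: "X \<subseteq> V" using K X by blast
    have "\<sigma> ` I \<subseteq> \<sigma> ` X" unfolding X(2)[symmetric] by blast
    then have IX: "I \<subseteq> X" using inj_on_image_subset_iff[OF inj IV XV] by simp
    have "\<sigma> ` (X - I) = \<sigma> ` X - \<sigma> ` I" by (rule inj_on_image_set_diff[OF inj]) (use XV IV in auto)
    also have "\<dots> = J'" unfolding X(2)[symmetric] using d by blast
    finally have "J' = \<sigma> ` (X - I)" by simp
    moreover have "X - I \<in> link K I" using X(1) IX by (simp add: link_def Un_absorb1)
    ultimately show "J' \<in> (`) \<sigma> ` link K I" by (simp only: imageI)
  qed
  show "(`) \<sigma> ` link K I \<subseteq> link ((`) \<sigma> ` K) (\<sigma> ` I)"
  proof
    fix J' assume "J' \<in> (`) \<sigma> ` link K I"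
    then obtain J where J: "J' = \<sigma> ` J" "I \<inter> J = {}" "I \<union> J \<in> K" unfolding link_def by blast
    have "\<sigma> ` I \<inter> \<sigma> ` J = {}" using inj_on_image_Int[OF inj IV, of J] J K by auto
    moreover have "\<sigma> ` I \<union> \<sigma> ` J \<in> (`) \<sigma> ` K" using J(3) by (simp only: image_Un[symmetric] imageI)
    ultimately show "J' \<in> link ((`) \<sigma> ` K) (\<sigma> ` I)" unfolding link_def J(1) by blast
  qed
qed

text \<open>
  This serves for the action of permutations and for the embeddings of the ground sets into the
  inputs of a composite.
\<close>

lemma pl_ball_pair_image:
  assumes p: "pl_ball_pair V B L" and inj: "inj_on \<sigma> V"
  shows "pl_ball_pair (\<sigma> ` V) ((`) \<sigma> ` B) ((`) \<sigma> ` L)"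
proof -
  note d = pl_ball_pairD[OF p]
  let ?B = "(`) \<sigma> ` B" and ?L = "(`) \<sigma> ` L"
  have inv: "pl_iso (realization ((`) \<sigma> ` K)) (realization K) (inv_into (realization K) (push \<sigma>))"
    if "complex_on V K" for K by (rule pl_iso_inverse[OF pl_iso_push[OF that inj]])
  have LB: "realization L \<subseteq> realization B" by (rule realization_mono[OF d(3)])
  have "inv_into (realization B) (push \<sigma>) ` realization ?L = realization L"
    unfolding pl_iso_image[OF pl_iso_push[OF d(2) inj], symmetric]
    by (rule inv_into_image_cancel[OF pl_iso_inj_on[OF pl_iso_push[OF d(1) inj]] LB])
  then have 1: "ball_pair (realization ?B) (realization ?L)"
    by (rule ball_pair_pl_iso[OF d(6) inv[OF d(1)] realization_mono[OF image_mono[OF d(3)]]])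
  have 2: "ball_or_sphere_links ?B" unfolding ball_or_sphere_links_def
  proof (intro ballI impI)
    fix I' assume "I' \<in> ?B" "I' \<noteq> {}"
    then obtain I where I: "I' = \<sigma> ` I" "I \<in> B" "I \<noteq> {}" by blast
    have "link ?B I' = (`) \<sigma> ` link B I" unfolding I(1)
      by (rule link_image[OF _ inj I(2)]) (use d(1) in \<open>simp add: complex_on_def\<close>)
    moreover have cl: "complex_on V (link B I)"
      by (rule complex_on_mono[OF complex_on_link[OF d(1)]]) (use complex_onD(1)[OF d(1)] in auto)
    moreover have "ball_or_sphere (realization (link B I))"
      by (rule ball_or_sphere_linksD[OF d(7) I(2,3)])
    ultimately show "ball_or_sphere (realization (link ?B I'))"
      using ball_pl_iso[OF _ inv[OF cl]] sphere_pl_iso[OF _ inv[OF cl]] by auto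
  qed
  have 3: "{} \<in> ?L" using imageI[OF d(4), of "(`) \<sigma>"] by simp
  show ?thesis unfolding pl_ball_pair_def
    by (intro conjI complex_on_image d(1,2) image_mono d(3) 1 2 3)
qed

section \<open>Links in a replacement\<close>

locale replacement =
  fixes v :: nat and V I :: "nat set" and X X' C N :: "nat set set"
  assumes X: "pl_ball_pair (insert v V) X X'" and C: "pl_ball_pair I C N"
    and VI: "V \<inter> I = {}" and v: "v \<notin> V \<union> I"
begin

lemma v': "v \<notin> V" "v \<notin> I" using v by auto

lemma finV: "finite V" using complex_onD(1)[OF pl_ball_pairD(1)[OF X]] by simp

lemma insert_v_disjoint: "insert v V \<inter> I = {}" using v VI by auto

lemma complex_link_X: "complex_on (insert v V) (link X A)"
  by (rule complex_on_mono[OF complex_on_link[OF pl_ball_pairD(1)[OF X]]]) (use finV in auto)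

lemma complex_link_C: "complex_on I (link C D)" "complex_on I (link N D)"
  using complex_onD(1)[OF pl_ball_pairD(1)[OF C]]
    complex_on_mono[OF complex_on_link[OF pl_ball_pairD(1)[OF C]] Diff_subset]
    complex_on_mono[OF complex_on_link[OF pl_ball_pairD(2)[OF C]] Diff_subset] by simp_all

lemma ball_pair_link_C:
  assumes "D \<in> N"
  shows "ball_pair (realization (link C D)) (realization (link N D))"
proof (cases "D = {}")
  case True then show ?thesis using pl_ball_pairD(6)[OF C] by simp
next
  case False
  have "D \<in> C" using assms pl_ball_pairD(3)[OF C] by blast
  then have "ball_or_sphere (realization (link C D))"
    by (rule ball_or_sphere_linksD[OF pl_ball_pairD(7)[OF C] _ False])
  then show ?thesis by (rule ball_pair_link[OF pl_ball_pairD(1,2,3,6)[OF C] assms False])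
qed

text \<open>
  If the part of \<open>J\<close> in \<open>I\<close> is interior in \<open>C\<close>, so is the part of every larger face, which excludes
  the second kind of faces.
\<close>

lemma link_replace_interior:
  assumes "J \<inter> I \<notin> N" "J \<subseteq> V \<union> I"
  shows "link (replace_complex v V I X C N) J = join_complex V I (link X (insert v (J \<inter> V))) (link C (J \<inter> I))"
proof (rule Set.set_eqI)
  fix J'
  have a: "(J \<union> J') \<inter> V = (J \<inter> V) \<union> (J' \<inter> V)" "(J \<union> J') \<inter> I = (J \<inter> I) \<union> (J' \<inter> I)" by blast+
  have b: "J \<union> J' \<subseteq> V \<union> I \<longleftrightarrow> J' \<subseteq> V \<union> I" using assms(2) by blast
  have c: "(J \<inter> I) \<union> (J' \<inter> I) \<notin> N" using complex_onD(3)[OF pl_ball_pairD(2)[OF C], of "(J \<inter> I) \<union> (J' \<inter> I)" "J \<inter> I"] assms(1) by blast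
  have d: "J \<inter> J' = {} \<longleftrightarrow> insert v (J \<inter> V) \<inter> (J' \<inter> V) = {} \<and> (J \<inter> I) \<inter> (J' \<inter> I) = {}" if "J' \<subseteq> V \<union> I"
    using that assms(2) v' by blast
  have e: "insert v ((J \<inter> V) \<union> (J' \<inter> V)) = insert v (J \<inter> V) \<union> (J' \<inter> V)" by blast
  show "J' \<in> link (replace_complex v V I X C N) J \<longleftrightarrow> J' \<in> join_complex V I (link X (insert v (J \<inter> V))) (link C (J \<inter> I))"
    unfolding replace_complex_def join_complex_def link_def mem_Collect_eq a b e using c d by satx
qed

lemma link_replace_boundary:
  assumes "J \<subseteq> V \<union> I"
  shows "link (replace_complex v V I X C N) J = replace_complex v V I (link X (J \<inter> V)) (link C (J \<inter> I)) (link N (J \<inter> I))"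
proof (rule Set.set_eqI)
  fix J'
  have a: "(J \<union> J') \<inter> V = (J \<inter> V) \<union> (J' \<inter> V)" "(J \<union> J') \<inter> I = (J \<inter> I) \<union> (J' \<inter> I)" by blast+
  have b: "J \<union> J' \<subseteq> V \<union> I \<longleftrightarrow> J' \<subseteq> V \<union> I" using assms by blast
  have d: "J \<inter> J' = {} \<longleftrightarrow> (J \<inter> V) \<inter> (J' \<inter> V) = {} \<and> (J \<inter> I) \<inter> (J' \<inter> I) = {}" if "J' \<subseteq> V \<union> I"
    using that assms v' by blast
  have d': "(J \<inter> V) \<inter> insert v (J' \<inter> V) = {} \<longleftrightarrow> (J \<inter> V) \<inter> (J' \<inter> V) = {}" using v' by blast
  have e: "insert v ((J \<inter> V) \<union> (J' \<inter> V)) = (J \<inter> V) \<union> insert v (J' \<inter> V)" by blast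
  show "J' \<in> link (replace_complex v V I X C N) J \<longleftrightarrow>
      J' \<in> replace_complex v V I (link X (J \<inter> V)) (link C (J \<inter> I)) (link N (J \<inter> I))"
    unfolding replace_complex_def link_def mem_Collect_eq a b e d' using d by satx
qed

text \<open>
  In the interior case the link is a join of two balls or spheres. In the boundary case it is itself a composite, and
  \<open>pl_iso_replace\<close> turns it into the join of a ball or sphere with the boundary sphere of the link in \<open>C\<close>.
\<close>

lemma ball_or_sphere_links_replace: "ball_or_sphere_links (replace_complex v V I X C N)"
  unfolding ball_or_sphere_links_def
proof (intro ballI impI)
  let ?T = "replace_complex v V I X C N"
  fix J assume J: "J \<in> ?T" "J \<noteq> {}"
  have JVI: "J \<subseteq> V \<union> I" using J(1) by (auto simp: replace_complex_def)
  show "ball_or_sphere (realization (link ?T J))"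
  proof (cases "J \<inter> I \<in> N")
    case False
    then have JJ: "insert v (J \<inter> V) \<in> X" "J \<inter> I \<in> C" using J(1) by (auto simp: replace_complex_def)
    have ne: "J \<inter> I \<noteq> {}" using False pl_ball_pairD(4)[OF C] by metis
    let ?A = "link X (insert v (J \<inter> V))" and ?D = "link C (J \<inter> I)"
    have cA: "complex_on V ?A"
      by (rule complex_on_mono[OF complex_on_link[OF pl_ball_pairD(1)[OF X]]]) (use finV in auto)
    have "realization (link ?T J) = join_set (realization ?A) (realization ?D)"
      unfolding link_replace_interior[OF False JVI]
      by (rule realization_join[OF cA empty_in_link[OF JJ(1)] complex_link_C(1) empty_in_link[OF JJ(2)] VI])
    moreover have "ball_or_sphere (realization ?A)"
      by (rule ball_or_sphere_linksD[OF pl_ball_pairD(7)[OF X] JJ(1)]) simp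
    moreover have "ball_or_sphere (realization ?D)"
      by (rule ball_or_sphere_linksD[OF pl_ball_pairD(7)[OF C] JJ(2) ne])
    ultimately show ?thesis
      using ball_or_sphere_join[OF _ _ realization_subset_slice[OF cA] realization_subset_slice[OF complex_link_C(1)] VI] by simp
  next
    case True
    let ?A = "link X (J \<inter> V)" and ?D = "link C (J \<inter> I)" and ?E = "link N (J \<inter> I)"
    have JX: "J \<inter> V \<in> X"
      using J(1) complex_onD(3)[OF pl_ball_pairD(1)[OF X], of "insert v (J \<inter> V)" "J \<inter> V"] by (auto simp: replace_complex_def)
    have sub: "?E \<subseteq> ?D" using pl_ball_pairD(3)[OF C] by (auto simp: link_def)
    note pair = ball_pair_link_C[OF True]
    obtain F where F: "pl_iso (realization (join_complex (insert v V) I ?A ?E)) (realization (replace_complex v V I ?A ?D ?E)) F"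
      using pl_iso_replace[OF complex_link_C(1,2) empty_in_link[OF True] sub finV VI v pair] complex_link_X by blast
    have "realization (join_complex (insert v V) I ?A ?E) = join_set (realization ?A) (realization ?E)"
      by (rule realization_join[OF complex_link_X empty_in_link[OF JX] complex_link_C(2) empty_in_link[OF True] insert_v_disjoint])
    then have inv: "pl_iso (realization (link ?T J)) (join_set (realization ?A) (realization ?E))
        (inv_into (realization (join_complex (insert v V) I ?A ?E)) F)"
      using pl_iso_inverse[OF F] unfolding link_replace_boundary[OF JVI] by simp
    have "ball_or_sphere (realization ?A)"
    proof (cases "J \<inter> V = {}")
      case True then show ?thesis using pl_ball_pairD(9)[OF X] by simp
    next
      case False then show ?thesis by (rule ball_or_sphere_linksD[OF pl_ball_pairD(7)[OF X] JX])
    qed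
    moreover have "sphere_like (realization ?E)"
      by (rule ball_pair_imp_sphere[OF pair polyhedral_realization[OF complex_link_C(2)]])
    ultimately have "ball_or_sphere (join_set (realization ?A) (realization ?E))"
      using ball_or_sphere_join[OF _ _ realization_subset_slice[OF complex_link_X] realization_subset_slice[OF complex_link_C(2)] insert_v_disjoint] by blast
    then show ?thesis using ball_pl_iso[OF _ inv] sphere_pl_iso[OF _ inv] by blast
  qed
qed

lemma pl_ball_pair_replace:
  "pl_ball_pair (V \<union> I) (replace_complex v V I X C N) (replace_complex v V I X' C N)"
proof -
  let ?T = "replace_complex v V I X C N" and ?T' = "replace_complex v V I X' C N"
  note x = pl_ball_pairD[OF X] and c = pl_ball_pairD[OF C]
  obtain F where F: "\<forall>Y. complex_on (insert v V) Y \<longrightarrow>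
      pl_iso (realization (join_complex (insert v V) I Y N)) (realization (replace_complex v V I Y C N)) F"
    by (rule pl_iso_replace[OF c(1,2,4,3) finV VI v c(6)])
  let ?S = "join_complex (insert v V) I X N" and ?S' = "join_complex (insert v V) I X' N"
  have F1: "pl_iso (realization ?S) (realization ?T) F" and F2: "pl_iso (realization ?S') (realization ?T') F"
    using F x(1,2) by blast+
  have SS: "realization ?S' \<subseteq> realization ?S" using x(3) by (intro realization_mono) (auto simp: join_complex_def)
  have TT: "?T' \<subseteq> ?T" using x(3) by (auto simp: replace_complex_def)
  have "ball_pair (join_set (realization X) (realization N)) (join_set (realization X') (realization N))"
    by (rule ball_pair_join_sphere[OF x(6) c(8) realization_subset_slice[OF x(1)] realization_subset_slice[OF c(2)] insert_v_disjoint])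
  then have "ball_pair (realization ?S) (realization ?S')"
    using realization_join[OF x(1,5) c(2,4) insert_v_disjoint] realization_join[OF x(2,4) c(2,4) insert_v_disjoint] by simp
  moreover have "inv_into (realization ?S) F ` realization ?T' = realization ?S'"
    unfolding pl_iso_image[OF F2, symmetric] by (rule inv_into_image_cancel[OF pl_iso_inj_on[OF F1] SS])
  ultimately have 1: "ball_pair (realization ?T) (realization ?T')"
    by (rule ball_pair_pl_iso[OF _ pl_iso_inverse[OF F1] realization_mono[OF TT]])
  have 2: "{} \<in> ?T'" using x(4) c(4) by (simp add: replace_complex_def)
  show ?thesis unfolding pl_ball_pair_def
    by (intro conjI complex_on_replace[OF x(1) c(1,2)] complex_on_replace[OF x(2) c(1,2)] TT ball_or_sphere_links_replace 1 2)
qed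

end

section \<open>The suboperad\<close>

lemma image_mem_image_iff:
  assumes "inj_on \<sigma> V" "K \<subseteq> Pow V" "Y \<subseteq> V"
  shows "\<sigma> ` Y \<in> (`) \<sigma> ` K \<longleftrightarrow> Y \<in> K"
  using inj_on_image_mem_iff[OF inj_on_image_Pow[OF assms(1)], of Y K] assms(2,3) by simp

text \<open>
  The vertex \<open>k\<close> that is replaced gets the label \<open>0\<close>, which no input of the composite has.
\<close>

definition outer_label :: "nat \<Rightarrow> nat \<Rightarrow> nat \<Rightarrow> nat" where
  "outer_label k m j = (if j = k then 0 else outer_pos k m j)"

lemma inj_on_outer_label: "k \<in> {1..n} \<Longrightarrow> 1 \<le> m \<Longrightarrow> inj_on (outer_label k m) {1..n}"
  by (auto simp: inj_on_def outer_label_def outer_pos_def split: if_splits)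

lemma inj_on_shift: "k \<in> {1..n} \<Longrightarrow> inj_on (\<lambda>b. b + k - 1) {1..m::nat}"
  by (auto simp: inj_on_def)

lemma composite_positions:
  assumes k: "k \<in> {1..n}" and m: "1 \<le> m"
  shows "{1..n+m-1} = outer_pos k m ` ({1..n} - {k}) \<union> (\<lambda>b. b + k - 1) ` {1..m}" (is "_ = ?V \<union> ?I")
proof
  show "{1..n+m-1} \<subseteq> ?V \<union> ?I"
  proof
    fix p assume "p \<in> {1..n+m-1}"
    then show "p \<in> ?V \<union> ?I" by (rule pos_cases[OF _ k m]) auto
  qed
  show "?V \<union> ?I \<subseteq> {1..n+m-1}" using k m by (auto simp: outer_pos_def)
qed

lemma triangle_join_eq_replace:
  assumes X: "scpx n X" and C: "scpx m C" "scpx m N" "N \<subseteq> C" and k: "k \<in> {1..n}" and m: "1 \<le> m"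
  shows "triangle_join n k m X (C, N) = replace_complex 0 (outer_pos k m ` ({1..n} - {k})) ((\<lambda>b. b + k - 1) ` {1..m})
    ((`) (outer_label k m) ` X) ((`) (\<lambda>b. b + k - 1) ` C) ((`) (\<lambda>b. b + k - 1) ` N)"
proof (rule Set.set_eqI)
  fix J
  let ?V = "outer_pos k m ` ({1..n} - {k})" and ?s = "\<lambda>b. b + k - 1"
  let ?I = "?s ` {1..m}"
  note injo = inj_on_outer_label[OF k m] and injs = inj_on_shift[OF k, of m]
  note U = composite_positions[OF k m]
  have o: "J \<inter> ?V = outer_label k m ` outer_part n k m J"
    by (auto simp: outer_part_def outer_label_def)
  have o': "insert 0 (J \<inter> ?V) = outer_label k m ` insert k (outer_part n k m J)"
    unfolding o image_insert by (simp add: outer_label_def[of k m k])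
  have i: "J \<inter> ?I = ?s ` inner_part k m J" by (auto simp: inner_part_def)
  have sub: "outer_part n k m J \<subseteq> {1..n}" "insert k (outer_part n k m J) \<subseteq> {1..n}" "inner_part k m J \<subseteq> {1..m}"
    using k by (auto simp: outer_part_def inner_part_def)
  have P: "X \<subseteq> Pow {1..n}" "C \<subseteq> Pow {1..m}" "N \<subseteq> Pow {1..m}" using X C by (auto simp: scpx_def)
  show "J \<in> triangle_join n k m X (C, N) \<longleftrightarrow> J \<in> replace_complex 0 ?V ?I ((`) (outer_label k m) ` X) ((`) ?s ` C) ((`) ?s ` N)"
    unfolding triangle_join_iff[OF X C k m] replace_complex_def mem_Collect_eq o' unfolding o i U
    image_mem_image_iff[OF injo P(1) sub(1)] image_mem_image_iff[OF injo P(1) sub(2)]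
    image_mem_image_iff[OF injs P(2) sub(3)] image_mem_image_iff[OF injs P(3) sub(3)] ..
qed

lemma pl_ball_pair_triangle_join:
  assumes X: "pl_ball_pair {1..n} X X'" and C: "pl_ball_pair {1..m} C N" and k: "k \<in> {1..n}" and m: "1 \<le> m"
  shows "pl_ball_pair {1..n+m-1} (triangle_join n k m X (C, N)) (triangle_join n k m X' (C, N))"
proof -
  note x = pl_ball_pairD[OF X] and c = pl_ball_pairD[OF C]
  let ?V = "outer_pos k m ` ({1..n} - {k})" and ?s = "\<lambda>b. b + k - 1"
  let ?I = "?s ` {1..m}"
  note injo = inj_on_outer_label[OF k m] and injs = inj_on_shift[OF k, of m]
  have oV: "outer_label k m ` {1..n} = insert 0 ?V" using k by (auto simp: outer_label_def)
  interpret replacement 0 ?V ?I "(`) (outer_label k m) ` X" "(`) (outer_label k m) ` X'" "(`) ?s ` C" "(`) ?s ` N"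
  proof
    show "pl_ball_pair (insert 0 ?V) ((`) (outer_label k m) ` X) ((`) (outer_label k m) ` X')"
      using pl_ball_pair_image[OF X injo] unfolding oV .
    show "pl_ball_pair ?I ((`) ?s ` C) ((`) ?s ` N)" by (rule pl_ball_pair_image[OF C injs])
    show "?V \<inter> ?I = {}" "0 \<notin> ?V \<union> ?I" using k m by (auto simp: outer_pos_def split: if_splits)
  qed
  note U = composite_positions[OF k m]
  note sc = x(1,2)[folded scpx_iff_complex_on] c(1,2)[folded scpx_iff_complex_on]
  show ?thesis
    unfolding U triangle_join_eq_replace[OF sc(1,3,4) c(3) k m] triangle_join_eq_replace[OF sc(2,3,4) c(3) k m]
    by (rule pl_ball_pair_replace)
qed

text \<open>
  A vertex of the composite comes from a vertex of \<open>X\<close>, and then lies in \<open>X'\<close>, or from a vertex of \<open>C\<close>, and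
  then lies in \<open>N\<close>. Both \<open>X'\<close> and \<open>N\<close> contain the empty face, so the other part causes no obstruction.
\<close>

lemma vertices_triangle_join:
  assumes X: "pl_ball_pair {1..n} X X'" and C: "pl_ball_pair {1..m} C N" and k: "k \<in> {1..n}" and m: "1 \<le> m"
    and nX: "vertices X \<subseteq> vertices X'" and nC: "vertices C \<subseteq> vertices N"
  shows "vertices (triangle_join n k m X (C, N)) \<subseteq> vertices (triangle_join n k m X' (C, N))"
proof
  note x = pl_ball_pairD[OF X] and c = pl_ball_pairD[OF C]
  note sc = x(1,2)[folded scpx_iff_complex_on] c(1,2)[folded scpx_iff_complex_on]
  note iff = triangle_join_iff[OF sc(1,3,4) c(3) k m] triangle_join_iff[OF sc(2,3,4) c(3) k m]
  fix p assume p: "p \<in> vertices (triangle_join n k m X (C, N))"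
  then have "p \<in> {1..n+m-1}" unfolding vertices_def mem_Collect_eq iff by blast
  then have "outer_part n k m {p} = {} \<or> inner_part k m {p} = {}"
    using k m by (auto simp: outer_part_def inner_part_def outer_pos_def)
  then show "p \<in> vertices (triangle_join n k m X' (C, N))"
  proof
    assume o: "outer_part n k m {p} = {}"
    have "inner_part k m {p} \<subseteq> {p + 1 - k}" using k by (auto simp: inner_part_def)
    then have "inner_part k m {p} = {} \<or> (\<exists>b. inner_part k m {p} = {b})" by blast
    then have "inner_part k m {p} \<in> N"
      using p nC c(3,4) unfolding vertices_def mem_Collect_eq iff o by auto
    then show ?thesis using p x(4) unfolding vertices_def mem_Collect_eq iff o by blast
  next
    assume i: "inner_part k m {p} = {}"
    have "outer_part n k m {p} \<subseteq> {if p < k then p else p + 1 - m}"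
      using k m by (auto simp: outer_part_def outer_pos_def split: if_splits)
    then have "outer_part n k m {p} = {} \<or> (\<exists>b. outer_part n k m {p} = {b})" by blast
    moreover have "outer_part n k m {p} \<in> X"
      using p complex_onD(3)[OF x(1), of "insert k (outer_part n k m {p})" "outer_part n k m {p}"]
      unfolding vertices_def mem_Collect_eq iff by blast
    ultimately have "outer_part n k m {p} \<in> X'" using nX x(4) by (auto simp: vertices_def)
    then show ?thesis using p c(4) unfolding vertices_def mem_Collect_eq iff i by blast
  qed
qed

lemma relabel_unit:
  assumes "\<sigma> permutes {1..1::nat}" shows "relabel \<sigma> rel_unit = rel_unit"
proof -
  have "\<sigma> 1 = 1" using permutes_in_image[OF assms, of 1] by simp
  then show ?thesis by (simp add: relabel_def rel_unit_def pt_def)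
qed

lemma neat_pl_pairs_relabel:
  assumes \<sigma>: "\<sigma> permutes {1..n}" and x: "x \<in> neat_pl_pairs n"
  shows "relabel \<sigma> x \<in> neat_pl_pairs n"
proof -
  obtain B L where BL: "x = (B, L)" by (cases x)
  from x[unfolded BL neat_pl_pairs_iff] show ?thesis
  proof
    assume a: "1 \<le> n \<and> pl_ball_pair {1..n} B L \<and> vertices B \<subseteq> vertices L"
    have "pl_ball_pair {1..n} ((`) \<sigma> ` B) ((`) \<sigma> ` L)"
      using pl_ball_pair_image[of "{1..n}" B L \<sigma>] a permutes_inj_on[OF \<sigma>] permutes_image[OF \<sigma>] by simp
    moreover have "vertices ((`) \<sigma> ` B) \<subseteq> vertices ((`) \<sigma> ` L)"
    proof
      fix i assume "i \<in> vertices ((`) \<sigma> ` B)"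
      then obtain I where I: "{i} = \<sigma> ` I" "I \<in> B" by (auto simp: vertices_def)
      then obtain j where j: "j \<in> I" "i = \<sigma> j" by blast
      have "I = {j}" using I(1) j permutes_inj[OF \<sigma>] by (auto dest: injD)
      then have "{j} \<in> L" using I(2) a by (auto simp: vertices_def)
      then have "\<sigma> ` {j} \<in> (`) \<sigma> ` L" by (rule imageI)
      then show "i \<in> vertices ((`) \<sigma> ` L)" using j(2) by (simp add: vertices_def)
    qed
    ultimately show ?thesis using a unfolding BL relabel_def prod.case neat_pl_pairs_iff by blast
  next
    assume a: "n = 1 \<and> (B, L) = rel_unit"
    then have "relabel \<sigma> x = rel_unit" using relabel_unit[of \<sigma>] \<sigma> BL by simp
    then show ?thesis using a by (simp add: neat_pl_pairs_def)
  qed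
qed

lemma neat_pl_pairs_subset: "neat_pl_pairs n \<subseteq> relscpx n"
  using unital_operad.unit_closed[OF unital_operad_relscpx] by (auto simp: neat_pl_pairs_def split: if_splits)

lemma neat_pl_pairs_comp:
  assumes x: "x \<in> neat_pl_pairs n" and y: "y \<in> neat_pl_pairs m" and k: "k \<in> {1..n}"
  shows "rel_comp n k m x y \<in> neat_pl_pairs (n + m - 1)"
proof -
  obtain B L where BL: "x = (B, L)" by (cases x)
  obtain C N where CN: "y = (C, N)" by (cases y)
  have xr: "x \<in> relscpx n" and yr: "y \<in> relscpx m" using x y neat_pl_pairs_subset by blast+
  consider "n = 1" "x = rel_unit" | "m = 1" "y = rel_unit"
    | "1 \<le> m" "pl_ball_pair {1..n} B L" "vertices B \<subseteq> vertices L" "pl_ball_pair {1..m} C N" "vertices C \<subseteq> vertices N"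
    using x y unfolding BL CN neat_pl_pairs_iff by blast
  then show ?thesis
  proof cases
    case 1
    then have "k = 1" using k by simp
    then show ?thesis using 1 y unital_operad.unit_left[OF unital_operad_relscpx yr] by simp
  next
    case 2
    then show ?thesis using x unital_operad.unit_right[OF unital_operad_relscpx xr k] by simp
  next
    case 3
    have "1 \<le> n + m - 1" using k 3(1) by auto
    then show ?thesis
      using pl_ball_pair_triangle_join[OF 3(2,4) k 3(1)] vertices_triangle_join[OF 3(2,4) k 3(1) 3(3,5)]
      unfolding BL CN rel_comp_def prod.case neat_pl_pairs_iff by blast
  qed
qed

theorem proposition4p19:
  shows "unital_suboperad relscpx (\<lambda>n. relabel) rel_comp rel_unit neat_pl_pairs"
proof -
  interpret unital_operad relscpx "\<lambda>n. relabel" rel_comp rel_unit by (rule unital_operad_relscpx)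
  show ?thesis
  proof unfold_locales
    show "neat_pl_pairs n \<subseteq> relscpx n" for n by (rule neat_pl_pairs_subset)
    show "relabel \<sigma> x \<in> neat_pl_pairs n" if "\<sigma> permutes {1..n}" "x \<in> neat_pl_pairs n" for \<sigma> n x
      using that by (rule neat_pl_pairs_relabel)
    show "rel_comp n k m x y \<in> neat_pl_pairs (n + m - 1)"
      if "x \<in> neat_pl_pairs n" "y \<in> neat_pl_pairs m" "k \<in> {1..n}" for x y n m k
      using that by (rule neat_pl_pairs_comp)
    show "rel_unit \<in> neat_pl_pairs 1" by (simp add: neat_pl_pairs_def)
  qed
qed

end
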